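(* Let $\Omega\subset\mathbb R^2$ be a bounded Lipschitz domain and let $m\colon\Omega\to\mathbb R^2$ satisfy $|m|=1$ a.e. in $\Omega$ and $\nabla\cdot m=0$ in $\mathcal D'(\Omega)$. If $m\in B^{1/3}_{3,c_0,\mathrm{loc}}(\Omega)$ (in particular, if $m\in B^{1/3}_{3,q,\mathrm{loc}}(\Omega)$ for some $q<\infty$), then $$\|\nabla\cdot\Phi(m)\|=0\qquad\text{for every }\Phi\in ENT,$$ and consequently $m$ is locally Lipschitz outside a locally finite set of points of $\Omega$.
   Context: $ENT$ is the set of all $\Phi\in C^2(S^1,\mathbb R^2)$ such that $e^{it}\cdot\frac{d}{dt}[\Phi(e^{it})]=0$ for all $t\in\mathbb R$ (with $\mathbb R^2\simeq\mathbb C$). $\|\mu\|$ is the total variation measure of $\mu$. For a domain $U$ and $f$ defined on $U$, let $D^zf(x)=f(x+z)-f(x)$ if $x,x+z\in U$ and $0$ otherwise, and $N_t(f,U)=\sup_{|z|\le t}t^{-1/3}\|D^zf\|_{L^3(U)}$. For $1\le q<\infty$, $f\in B^{1/3}_{3,q}(U)$ if $\|f\|_{L^3(U)}+\big(\int_0^1N_t(f,U)^q\frac{dt}{t}\big)^{1/q}<\infty$; $f\in B^{1/3}_{3,\infty}(U)$ if $\|f\|_{L^3(U)}+\sup_{0<t\le1}N_t(f,U)<\infty$; and $B^{1/3}_{3,c_0}(U)=\{f\in B^{1/3}_{3,\infty}(U):\lim_{t\to0}N_t(f,U)=0\}$. The local spaces are $B^{1/3}_{3,\ast,\mathrm{loc}}(\Omega)=\bigcap_{U\subset\subset\Omega}B^{1/3}_{3,\ast}(U)$;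 vector-valued functions are treated componentwise. "Locally Lipschitz" means that $m$ has a locally Lipschitz representative. *)

theory Defs
  imports "HOL-Analysis.Analysis"
begin

section \<open>Domains\<close>

definition compactly_contained :: "'a::metric_space set \<Rightarrow> 'a set \<Rightarrow> bool" where
  "compactly_contained U \<Omega> \<longleftrightarrow> compact (closure U) \<and> closure U \<subseteq> \<Omega>"

text \<open>Near every boundary point, \<open>\<Omega>\<close> is, in suitable orthonormal coordinates centred at
  that point, the set of points of a coordinate box that lie above a Lipschitz graph.\<close>

definition bounded_Lipschitz_domain :: "(real^2) set \<Rightarrow> bool" where
  "bounded_Lipschitz_domain \<Omega> \<longleftrightarrow>
     open \<Omega> \<and> connected \<Omega> \<and> \<Omega> \<noteq> {} \<and> bounded \<Omega> \<and>
     (\<forall>p\<in>frontier \<Omega>. \<exists>a b. norm a = 1 \<and> norm b = 1 \<and> a \<bullet> b = 0 \<and>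
        (\<exists>r>0. \<exists>h>0. \<exists>L g. L-lipschitz_on UNIV (g :: real \<Rightarrow> real) \<and>
           (\<forall>s t. \<bar>s\<bar> < r \<and> \<bar>t\<bar> < h \<longrightarrow>
              (p + s *\<^sub>R a + t *\<^sub>R b \<in> \<Omega> \<longleftrightarrow> g s < t))))"

section \<open>Test functions and the distributional divergence\<close>

primrec C_k :: "nat \<Rightarrow> (real^2 \<Rightarrow> real) \<Rightarrow> bool" where
  "C_k 0 f \<longleftrightarrow> continuous_on UNIV f"
| "C_k (Suc k) f \<longleftrightarrow>
     (\<exists>G :: real^2 \<Rightarrow> real^2.
        (\<forall>x. (f has_derivative (\<lambda>h. G x \<bullet> h)) (at x)) \<and> (\<forall>i. C_k k (\<lambda>x. G x $ i)))"

definition gradient :: "(real^2 \<Rightarrow> real) \<Rightarrow> real^2 \<Rightarrow> real^2" where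
  "gradient \<phi> x = (\<chi> i. frechet_derivative \<phi> (at x) (axis i 1))"

definition test_functions :: "(real^2) set \<Rightarrow> (real^2 \<Rightarrow> real) set" where
  "test_functions \<Omega> = {\<phi>. (\<forall>k. C_k k \<phi>) \<and> compactly_contained {x. \<phi> x \<noteq> 0} \<Omega>}"

text \<open>Integrals are taken with respect to the complete measure, so that \<open>\<Phi> \<circ> m\<close> with
  \<open>\<bar>m\<bar> = 1\<close> almost everywhere is measurable whatever values \<open>\<Phi>\<close> takes off the circle.\<close>

definition distr_div :: "(real^2) set \<Rightarrow> (real^2 \<Rightarrow> real^2) \<Rightarrow> (real^2 \<Rightarrow> real) \<Rightarrow> real" where
  "distr_div \<Omega> F \<phi> = - (\<integral>x. F x \<bullet> gradient \<phi> x \<partial>lebesgue_on \<Omega>)"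

section \<open>Signed Radon measures and total variation\<close>

definition radon_on :: "(real^2) set \<Rightarrow> (real^2) measure \<Rightarrow> bool" where
  "radon_on \<Omega> M \<longleftrightarrow> sets M = sets (restrict_space borel \<Omega>) \<and>
     (\<forall>K. compact K \<and> K \<subseteq> \<Omega> \<longrightarrow> emeasure M K < \<infinity>)"

text \<open>A (locally finite) signed Radon measure \<open>\<mu>\<close> on \<open>\<Omega>\<close> is given as a difference \<open>P - N\<close>
  of two positive ones; \<open>P\<close> and \<open>N\<close> need not be mutually singular.\<close>

definition divergence_is_measure ::
  "(real^2) set \<Rightarrow> (real^2 \<Rightarrow> real^2) \<Rightarrow> (real^2) measure \<Rightarrow> (real^2) measure \<Rightarrow> bool" where
  "divergence_is_measure \<Omega> F P N \<longleftrightarrow> radon_on \<Omega> P \<and> radon_on \<Omega> N \<and>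
     (\<forall>\<phi>\<in>test_functions \<Omega>. distr_div \<Omega> F \<phi> = (\<integral>x. \<phi> x \<partial>P) - (\<integral>x. \<phi> x \<partial>N))"

text \<open>The total variation measure of \<open>\<mu> = P - N\<close>, that is, the supremum of
  \<open>\<Sum>i. \<bar>\<mu> (A i)\<bar>\<close> over the partitions of \<open>E\<close>. The pieces are taken
  relatively compact in \<open>\<Omega>\<close>, because \<open>\<mu>\<close> may be undefined (\<open>\<infinity> - \<infinity>\<close>) on other sets; finite disjoint
  families of such subsets of \<open>E\<close> give the same supremum as countable partitions.\<close>

definition total_variation ::
  "(real^2) set \<Rightarrow> (real^2) measure \<Rightarrow> (real^2) measure \<Rightarrow> (real^2) set \<Rightarrow> ennreal" where
  "total_variation \<Omega> P N E =
     (SUP \<A>\<in>{\<A>. finite \<A> \<and> disjoint \<A> \<and>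
                (\<forall>A\<in>\<A>. A \<in> sets borel \<and> A \<subseteq> E \<and> compactly_contained A \<Omega>)}.
        \<Sum>A\<in>\<A>. ennreal \<bar>measure P A - measure N A\<bar>)"

section \<open>Entropies\<close>

definition circ :: "real \<Rightarrow> real^2" where
  "circ t = vector [cos t, sin t]"

text \<open>Only the values of \<open>\<Phi>\<close> on the unit circle matter.\<close>

definition ENT :: "(real^2 \<Rightarrow> real^2) set" where
  "ENT = {\<Phi>. \<exists>D D2.
      (\<forall>t. ((\<lambda>s. \<Phi> (circ s)) has_vector_derivative D t) (at t)) \<and>
      (\<forall>t. (D has_vector_derivative D2 t) (at t)) \<and>
      continuous_on UNIV D2 \<and>
      (\<forall>t. circ t \<bullet> D t = 0)}"

section \<open>Besov spaces\<close>

text \<open>Powers of extended nonnegative reals with exponent \<open>a > 0\<close>.\<close>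

definition epowr :: "ennreal \<Rightarrow> real \<Rightarrow> ennreal" where
  "epowr x a = (if x = \<infinity> then \<infinity> else ennreal (enn2real x powr a))"

definition L3_norm :: "(real^2) set \<Rightarrow> (real^2 \<Rightarrow> real) \<Rightarrow> ennreal" where
  "L3_norm U f = epowr (\<integral>\<^sup>+x. ennreal (\<bar>f x\<bar> ^ 3) \<partial>lebesgue_on U) (1/3)"

definition fin_diff :: "(real^2) set \<Rightarrow> real^2 \<Rightarrow> (real^2 \<Rightarrow> real) \<Rightarrow> real^2 \<Rightarrow> real" where
  "fin_diff U z f x = (if x \<in> U \<and> x + z \<in> U then f (x + z) - f x else 0)"

definition besov_N :: "real \<Rightarrow> (real^2 \<Rightarrow> real) \<Rightarrow> (real^2) set \<Rightarrow> ennreal" where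
  "besov_N t f U = (SUP z\<in>{z. norm z \<le> t}. ennreal (t powr (-1/3)) * L3_norm U (fin_diff U z f))"

definition besov_q :: "real \<Rightarrow> (real^2) set \<Rightarrow> (real^2 \<Rightarrow> real) set" where
  "besov_q q U = {f. f \<in> borel_measurable (lebesgue_on U) \<and>
     L3_norm U f +
       epowr (\<integral>\<^sup>+t\<in>{0<..1}. (epowr (besov_N t f U) q * ennreal (1 / t)) \<partial>lborel) (1/q) < \<infinity>}"

definition besov_inf :: "(real^2) set \<Rightarrow> (real^2 \<Rightarrow> real) set" where
  "besov_inf U = {f. f \<in> borel_measurable (lebesgue_on U) \<and>
     L3_norm U f + (SUP t\<in>{0<..1}. besov_N t f U) < \<infinity>}"

definition besov_c0 :: "(real^2) set \<Rightarrow> (real^2 \<Rightarrow> real) set" where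
  "besov_c0 U = {f \<in> besov_inf U. ((\<lambda>t. besov_N t f U) \<longlongrightarrow> 0) (at_right 0)}"

text \<open>Local, componentwise version of a family \<open>B U\<close> of spaces of scalar functions on domains.\<close>

definition loc_vec ::
  "((real^2) set \<Rightarrow> (real^2 \<Rightarrow> real) set) \<Rightarrow> (real^2) set \<Rightarrow> (real^2 \<Rightarrow> real^2) set" where
  "loc_vec B \<Omega> = {m. \<forall>U. open U \<and> connected U \<and> compactly_contained U \<Omega> \<longrightarrow>
      (\<forall>i. (\<lambda>x. m x $ i) \<in> B U)}"

section \<open>Local Lipschitz regularity\<close>

definition locally_finite_subset :: "(real^2) set \<Rightarrow> (real^2) set \<Rightarrow> bool" where
  "locally_finite_subset S \<Omega> \<longleftrightarrow> S \<subseteq> \<Omega> \<and> (\<forall>x\<in>\<Omega>. \<exists>e>0. finite (S \<inter> ball x e))"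

definition has_locally_Lipschitz_rep :: "(real^2) set \<Rightarrow> (real^2 \<Rightarrow> real^2) \<Rightarrow> bool" where
  "has_locally_Lipschitz_rep V m \<longleftrightarrow>
     (\<exists>n. (AE x in lebesgue_on V. n x = m x) \<and>
          (\<forall>x\<in>V. \<exists>r>0. \<exists>L. L-lipschitz_on (ball x r \<inter> V) n))"

end

theory Submission
  imports Defs
begin

text \<open>
  Why the entropy production vanishes. An entropy \<open>\<Phi>\<close> extends from the circle to a map \<open>G\<close> of the plane
  whose derivative at \<open>z\<close> is a multiple of the identity plus \<open>1 - \<bar>z\<bar>^2\<close> times a bounded map
  (\<open>entropy_extension\<close>). Let \<open>M\<close> be the mollification of \<open>m\<close> at scale \<open>e\<close>. It is divergence-free, so the
  identity part does not contribute to the divergence of \<open>G \<circ> M\<close>, which is therefore at most a constant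
  times \<open>(1 - \<bar>M\<bar>^2) \<bar>\<nabla>M\<bar>\<close>. As \<open>\<bar>m\<bar> = 1\<close>, the first factor is quadratic in the increments of \<open>m\<close> at scale
  \<open>e\<close>, and the second is linear in them up to the factor \<open>1 / e\<close>. The product is cubic, and its integral is
  at most a constant times the supremum over \<open>\<bar>w\<bar> \<le> 2 e\<close> of the integral of \<open>\<bar>m (x + w) - m x\<bar>^3 / e\<close>, which tends
  to zero by the Besov condition (\<open>commutator_pointwise\<close>, \<open>commutator_vanishes\<close>,
  \<open>entropy_production_vanishes\<close>). A finite exponent \<open>q\<close> implies this condition because the modulus of
  continuity is monotone (\<open>besov_q_imp_c0\<close>).

  Why the field is Lipschitz off a locally finite set. Smooth entropies approximate \<open>sgn (z \<bullet> \<xi>) \<xi>\<close>, so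
  \<open>sgn (m \<bullet> \<xi>)\<close> is constant in the direction \<open>\<xi>\<close> (\<open>sign_transport\<close>). Averaging around two points \<open>x\<close>, \<open>y\<close> of
  approximate continuity, with \<open>\<xi>\<close> parallel to \<open>y - x\<close>, shows that \<open>m x \<bullet> (y - x)\<close> and \<open>m y \<bullet> (y - x)\<close> do not
  have opposite signs (\<open>approx_points_sign_compatible\<close>). The rest is plane geometry
  (\<open>sign_compatible_regularity\<close>). If \<open>m\<close> has two limit values at a point \<open>p\<close> of a ball, then \<open>m x\<close> is orthogonal to
  \<open>x - p\<close> throughout the ball: the field is a vortex, and \<open>p\<close> is its only singularity there. Otherwise \<open>m\<close>
  extends continuously and is constant along the lines orthogonal to it. Two such lines with
  different values cannot cross inside the ball, so for nearby points the angle between them is at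
  most proportional to the distance of the points.
\<close>

section \<open>Fields with compatible signs along chords\<close>

definition rot :: "real^2 \<Rightarrow> real^2" where
  "rot x = vector [- (x $ 2), x $ 1]"

lemma inner_plane: "x \<bullet> y = x $ 1 * y $ 1 + x $ 2 * y $ 2" for x y :: "real^2"
  by (simp add: inner_vec_def sum_2)

lemma rot_component [simp]: "rot x $ 1 = - (x $ 2)" "rot x $ 2 = x $ 1"
  by (simp_all add: rot_def)

lemma plane_eq_iff: "x = y \<longleftrightarrow> x $ 1 = y $ 1 \<and> x $ 2 = y $ 2" for x y :: "real^2"
  by (simp add: vec_eq_iff forall_2)

lemma rot_linear: "linear rot"
  by (rule linearI) (simp_all add: plane_eq_iff)

lemma rot_algebra: "rot (x + y) = rot x + rot y" "rot (x - y) = rot x - rot y"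
    "rot (c *\<^sub>R x) = c *\<^sub>R rot x" "rot (- x) = - rot x" "rot (rot x) = - x" "rot 0 = 0"
  by (simp_all add: plane_eq_iff)

lemma rot_inner [simp]: "rot x \<bullet> rot y = x \<bullet> y" "rot x \<bullet> x = 0" "x \<bullet> rot x = 0"
  by (simp_all add: inner_plane)

lemma norm_rot [simp]: "norm (rot x) = norm x"
  by (simp add: norm_eq_sqrt_inner)

lemma bounded_linear_rot: "bounded_linear rot"
  using rot_linear linear_conv_bounded_linear by blast

lemma continuous_on_rot [continuous_intros]: "continuous_on S f \<Longrightarrow> continuous_on S (\<lambda>x. rot (f x))"
  by (rule bounded_linear.continuous_on[OF bounded_linear_rot])

lemma tendsto_rot [tendsto_intros]: "(f \<longlongrightarrow> l) F \<Longrightarrow> ((\<lambda>x. rot (f x)) \<longlongrightarrow> rot l) F"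
  by (rule bounded_linear.tendsto[OF bounded_linear_rot])

lemma rot_frame: "(u \<bullet> u) *\<^sub>R v = (u \<bullet> v) *\<^sub>R u + (rot u \<bullet> v) *\<^sub>R rot u"
  by (simp add: plane_eq_iff inner_plane algebra_simps)

lemma unit_perp_cases:
  assumes "norm u = 1" "v \<noteq> 0" "u \<bullet> v = 0"
  obtains \<sigma> where "\<sigma> = 1 \<or> \<sigma> = -1" "u = (\<sigma> / norm v) *\<^sub>R rot v"
proof -
  define s where "s = (rot v \<bullet> u) / norm v"
  have nv: "norm v > 0" using assms by simp
  have "(v \<bullet> v) *\<^sub>R u = (rot v \<bullet> u) *\<^sub>R rot v"
    using rot_frame[of v u] assms(3) by (simp add: inner_commute)
  then have "(norm v * norm v) *\<^sub>R u = (rot v \<bullet> u) *\<^sub>R rot v"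
    by (simp add: dot_square_norm power2_eq_square)
  then have "(1 / (norm v * norm v)) *\<^sub>R (norm v * norm v) *\<^sub>R u = (1 / (norm v * norm v)) *\<^sub>R (rot v \<bullet> u) *\<^sub>R rot v"
    by simp
  then have u: "u = (s / norm v) *\<^sub>R rot v" using nv by (simp add: s_def)
  then have "norm u = \<bar>s\<bar>" using nv by simp
  then have "s = 1 \<or> s = -1" using assms by linarith
  then show ?thesis using that u by blast
qed

text \<open>The trace at points of the equation \<open>\<xi> \<bullet> \<nabla> sgn (m \<bullet> \<xi>) = 0\<close>: along a chord the sign of the
  component of \<open>m\<close> in the direction of the chord does not change. The weak inequality
  is stable under limits of \<open>m\<close>.\<close>

definition sign_compatible :: "(real^2) set \<Rightarrow> (real^2 \<Rightarrow> real^2) \<Rightarrow> bool" where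
  "sign_compatible G m \<longleftrightarrow> (\<forall>x\<in>G. \<forall>y\<in>G. 0 \<le> (m x \<bullet> (y - x)) * (m y \<bullet> (y - x)))"

definition cluster_values :: "(real^2) set \<Rightarrow> (real^2 \<Rightarrow> real^2) \<Rightarrow> real^2 \<Rightarrow> (real^2) set" where
  "cluster_values G m p = {\<mu>. \<exists>X. (\<forall>n. X n \<in> G) \<and> X \<longlonglongrightarrow> p \<and> (\<lambda>n. m (X n)) \<longlonglongrightarrow> \<mu>}"

lemma cluster_sign:
  assumes "sign_compatible G m" "\<mu> \<in> cluster_values G m p" "x \<in> G"
  shows "0 \<le> (m x \<bullet> (p - x)) * (\<mu> \<bullet> (p - x))"
proof -
  obtain X where X: "\<And>n. X n \<in> G" "X \<longlonglongrightarrow> p" "(\<lambda>n. m (X n)) \<longlonglongrightarrow> \<mu>"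
    using assms(2) by (auto simp: cluster_values_def)
  have "(\<lambda>n. (m x \<bullet> (X n - x)) * (m (X n) \<bullet> (X n - x))) \<longlonglongrightarrow> (m x \<bullet> (p - x)) * (\<mu> \<bullet> (p - x))"
    by (intro tendsto_intros X)
  then show ?thesis
    by (rule LIMSEQ_le_const) (use assms X in \<open>auto simp: sign_compatible_def\<close>)
qed

lemma dense_in_open:
  assumes "B \<subseteq> closure G" "open V" "z \<in> V" "z \<in> B"
  obtains x where "x \<in> G" "x \<in> V"
proof -
  have "V \<inter> closure G \<noteq> {}" using assms by blast
  then have "V \<inter> G \<noteq> {}" using open_Int_closure_eq_empty[OF assms(2)] by blast
  then show ?thesis using that by blast
qed

text \<open>Opposite orientations at two points not aligned with \<open>p\<close> would violate the sign condition,
  and aligned points are compared through a third one.\<close>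

lemma vortex_orientation:
  fixes m :: "real^2 \<Rightarrow> real^2"
  assumes comp: "sign_compatible G m" and unit: "\<And>x. x \<in> G \<Longrightarrow> norm (m x) = 1"
    and dense: "V \<subseteq> closure G" and "open V" "p \<notin> V"
    and perp: "\<And>x. x \<in> G \<inter> V \<Longrightarrow> m x \<bullet> (x - p) = 0"
  obtains \<sigma> where "\<sigma> = 1 \<or> \<sigma> = -1"
    "\<And>x. x \<in> G \<inter> V \<Longrightarrow> m x = (\<sigma> / norm (x - p)) *\<^sub>R rot (x - p)"
proof -
  have ex: "\<exists>s. (s = 1 \<or> s = -1) \<and> m x = (s / norm (x - p)) *\<^sub>R rot (x - p)" if "x \<in> G \<inter> V" for x
  proof -
    have "x - p \<noteq> 0" using that assms(5) by auto
    then show ?thesis using unit_perp_cases[of "m x" "x - p"] unit perp that by (metis IntD1)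
  qed
  define s where "s x = (SOME s. (s = 1 \<or> s = -1) \<and> m x = (s / norm (x - p)) *\<^sub>R rot (x - p))" for x
  have s: "s x = 1 \<or> s x = -1" "m x = (s x / norm (x - p)) *\<^sub>R rot (x - p)" if "x \<in> G \<inter> V" for x
    using someI_ex[OF ex[OF that]] by (simp_all add: s_def)
  have noncol: "s x = s y" if "x \<in> G \<inter> V" "y \<in> G \<inter> V" "rot (x - p) \<bullet> (y - p) \<noteq> 0" for x y
  proof -
    let ?c = "rot (x - p) \<bullet> (y - p)"
    have nx: "norm (x - p) > 0" "norm (y - p) > 0" using that assms(5) by auto
    have c1: "rot (x - p) \<bullet> (y - x) = ?c" "rot (y - p) \<bullet> (y - x) = ?c"
      by (simp_all add: inner_plane algebra_simps)
    have "0 \<le> (m x \<bullet> (y - x)) * (m y \<bullet> (y - x))"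
      using comp that by (auto simp: sign_compatible_def)
    also have "\<dots> = (s x * s y) * (?c\<^sup>2 / (norm (x - p) * norm (y - p)))"
      unfolding s(2)[OF that(1)] s(2)[OF that(2)] inner_scaleR_left c1
      by (simp add: power2_eq_square)
    finally have "0 \<le> (s x * s y) * (?c\<^sup>2 / (norm (x - p) * norm (y - p)))" .
    moreover have "?c\<^sup>2 / (norm (x - p) * norm (y - p)) > 0" using that nx by simp
    ultimately have "0 \<le> s x * s y" by (meson mult_neg_pos not_le)
    then show ?thesis using s(1)[OF that(1)] s(1)[OF that(2)] by auto
  qed
  show ?thesis
  proof (cases "G \<inter> V = {}")
    case True
    then show ?thesis using that[of 1] by auto
  next
    case False
    then obtain x0 where x0: "x0 \<in> G \<inter> V" by blast
    have x0p: "x0 \<noteq> p" using x0 assms(5) by auto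
    let ?n = "rot (x0 - p)"
    obtain e where e: "e > 0" "ball x0 e \<subseteq> V" using \<open>open V\<close> x0 openE by blast
    define z where "z = x0 + (e / (2 * norm (x0 - p))) *\<^sub>R ?n"
    have "dist x0 z < e" using e x0p by (simp add: z_def dist_norm)
    then have zV: "z \<in> V" using e by auto
    have "?n \<bullet> (z - p) = ?n \<bullet> (x0 - p) + (e / (2 * norm (x0 - p))) * (?n \<bullet> ?n)"
      by (simp add: z_def inner_diff_right inner_add_right)
    also have "\<dots> > 0" using e x0p by simp
    finally have zz: "?n \<bullet> (z - p) \<noteq> 0" by simp
    have "open (V \<inter> {z. ?n \<bullet> (z - p) \<noteq> 0})"
      by (intro open_Int \<open>open V\<close> open_Collect_neq continuous_intros)
    from dense_in_open[OF dense this] obtain y where y: "y \<in> G" "y \<in> V" "?n \<bullet> (y - p) \<noteq> 0"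
      using zV zz by auto
    have "s x = s x0" if x: "x \<in> G \<inter> V" for x
    proof (cases "?n \<bullet> (x - p) = 0")
      case False
      then show ?thesis using noncol[OF x0 x] by simp
    next
      case True
      have "rot (x - p) \<bullet> (y - p) \<noteq> 0"
      proof
        assume a: "rot (x - p) \<bullet> (y - p) = 0"
        let ?u = "x0 - p"
        have fr: "(?u \<bullet> ?u) *\<^sub>R (x - p) = (?u \<bullet> (x - p)) *\<^sub>R ?u"
          using rot_frame[of ?u "x - p"] True by simp
        then have "(?u \<bullet> ?u) *\<^sub>R rot (x - p) = (?u \<bullet> (x - p)) *\<^sub>R ?n"
          by (metis rot_algebra(3))
        then have "(?u \<bullet> ?u) * (rot (x - p) \<bullet> (y - p)) = (?u \<bullet> (x - p)) * (?n \<bullet> (y - p))"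
          by (metis inner_scaleR_left)
        then have "?u \<bullet> (x - p) = 0" using a y by simp
        then have "(?u \<bullet> ?u) *\<^sub>R (x - p) = 0" using fr by simp
        then have "x = p" using x0p by auto
        then show False using x assms(5) by auto
      qed
      then show ?thesis using noncol[OF x, of y] noncol[OF x0, of y] y by auto
    qed
    then show ?thesis using that[of "s x0"] s x0 by metis
  qed
qed

text \<open>If \<open>\<mu> \<bullet> (x - p)\<close> and \<open>\<nu> \<bullet> (x - p)\<close> have opposite signs, compatibility with both limits leaves
  only \<open>m x \<bullet> (x - p) = 0\<close>. So the field rotates about \<open>p\<close> in an open double cone, with one orientation.
  Radial approach to \<open>p\<close> from the two halves of the cone produces opposite limits \<open>w\<close> and \<open>-w\<close>, and
  such a pair leaves out only the points with \<open>w \<bullet> (x - p) = 0\<close>; varying \<open>w\<close> removes these too.\<close>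

lemma distinct_cluster_values_imp_vortex:
  fixes m :: "real^2 \<Rightarrow> real^2"
  assumes comp: "sign_compatible G m" and unit: "\<And>x. x \<in> G \<Longrightarrow> norm (m x) = 1"
    and dense: "B \<subseteq> closure G" and "open B" "p \<in> B"
    and mn: "\<mu> \<in> cluster_values G m p" "\<nu> \<in> cluster_values G m p" "\<mu> \<noteq> \<nu>"
    and x: "x \<in> G"
  shows "m x \<bullet> (x - p) = 0"
proof -
  have unit_cl: "norm \<mu> = 1" if "\<mu> \<in> cluster_values G m p" for \<mu>
  proof -
    obtain X where X: "\<And>n. X n \<in> G" and "(\<lambda>n. m (X n)) \<longlonglongrightarrow> \<mu>"
      using \<open>\<mu> \<in> cluster_values G m p\<close> by (auto simp: cluster_values_def)
    then have "(\<lambda>n. norm (m (X n))) \<longlonglongrightarrow> norm \<mu>" by (intro tendsto_norm)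
    moreover have "(\<lambda>n. norm (m (X n))) = (\<lambda>n. 1)" using unit X by auto
    ultimately show ?thesis using LIMSEQ_unique[OF _ tendsto_const] by metis
  qed
  have opp: "m x \<bullet> (x - p) = 0"
    if "\<mu> \<in> cluster_values G m p" "\<nu> \<in> cluster_values G m p" "x \<in> G"
      "(\<mu> \<bullet> (x - p)) * (\<nu> \<bullet> (x - p)) < 0" for \<mu> \<nu> x
  proof -
    have "0 \<le> (m x \<bullet> (x - p)) * (\<mu> \<bullet> (x - p))" "0 \<le> (m x \<bullet> (x - p)) * (\<nu> \<bullet> (x - p))"
      using cluster_sign[OF comp that(1,3)] cluster_sign[OF comp that(2,3)]
      by (simp_all add: inner_diff_right algebra_simps)
    then show ?thesis using that(4)
      by (auto simp: mult_less_0_iff zero_le_mult_iff)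
  qed
  define C where "C = {d. (\<mu> \<bullet> d) * (\<nu> \<bullet> d) < 0}"
  have openC: "open C" unfolding C_def by (intro open_Collect_less continuous_intros)
  define V where "V = B \<inter> {x. x - p \<in> C}"
  have "open {x. x - p \<in> C}"
    unfolding C_def mem_Collect_eq by (intro open_Collect_less continuous_intros)
  then have openV: "open V" unfolding V_def using \<open>open B\<close> by blast
  have "p \<notin> V" by (simp add: V_def C_def)
  moreover have "V \<subseteq> closure G" using dense by (auto simp: V_def)
  moreover have "m x \<bullet> (x - p) = 0" if "x \<in> G \<inter> V" for x
    using opp[OF mn(1,2)] that by (auto simp: V_def C_def)
  ultimately obtain \<sigma> where \<sigma>: "\<sigma> = 1 \<or> \<sigma> = -1"
    "\<And>x. x \<in> G \<inter> V \<Longrightarrow> m x = (\<sigma> / norm (x - p)) *\<^sub>R rot (x - p)"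
    using vortex_orientation[OF comp unit _ openV, of p] by metis
  obtain e where e: "e > 0" "ball p e \<subseteq> B" using \<open>open B\<close> \<open>p \<in> B\<close> openE by blast
  have radial: "(\<sigma> / norm d) *\<^sub>R rot d \<in> cluster_values G m p" if d: "d \<in> C" for d
  proof -
    have d0: "d \<noteq> 0" using d by (auto simp: C_def)
    \<comment> \<open>points approaching \<open>p\<close> with an error small relative to their distance, so that their direction tends to \<open>d\<close>\<close>
    define t where "t n = e / (2 * norm d) * inverse (real (Suc n))" for n
    have tpos: "t n > 0" for n using e d0 by (simp add: t_def)
    have t0: "t \<longlonglongrightarrow> 0" unfolding t_def by (rule tendsto_mult_right_zero[OF LIMSEQ_inverse_real_of_nat])
    have inV: "p + t n *\<^sub>R d \<in> V" for n
    proof -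
      have "t n * norm d = e / 2 * inverse (real (Suc n))" using d0 by (simp add: t_def)
      also have "\<dots> \<le> e / 2 * 1" using e by (intro mult_left_mono) (auto simp: inverse_le_1_iff)
      also have "\<dots> < e" using e by simp
      finally have "t n * norm d < e" .
      then have "p + t n *\<^sub>R d \<in> B" using e tpos[of n] by (auto simp: dist_norm subset_iff)
      moreover have "t n *\<^sub>R d \<in> C"
      proof -
        have "(\<mu> \<bullet> (t n *\<^sub>R d)) * (\<nu> \<bullet> (t n *\<^sub>R d)) = (t n)\<^sup>2 * ((\<mu> \<bullet> d) * (\<nu> \<bullet> d))"
          by (simp add: power2_eq_square)
        also have "\<dots> < 0" using d tpos[of n] by (simp add: C_def mult_pos_neg)
        finally show ?thesis by (simp add: C_def)
      qed
      ultimately show ?thesis by (simp add: V_def)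
    qed
    have "\<exists>y. y \<in> G \<inter> V \<and> dist y (p + t n *\<^sub>R d) < t n * inverse (real (Suc n))" for n
    proof -
      have "open (V \<inter> ball (p + t n *\<^sub>R d) (t n * inverse (real (Suc n))))" using openV by blast
      moreover have "p + t n *\<^sub>R d \<in> V \<inter> ball (p + t n *\<^sub>R d) (t n * inverse (real (Suc n)))"
        using inV tpos by simp
      ultimately obtain y where "y \<in> G" "y \<in> V \<inter> ball (p + t n *\<^sub>R d) (t n * inverse (real (Suc n)))"
        using dense_in_open[OF dense] inV V_def by (metis IntD1)
      then show ?thesis by (auto simp: dist_commute)
    qed
    then obtain X where X: "\<And>n. X n \<in> G \<inter> V"
      "\<And>n. dist (X n) (p + t n *\<^sub>R d) < t n * inverse (real (Suc n))" by metis
    define Y where "Y n = (1 / t n) *\<^sub>R (X n - p)" for n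
    have XY: "X n - p = t n *\<^sub>R Y n" for n using tpos[of n] by (simp add: Y_def)
    have "norm (Y n - d) \<le> inverse (real (Suc n))" for n
    proof -
      have "Y n - d = (1 / t n) *\<^sub>R (X n - (p + t n *\<^sub>R d))"
        using tpos[of n] by (simp add: Y_def algebra_simps)
      then have "norm (Y n - d) = (1 / t n) * dist (X n) (p + t n *\<^sub>R d)"
        using tpos[of n] by (simp add: dist_norm)
      also have "\<dots> \<le> (1 / t n) * (t n * inverse (real (Suc n)))"
        using X(2)[of n] tpos[of n] by (intro mult_left_mono) auto
      finally show ?thesis using tpos[of n] by simp
    qed
    then have Yd: "Y \<longlonglongrightarrow> d"
      using LIM_zero_cancel Lim_null_comparison[OF _ LIMSEQ_inverse_real_of_nat, of "\<lambda>n. Y n - d"] by auto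
    have "(\<lambda>n. p + t n *\<^sub>R Y n) \<longlonglongrightarrow> p + 0 *\<^sub>R d" by (intro tendsto_intros t0 Yd)
    then have Xp: "X \<longlonglongrightarrow> p" by (simp flip: XY)
    have "m (X n) = (\<sigma> / norm (Y n)) *\<^sub>R rot (Y n)" for n
      using \<sigma>(2)[OF X(1)[of n]] tpos[of n] unfolding XY by (simp add: rot_algebra)
    moreover have "(\<lambda>n. (\<sigma> / norm (Y n)) *\<^sub>R rot (Y n)) \<longlonglongrightarrow> (\<sigma> / norm d) *\<^sub>R rot d"
      by (intro tendsto_intros Yd) (use d0 in auto)
    ultimately have "(\<lambda>n. m (X n)) \<longlonglongrightarrow> (\<sigma> / norm d) *\<^sub>R rot d" by simp
    then show ?thesis using X(1) Xp unfolding cluster_values_def by blast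
  qed
  have opposite: "m x \<bullet> (x - p) = 0" if d: "d \<in> C" and "rot d \<bullet> (x - p) \<noteq> 0" for d
  proof -
    have d0: "d \<noteq> 0" using d by (auto simp: C_def)
    have "- d \<in> C" using d by (simp add: C_def)
    define w where "w = (\<sigma> / norm d) *\<^sub>R rot d"
    have w: "w \<in> cluster_values G m p" "- w \<in> cluster_values G m p"
      using radial[OF d] radial[OF \<open>- d \<in> C\<close>] by (simp_all add: w_def rot_algebra)
    have "w \<bullet> (x - p) \<noteq> 0" using \<sigma>(1) d0 that(2) by (auto simp: w_def)
    then have "(w \<bullet> (x - p)) * (- w \<bullet> (x - p)) < 0"
      by (simp add: not_square_less_zero less_le)
    then show ?thesis by (rule opp[OF w x])
  qed
  show ?thesis
  proof (cases "x = p")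
    case False
    define d where "d = \<mu> - \<nu>"
    have "\<mu> \<bullet> \<mu> = 1" "\<nu> \<bullet> \<nu> = 1" using unit_cl[OF mn(1)] unit_cl[OF mn(2)] by (simp_all add: dot_square_norm)
    moreover have "d \<bullet> d > 0" using mn(3) by (simp add: d_def)
    ultimately have "\<mu> \<bullet> d > 0" "\<nu> \<bullet> d < 0"
      by (simp_all add: d_def inner_diff_right inner_diff_left inner_commute)
    then have dC: "d \<in> C" "d \<noteq> 0" by (auto simp: C_def mult_less_0_iff)
    show ?thesis
    proof (cases "rot d \<bullet> (x - p) = 0")
      case True
      obtain r where r: "r > 0" "ball d r \<subseteq> C" using openC dC openE by blast
      \<comment> \<open>the first direction is parallel to \<open>x - p\<close>; a slight turn keeps it in the open cone\<close>
      define d' where "d' = d + (r / (2 * norm d)) *\<^sub>R rot d"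
      have "d' \<in> C" using r dC by (auto simp: d'_def dist_norm subset_iff)
      moreover have "rot d' \<bullet> (x - p) = - (r / (2 * norm d)) * (d \<bullet> (x - p))"
        using True by (simp add: d'_def rot_algebra inner_add_left inner_diff_left)
      moreover have "d \<bullet> (x - p) \<noteq> 0"
      proof
        assume "d \<bullet> (x - p) = 0"
        then have "(d \<bullet> d) *\<^sub>R (x - p) = 0" using rot_frame[of d "x - p"] True by simp
        then show False using False dC by simp
      qed
      ultimately show ?thesis using r dC by (intro opposite[of d']) auto
    qed (use opposite dC in blast)
  qed simp
qed

text \<open>Displacing \<open>y\<close> by small multiples of \<open>\<plusminus> M x\<close> gives the chord a nonzero component along \<open>M x\<close> of
  either sign, hence \<open>M y \<bullet> (y - x) = 0\<close> in the limit and \<open>M y = \<plusminus> M x\<close>. Continuity along the segment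
  excludes the minus sign.\<close>

lemma compat_constant_on_line:
  fixes M :: "real^2 \<Rightarrow> real^2"
  assumes cont: "continuous_on (ball a R) M" and unit: "\<And>x. x \<in> ball a R \<Longrightarrow> norm (M x) = 1"
    and comp: "sign_compatible (ball a R) M"
    and x: "x \<in> ball a R" and y: "y \<in> ball a R" and perp: "M x \<bullet> (y - x) = 0"
  shows "M y = M x"
proof (cases "y = x")
  case False
  have orth: "M z \<bullet> (z - x) = 0" if z: "z \<in> ball a R" "M x \<bullet> (z - x) = 0" for z
  proof -
    obtain e where e: "e > 0" "ball z e \<subseteq> ball a R" using z open_ball openE by blast
    have le: "0 \<le> s * (M z \<bullet> (z - x))" if s: "s = 1 \<or> s = -1" for s :: real
    proof -
      define t where "t n = s * (e / 2) * inverse (real (Suc n))" for n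
      have t0: "t \<longlonglongrightarrow> 0" unfolding t_def by (rule tendsto_mult_right_zero[OF LIMSEQ_inverse_real_of_nat])
      have tb: "\<bar>t n\<bar> < e" for n
      proof -
        have "inverse (real (Suc n)) \<le> 1" by (simp add: inverse_le_1_iff)
        then have "\<bar>t n\<bar> \<le> e / 2" using s e by (auto simp: t_def abs_mult intro: mult_left_le)
        then show ?thesis using e by simp
      qed
      have zt: "z + t n *\<^sub>R M x \<in> ball a R" for n
        using e(2) tb[of n] unit[OF x] by (auto simp: dist_norm subset_iff)
      have lim: "(\<lambda>n. z + t n *\<^sub>R M x) \<longlonglongrightarrow> z + 0 *\<^sub>R M x" by (intro tendsto_intros t0)
      have "isCont M z" using cont z by (simp add: continuous_on_eq_continuous_at)
      then have "(\<lambda>n. M (z + t n *\<^sub>R M x)) \<longlonglongrightarrow> M z"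
        using isCont_tendsto_compose[of z M] lim by simp
      then have "(\<lambda>n. s * (M (z + t n *\<^sub>R M x) \<bullet> (z + t n *\<^sub>R M x - x))) \<longlonglongrightarrow> s * (M z \<bullet> (z + 0 *\<^sub>R M x - x))"
        by (intro tendsto_intros lim)
      moreover have "0 \<le> s * (M (z + t n *\<^sub>R M x) \<bullet> (z + t n *\<^sub>R M x - x))" for n
      proof -
        have "M x \<bullet> (z + t n *\<^sub>R M x - x) = t n"
          using z(2) unit[OF x] by (simp add: inner_diff_right inner_add_right dot_square_norm)
        then have "0 \<le> t n * (M (z + t n *\<^sub>R M x) \<bullet> (z + t n *\<^sub>R M x - x))"
          using comp x zt[of n] unfolding sign_compatible_def by metis
        then have "0 \<le> (e / 2 * inverse (real (Suc n))) * (s * (M (z + t n *\<^sub>R M x) \<bullet> (z + t n *\<^sub>R M x - x)))"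
          by (simp add: t_def mult_ac)
        moreover have "0 < e / 2 * inverse (real (Suc n))" using e by simp
        ultimately show ?thesis by (meson mult_pos_neg not_le)
      qed
      ultimately show ?thesis by (intro LIMSEQ_le_const) auto
    qed
    from le[of 1] le[of "-1"] show ?thesis by simp
  qed
  have par: "M z \<bullet> M x = 1 \<or> M z \<bullet> M x = -1" if z: "z \<in> ball a R" "M x \<bullet> (z - x) = 0" "z \<noteq> x" for z
  proof -
    have zx: "z - x \<noteq> 0" using z by simp
    obtain s where s: "s = 1 \<or> s = -1" "M z = (s / norm (z - x)) *\<^sub>R rot (z - x)"
      using unit_perp_cases[OF unit[OF z(1)] zx orth[OF z(1,2)]] by blast
    obtain s' where s': "s' = 1 \<or> s' = -1" "M x = (s' / norm (z - x)) *\<^sub>R rot (z - x)"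
      using unit_perp_cases[OF unit[OF x] zx z(2)] by blast
    have "M z \<bullet> M x = s * s'" unfolding s(2) s'(2)
      using zx by (simp add: dot_square_norm power2_eq_square)
    then show ?thesis using s s' by auto
  qed
  define g where "g t = M (x + t *\<^sub>R (y - x)) \<bullet> M x" for t
  have seg: "x + t *\<^sub>R (y - x) \<in> ball a R" if "0 \<le> t" "t \<le> 1" for t
  proof -
    have "(1 - t) *\<^sub>R x + t *\<^sub>R y \<in> ball a R" using that x y convex_ball[of a R] by (auto simp: convex_alt)
    then show ?thesis by (simp add: algebra_simps)
  qed
  have contg: "continuous_on {0..1} g" unfolding g_def
    by (intro continuous_intros continuous_on_compose2[OF cont]) (use seg in auto)
  have "g 1 \<noteq> -1"
  proof
    assume "g 1 = -1"
    moreover have "g 0 = 1" using unit[OF x] by (simp add: g_def dot_square_norm)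
    ultimately obtain t where t: "0 \<le> t" "t \<le> 1" "g t = 0"
      using IVT2'[of g 1 0 0] contg by auto
    have "t \<noteq> 0" using t \<open>g 0 = 1\<close> by auto
    then show False using par[of "x + t *\<^sub>R (y - x)"] seg[OF t(1,2)] t(3) perp False by (auto simp: g_def)
  qed
  then have "M y \<bullet> M x = 1" using par[OF y perp False] by (simp add: g_def)
  then have "(norm (M y - M x))\<^sup>2 = 0"
    using dot_norm_neg[of "M y" "M x"] unit[OF x] unit[OF y] by simp
  then show ?thesis by simp
qed simp

text \<open>Lines orthogonal to two nearby values meet at distance about \<open>\<bar>x - y\<bar>\<close> divided by the sine of
  their angle; inside the ball they cannot meet, because the field is constant along both.\<close>

lemma compat_continuous_lipschitz:
  fixes M :: "real^2 \<Rightarrow> real^2"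
  assumes "R > 0" and cont: "continuous_on (ball a R) M" and unit: "\<And>x. x \<in> ball a R \<Longrightarrow> norm (M x) = 1"
    and comp: "sign_compatible (ball a R) M"
  obtains s L where "s > 0" "s \<le> R" "L-lipschitz_on (ball a s) M"
proof -
  have "isCont M a" using cont \<open>R > 0\<close> by (simp add: continuous_on_eq_continuous_at)
  then obtain d where d: "d > 0" "\<And>x. dist x a < d \<Longrightarrow> dist (M x) (M a) < 1/2"
    unfolding continuous_at_eps_delta by (metis half_gt_zero_iff zero_less_one)
  define s where "s = min d (R / 2)"
  have "(4 / R)-lipschitz_on (ball a s) M"
  proof (rule lipschitz_onI)
    fix x y assume xy: "x \<in> ball a s" "y \<in> ball a s"
    have xR: "x \<in> ball a R" "y \<in> ball a R" using xy \<open>R > 0\<close> by (auto simp: s_def)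
    define c where "c = rot (M x) \<bullet> M y"
    define k where "k = M x \<bullet> M y"
    have Mx: "M x \<bullet> M x = 1" "M y \<bullet> M y = 1" using unit xR by (simp_all add: dot_square_norm)
    have "dist (M x) (M y) < 1"
      using d(2)[of x] d(2)[of y] xy dist_triangle_half_l[of "M x" "M a" 1 "M y"]
      by (auto simp: s_def dist_commute)
    then have "(norm (M x - M y))\<^sup>2 < 1" by (simp add: dist_norm abs_square_less_1)
    moreover have n2: "(norm (M x - M y))\<^sup>2 = 2 - 2 * k"
      using Mx by (simp add: power2_norm_eq_inner inner_diff_left inner_diff_right inner_commute k_def)
    ultimately have k: "k > 1/2" by linarith
    have "k\<^sup>2 + c\<^sup>2 = (M x \<bullet> M x) * (M y \<bullet> M y)"
      by (simp add: k_def c_def inner_plane power2_eq_square algebra_simps)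
    then have ck: "c\<^sup>2 = 1 - k\<^sup>2" using Mx by simp
    have cR: "\<bar>c\<bar> * (R / 2) \<le> norm (x - y)"
    proof (rule ccontr)
      assume neg: "\<not> ?thesis"
      then have c0: "c \<noteq> 0" by auto
      define t where "t = (M y \<bullet> (y - x)) / c"
      have "\<bar>M y \<bullet> (y - x)\<bar> \<le> norm (x - y)"
        using Cauchy_Schwarz_ineq2[of "M y" "y - x"] unit xR by (simp add: norm_minus_commute)
      then have "\<bar>t\<bar> < R / 2" using neg c0 by (simp add: t_def abs_divide field_simps)
      define q where "q = x + t *\<^sub>R rot (M x)"
      have "dist a q \<le> dist a x + \<bar>t\<bar>"
        using dist_triangle[of a q x] unit[OF xR(1)] by (simp add: q_def dist_norm)
      then have q: "q \<in> ball a R" using xy \<open>\<bar>t\<bar> < R / 2\<close> by (auto simp: s_def)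
      have "M x \<bullet> (q - x) = 0" by (simp add: q_def)
      then have 1: "M q = M x" using compat_constant_on_line[OF cont _ comp xR(1) q] unit by blast
      have "M y \<bullet> (q - y) = M y \<bullet> (x - y) + t * c"
        by (simp add: q_def c_def inner_diff_right inner_add_right inner_commute)
      then have "M y \<bullet> (q - y) = 0" using c0 by (simp add: t_def inner_diff_right)
      then have "M q = M y" using compat_constant_on_line[OF cont _ comp xR(2) q] unit by blast
      then show False using 1 c0 by (simp add: c_def)
    qed
    have "k \<le> 1" using Cauchy_Schwarz_ineq2[of "M x" "M y"] unit xR by (simp add: k_def)
    then have "k\<^sup>2 \<le> k" using k by (simp add: power2_eq_square mult_left_le)
    then have "(norm (M x - M y))\<^sup>2 \<le> (2 * \<bar>c\<bar>)\<^sup>2" using n2 ck \<open>k \<le> 1\<close> by (simp add: power_mult_distrib)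
    then have "norm (M x - M y) \<le> 2 * \<bar>c\<bar>" by (rule power2_le_imp_le) simp
    also have "\<dots> \<le> 4 / R * norm (x - y)" using cR \<open>R > 0\<close> by (simp add: field_simps)
    finally show "dist (M x) (M y) \<le> 4 / R * dist x y" by (simp add: dist_norm)
  qed (use \<open>R > 0\<close> in simp)
  then show ?thesis using that[of s] d \<open>R > 0\<close> by (auto simp: s_def)
qed

lemma unit_subsequence:
  fixes m :: "real^2 \<Rightarrow> real^2"
  assumes "\<And>n. X n \<in> G" "X \<longlonglongrightarrow> p" and unit: "\<And>x. x \<in> G \<Longrightarrow> norm (m x) = 1"
  obtains r \<mu> where "strict_mono r" "(\<lambda>n. m (X (r n))) \<longlonglongrightarrow> \<mu>" "\<mu> \<in> cluster_values G m p"
proof -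
  have "\<forall>n. m (X n) \<in> sphere 0 1" using assms by auto
  then obtain l r where l: "strict_mono r" "((\<lambda>n. m (X n)) \<circ> r) \<longlonglongrightarrow> l"
    using compact_sphere[of "0::real^2" 1] unfolding compact_def by metis
  have "(\<lambda>n. X (r n)) \<longlonglongrightarrow> p" using LIMSEQ_subseq_LIMSEQ[OF assms(2) l(1)] by (simp add: o_def)
  then have "l \<in> cluster_values G m p"
    unfolding cluster_values_def using assms(1) l by (auto simp: o_def intro!: exI[of _ "\<lambda>n. X (r n)"])
  then show ?thesis using that l by (auto simp: o_def)
qed

lemma unique_cluster_limit:
  fixes m :: "real^2 \<Rightarrow> real^2"
  assumes unit: "\<And>x. x \<in> G \<Longrightarrow> norm (m x) = 1"
    and uniq: "\<And>\<nu>. \<nu> \<in> cluster_values G m p \<Longrightarrow> \<nu> = \<mu>" and "e > 0"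
  obtains d where "d > 0" "\<And>x. x \<in> G \<Longrightarrow> dist x p < d \<Longrightarrow> dist (m x) \<mu> < e"
proof (rule ccontr)
  assume neg: "\<not> thesis"
  have "\<exists>x. x \<in> G \<and> dist x p < inverse (real (Suc n)) \<and> \<not> dist (m x) \<mu> < e" for n
  proof (rule ccontr)
    assume "\<not> ?thesis"
    then show False using neg that[of "inverse (real (Suc n))"] by auto
  qed
  then obtain X where X: "\<And>n. X n \<in> G" "\<And>n. dist (X n) p < inverse (real (Suc n))"
    "\<And>n. \<not> dist (m (X n)) \<mu> < e" by metis
  have "X \<longlonglongrightarrow> p"
    unfolding tendsto_dist_iff[of X]
    by (rule tendsto_sandwich[OF _ _ tendsto_const LIMSEQ_inverse_real_of_nat])
      (use X(2) in \<open>auto intro!: always_eventually less_imp_le simp del: of_nat_Suc\<close>)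
  then obtain r \<nu> where r: "(\<lambda>n. m (X (r n))) \<longlonglongrightarrow> \<nu>" "\<nu> \<in> cluster_values G m p"
    using unit_subsequence[of X G p m] X(1) unit by metis
  then have "(\<lambda>n. dist (m (X (r n))) \<mu>) \<longlonglongrightarrow> 0" using uniq by (auto simp flip: tendsto_dist_iff)
  then have "eventually (\<lambda>n. dist (m (X (r n))) \<mu> < e) sequentially"
    using order_tendstoD(2) \<open>e > 0\<close> by blast
  then show False using X(3) by (auto simp: eventually_sequentially)
qed

text \<open>Uniqueness of the limit value at each point of \<open>B\<close>, including the points outside \<open>G\<close>, is a
  continuity statement by compactness of the circle.\<close>

lemma sign_compatible_extension:
  fixes m :: "real^2 \<Rightarrow> real^2"
  assumes unit: "\<And>x. x \<in> G \<Longrightarrow> norm (m x) = 1" and comp: "sign_compatible G m"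
    and dense: "B \<subseteq> closure G" and "open B"
    and uniq: "\<And>p \<mu> \<nu>. p \<in> B \<Longrightarrow> \<mu> \<in> cluster_values G m p \<Longrightarrow> \<nu> \<in> cluster_values G m p \<Longrightarrow> \<mu> = \<nu>"
  obtains M where "continuous_on B M" "\<And>x. x \<in> B \<Longrightarrow> norm (M x) = 1" "sign_compatible B M"
    "\<And>x. x \<in> G \<Longrightarrow> x \<in> B \<Longrightarrow> M x = m x"
proof -
  have seqs: "\<exists>X. (\<forall>n. X n \<in> G) \<and> X \<longlonglongrightarrow> p" if "p \<in> B" for p
    using dense that closure_sequential by blast
  have ex: "\<exists>\<mu>. \<mu> \<in> cluster_values G m p" if "p \<in> B" for p
    using seqs[OF that] unit_subsequence[of _ G p m] unit by metis
  define M where "M p = (SOME \<mu>. \<mu> \<in> cluster_values G m p)" for p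
  have M: "M p \<in> cluster_values G m p" if "p \<in> B" for p
    using someI_ex[OF ex[OF that]] by (simp add: M_def)
  have near: "\<exists>d>0. \<forall>x\<in>G. dist x p < d \<longrightarrow> dist (m x) (M p) < e" if "p \<in> B" "e > 0" for p e
    using unique_cluster_limit[of G m p "M p" e] unit uniq[OF that(1) _ M[OF that(1)]] that(2) by metis
  have lim: "(\<lambda>n. m (X n)) \<longlonglongrightarrow> M p" if "p \<in> B" "\<And>n. X n \<in> G" "X \<longlonglongrightarrow> p" for p X
  proof (rule metric_LIMSEQ_I)
    fix e :: real assume "e > 0"
    then obtain d where "d > 0" "\<forall>x\<in>G. dist x p < d \<longrightarrow> dist (m x) (M p) < e"
      using near \<open>p \<in> B\<close> by blast
    then show "\<exists>N. \<forall>n\<ge>N. dist (m (X n)) (M p) < e"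
      using metric_LIMSEQ_D[OF that(3), of d] that(2) by metis
  qed
  have eq: "M x = m x" if "x \<in> G" "x \<in> B" for x
    using lim[of x "\<lambda>_. x"] that LIMSEQ_const_iff by metis
  have cont: "continuous_on B M"
    unfolding continuous_on_iff
  proof (intro ballI allI impI)
    fix p and e :: real assume p: "p \<in> B" and "e > 0"
    then obtain d where d: "d > 0" "\<forall>x\<in>G. dist x p < d \<longrightarrow> dist (m x) (M p) < e / 2"
      using near[of p "e/2"] by auto
    have "dist (M q) (M p) < e" if q: "q \<in> B" "dist q p < d" for q
    proof -
      obtain d' where d': "d' > 0" "\<forall>x\<in>G. dist x q < d' \<longrightarrow> dist (m x) (M q) < e / 2"
        using near[of q "e/2"] q \<open>e > 0\<close> by auto
      obtain x where "x \<in> G" "x \<in> ball q d' \<inter> ball p d"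
        using dense_in_open[OF dense, of "ball q d' \<inter> ball p d" q] q d' by (auto simp: dist_commute)
      then show ?thesis using d d' dist_triangle_half_r[of "m x" "M q" e "M p"] by (auto simp: dist_commute)
    qed
    then show "\<exists>d>0. \<forall>x'\<in>B. dist x' p < d \<longrightarrow> dist (M x') (M p) < e" using d(1) by blast
  qed
  have Munit: "norm (M p) = 1" if p: "p \<in> B" for p
  proof -
    obtain X where X: "\<And>n. X n \<in> G" "X \<longlonglongrightarrow> p" using seqs p by blast
    then have "(\<lambda>n. norm (m (X n))) \<longlonglongrightarrow> norm (M p)" by (intro tendsto_norm lim[OF p])
    moreover have "(\<lambda>n. norm (m (X n))) = (\<lambda>n. 1)" using unit X by auto
    ultimately show ?thesis using LIMSEQ_unique[OF _ tendsto_const] by metis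
  qed
  have "0 \<le> (M p \<bullet> (q - p)) * (M q \<bullet> (q - p))" if pq: "p \<in> B" "q \<in> B" for p q
  proof -
    obtain X where X: "\<And>n. X n \<in> G" "X \<longlonglongrightarrow> p" using seqs pq by blast
    have "(\<lambda>n. (m (X n) \<bullet> (q - X n)) * (M q \<bullet> (q - X n))) \<longlonglongrightarrow> (M p \<bullet> (q - p)) * (M q \<bullet> (q - p))"
      by (intro tendsto_intros lim pq X)
    then show ?thesis
      by (rule LIMSEQ_le_const) (use cluster_sign[OF comp M[OF pq(2)] X(1)] in auto)
  qed
  then have "sign_compatible B M" by (simp add: sign_compatible_def)
  then show ?thesis using that cont Munit eq by blast
qed

text \<open>The exceptional point is the centre of the vortex, if two limit values occur somewhere in \<open>B\<close>;
  otherwise \<open>p\<close> is arbitrary.\<close>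

theorem sign_compatible_regularity:
  fixes m :: "real^2 \<Rightarrow> real^2"
  assumes unit: "\<And>x. x \<in> G \<Longrightarrow> norm (m x) = 1" and comp: "sign_compatible G m"
    and dense: "B \<subseteq> closure G" and "open B"
  obtains p where "\<And>x. x \<in> B \<Longrightarrow> x \<noteq> p \<Longrightarrow> \<exists>s>0. \<exists>L. L-lipschitz_on (ball x s \<inter> G) m"
proof (cases "\<exists>p\<in>B. \<exists>\<mu>\<in>cluster_values G m p. \<exists>\<nu>\<in>cluster_values G m p. \<mu> \<noteq> \<nu>")
  case True
  then obtain p \<mu> \<nu> where p: "p \<in> B" "\<mu> \<in> cluster_values G m p" "\<nu> \<in> cluster_values G m p" "\<mu> \<noteq> \<nu>"
    by blast
  have perp: "m x \<bullet> (x - p) = 0" if "x \<in> G" for x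
    using distinct_cluster_values_imp_vortex[OF comp _ dense \<open>open B\<close> p that] unit by blast
  have "B - {p} \<subseteq> closure G" "open (B - {p})" "p \<notin> B - {p}" using dense \<open>open B\<close> by auto
  then obtain \<sigma> where \<sigma>: "\<sigma> = 1 \<or> \<sigma> = -1"
    "\<And>x. x \<in> G \<inter> (B - {p}) \<Longrightarrow> m x = (\<sigma> / norm (x - p)) *\<^sub>R rot (x - p)"
    using vortex_orientation[OF comp unit, of "B - {p}" p] perp by (metis IntD1)
  have "\<exists>s>0. \<exists>L. L-lipschitz_on (ball x s \<inter> G) m" if x: "x \<in> B" "x \<noteq> p" for x
  proof -
    obtain e where e: "e > 0" "ball x e \<subseteq> B" using \<open>open B\<close> x openE by blast
    define r where "r = norm (x - p)"
    have r: "r > 0" using x by (simp add: r_def)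
    define s where "s = min e (r / 2)"
    have "(4 / r)-lipschitz_on (ball x s \<inter> G) m"
    proof (rule lipschitz_onI)
      fix y z assume yz: "y \<in> ball x s \<inter> G" "z \<in> ball x s \<inter> G"
      have far: "norm (w - p) > r / 2" if "w \<in> ball x s" for w
        using that dist_triangle[of x p w] by (auto simp: s_def r_def dist_norm)
      have in': "w \<in> G \<inter> (B - {p})" if "w \<in> ball x s \<inter> G" for w
        using that far[of w] r e by (auto simp: s_def subset_iff)
      let ?u = "y - p" and ?v = "z - p"
      have nn: "norm ?u > r / 2" "norm ?v > r / 2" using far yz by auto
      have nn0: "norm ?u > 0" "norm ?v > 0" using nn r by linarith+
      have "dist (m y) (m z) = \<bar>\<sigma>\<bar> * norm ((1 / norm ?u) *\<^sub>R rot ?u - (1 / norm ?v) *\<^sub>R rot ?v)"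
        unfolding \<sigma>(2)[OF in'[OF yz(1)]] \<sigma>(2)[OF in'[OF yz(2)]] dist_norm norm_scaleR[symmetric]
        by (simp add: algebra_simps)
      also have "\<dots> = norm ((1 / norm ?u) *\<^sub>R rot (?u - ?v) + ((norm ?v - norm ?u) / (norm ?u * norm ?v)) *\<^sub>R rot ?v)"
        using \<sigma>(1) nn0 by (auto simp: plane_eq_iff divide_simps algebra_simps intro!: arg_cong[where f=norm])
      also have "\<dots> \<le> norm (y - z) / norm ?u + \<bar>norm ?v - norm ?u\<bar> / norm ?u"
        by (rule order_trans[OF norm_triangle_ineq]) (use nn0 in \<open>simp add: abs_mult abs_divide\<close>)
      also have "\<dots> \<le> norm (y - z) / norm ?u + norm (y - z) / norm ?u"
        using norm_triangle_ineq3[of ?v ?u] nn0 by (intro add_left_mono divide_right_mono) (auto simp: norm_minus_commute)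
      also have "\<dots> = 2 * norm (y - z) / norm ?u" by simp
      also have "\<dots> \<le> 2 * norm (y - z) / (r / 2)" using nn r nn0 by (intro divide_left_mono mult_pos_pos) auto
      finally show "dist (m y) (m z) \<le> 4 / r * dist y z" by (simp add: dist_norm)
    qed (use r in simp)
    moreover have "s > 0" using e r by (simp add: s_def)
    ultimately show ?thesis by blast
  qed
  then show ?thesis using that by blast
next
  case False
  then have uniq: "\<And>p \<mu> \<nu>. p \<in> B \<Longrightarrow> \<mu> \<in> cluster_values G m p \<Longrightarrow> \<nu> \<in> cluster_values G m p \<Longrightarrow> \<mu> = \<nu>"
    by blast
  have "\<exists>M. continuous_on B M \<and> (\<forall>x\<in>B. norm (M x) = 1) \<and> sign_compatible B M \<and>
      (\<forall>x\<in>G. x \<in> B \<longrightarrow> M x = m x)"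
  proof (rule sign_compatible_extension[of G m B])
    show "norm (m x) = 1" if "x \<in> G" for x by (rule unit[OF that])
    show "\<mu> = \<nu>" if "p \<in> B" "\<mu> \<in> cluster_values G m p" "\<nu> \<in> cluster_values G m p" for p \<mu> \<nu>
      by (rule uniq[OF that])
    show "\<exists>M. continuous_on B M \<and> (\<forall>x\<in>B. norm (M x) = 1) \<and> sign_compatible B M \<and>
        (\<forall>x\<in>G. x \<in> B \<longrightarrow> M x = m x)"
      if "continuous_on B M" "\<And>x. x \<in> B \<Longrightarrow> norm (M x) = 1" "sign_compatible B M"
        "\<And>x. x \<in> G \<Longrightarrow> x \<in> B \<Longrightarrow> M x = m x" for M
      using that by (intro exI[of _ M]) auto
  qed (fact comp dense \<open>open B\<close>)+
  then obtain M where M: "continuous_on B M" "\<And>x. x \<in> B \<Longrightarrow> norm (M x) = 1" "sign_compatible B M"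
    "\<And>x. x \<in> G \<Longrightarrow> x \<in> B \<Longrightarrow> M x = m x"
    by blast
  have "\<exists>s>0. \<exists>L. L-lipschitz_on (ball x s \<inter> G) m" if x: "x \<in> B" for x
  proof -
    obtain R where R: "R > 0" "ball x R \<subseteq> B" using openE[OF \<open>open B\<close> x] by metis
    have "continuous_on (ball x R) M" by (rule continuous_on_subset[OF M(1) R(2)])
    moreover have "sign_compatible (ball x R) M"
      using M(3) R(2) unfolding sign_compatible_def by blast
    moreover have "\<And>y. y \<in> ball x R \<Longrightarrow> norm (M y) = 1" using M(2) R(2) by blast
    ultimately obtain s L where s: "s > 0" "s \<le> R" "L-lipschitz_on (ball x s) M"
      using compat_continuous_lipschitz[OF R(1)] by metis
    have "L-lipschitz_on (ball x s \<inter> G) M" by (rule lipschitz_on_subset[OF s(3)]) simp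
    moreover have "m y = M y" if "y \<in> ball x s \<inter> G" for y
      using M(4)[of y] that s(2) R(2) by (auto simp: subset_iff)
    ultimately have "L-lipschitz_on (ball x s \<inter> G) m" using lipschitz_on_transform by blast
    then show ?thesis using s(1) by blast
  qed
  then show ?thesis using that by blast
qed

section \<open>Functions of the polar angle\<close>

lemma circ_component [simp]: "circ t $ 1 = cos t" "circ t $ 2 = sin t"
  by (simp_all add: circ_def)

lemma norm_circ [simp]: "norm (circ t) = 1"
  by (simp add: norm_eq_sqrt_inner inner_plane power2_eq_square[symmetric])

lemma circ_dot [simp]: "circ t \<bullet> circ t = 1"
  by (simp add: dot_square_norm)

lemma circ_add: "circ (s + t) = cos t *\<^sub>R circ s + sin t *\<^sub>R rot (circ s)"
  by (simp add: plane_eq_iff cos_add sin_add algebra_simps)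

lemma circ_has_vector_derivative: "(circ has_vector_derivative rot (circ t)) (at t within S)"
proof -
  have eq: "circ = (\<lambda>t. cos t *\<^sub>R axis 1 1 + sin t *\<^sub>R axis 2 1)"
    by (auto simp: plane_eq_iff axis_def)
  have r: "rot (circ t) = - sin t *\<^sub>R axis 1 1 + cos t *\<^sub>R axis 2 1"
    by (auto simp: plane_eq_iff axis_def)
  show ?thesis unfolding r by (subst eq) (auto intro!: derivative_eq_intros)
qed

lemma rot_circ_has_vector_derivative:
  "((\<lambda>t. rot (circ t)) has_vector_derivative - circ t) (at t within S)"
  using bounded_linear.has_vector_derivative[OF bounded_linear_rot circ_has_vector_derivative]
  by (simp add: rot_algebra)

lemma unit_is_circ:
  assumes "norm z = 1"
  obtains t where "0 \<le> t" "t \<le> 2 * pi" "z = circ t"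
proof -
  have "(z $ 1)\<^sup>2 + (z $ 2)\<^sup>2 = 1"
    using assms by (simp add: norm_eq_sqrt_inner inner_plane power2_eq_square)
  then obtain t where "0 \<le> t" "t < 2 * pi" "z $ 1 = cos t" "z $ 2 = sin t"
    using sincos_total_2pi by metis
  then show ?thesis using that[of t] by (auto simp: plane_eq_iff)
qed

lemma plane_lagrange: "(u \<bullet> u) * (v \<bullet> v) = (u \<bullet> v)\<^sup>2 + (rot u \<bullet> v)\<^sup>2" for u v :: "real^2"
  by (simp add: inner_plane power2_eq_square algebra_simps)

definition ang :: "real^2 \<Rightarrow> real" where
  "ang z = (SOME t. 0 \<le> t \<and> t \<le> 2 * pi \<and> z = norm z *\<^sub>R circ t)"

lemma ang: "0 \<le> ang z" "ang z \<le> 2 * pi" "norm z *\<^sub>R circ (ang z) = z"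
proof -
  have "\<exists>t. 0 \<le> t \<and> t \<le> 2 * pi \<and> z = norm z *\<^sub>R circ t"
  proof (cases "z = 0")
    case False
    then have "norm ((1 / norm z) *\<^sub>R z) = 1" by simp
    then obtain t where "0 \<le> t" "t \<le> 2 * pi" "(1 / norm z) *\<^sub>R z = circ t" using unit_is_circ by metis
    then show ?thesis using False by (intro exI[of _ t]) (auto simp flip: \<open>_ = circ t\<close>)
  qed (auto intro!: exI[of _ 0])
  from someI_ex[OF this] show "0 \<le> ang z" "ang z \<le> 2 * pi" "norm z *\<^sub>R circ (ang z) = z"
    by (auto simp: ang_def)
qed

lemma circ_ang:
  assumes "z \<noteq> 0"
  shows "circ (ang z) = (1 / norm z) *\<^sub>R z"
proof -
  have "(1 / norm z) *\<^sub>R (norm z *\<^sub>R circ (ang z)) = (1 / norm z) *\<^sub>R z" by (simp only: ang(3))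
  then show ?thesis using assms by simp
qed

text \<open>Near \<open>z\<close> the angle is \<open>ang z + arctan\<close> of a quotient of coordinates, up to multiples
  of \<open>2\<pi>\<close>, which a function factoring through \<open>circ\<close> does not see.\<close>

lemma has_derivative_angular:
  fixes f :: "real \<Rightarrow> 'b::real_normed_vector"
  assumes wd: "\<And>s t. circ s = circ t \<Longrightarrow> f s = f t"
    and f': "(f has_vector_derivative f') (at (ang z))" and "z \<noteq> 0"
  shows "((\<lambda>w. f (ang w)) has_derivative (\<lambda>h. ((rot z \<bullet> h) / (z \<bullet> z)) *\<^sub>R f')) (at z)"
proof -
  define n where "n = circ (ang z)"
  define W where "W = {w. 0 < n \<bullet> w}"
  define \<psi> where "\<psi> w = ang z + arctan ((rot n \<bullet> w) / (n \<bullet> w))" for w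
  have z: "z = norm z *\<^sub>R n" using ang(3)[of z] by (simp add: n_def)
  have nn: "n \<bullet> n = 1" "norm n = 1" by (simp_all add: n_def)
  have nz: "n \<bullet> z = norm z" "rot n \<bullet> z = 0"
    using nn by (subst z, simp)+
  have oW: "open W" unfolding W_def by (intro open_Collect_less continuous_intros)
  have zW: "z \<in> W" using nz \<open>z \<noteq> 0\<close> by (simp add: W_def)
  have eq: "f (\<psi> w) = f (ang w)" if "w \<in> W" for w
  proof (rule wd)
    define p q where "p = n \<bullet> w" "q = rot n \<bullet> w"
    have p: "p > 0" using that by (simp add: W_def p_q_def)
    have w: "w = p *\<^sub>R n + q *\<^sub>R rot n" using rot_frame[of n w] nn by (simp add: p_q_def)
    have "w \<bullet> w = p\<^sup>2 + q\<^sup>2" using nn by (subst w, subst w)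
      (simp add: inner_add_left inner_add_right power2_eq_square)
    then have nw: "norm w = sqrt (p\<^sup>2 + q\<^sup>2)" by (simp add: norm_eq_sqrt_inner)
    have "sqrt (1 + (q / p)\<^sup>2) = sqrt ((p\<^sup>2 + q\<^sup>2) / p\<^sup>2)" using p by (simp add: power_divide add_divide_distrib)
    also have "\<dots> = norm w / p" using p by (simp add: real_sqrt_divide nw)
    finally have sq: "sqrt (1 + (q / p)\<^sup>2) = norm w / p" .
    have w0: "w \<noteq> 0" using p by (auto simp: p_q_def)
    have "circ (\<psi> w) = (p / norm w) *\<^sub>R n + (q / norm w) *\<^sub>R rot n"
      using p w0 unfolding \<psi>_def circ_add cos_arctan sin_arctan p_q_def[symmetric] sq n_def[symmetric] by simp
    also have "\<dots> = (1 / norm w) *\<^sub>R w" by (subst (3) w) (simp add: scaleR_add_right)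
    finally show "circ (\<psi> w) = circ (ang w)" using circ_ang[OF w0] by simp
  qed
  have der: "((\<lambda>w. f (\<psi> w)) has_derivative (\<lambda>h. ((rot z \<bullet> h) / (z \<bullet> z)) *\<^sub>R f')) (at z)"
  proof -
    have "n \<bullet> z \<noteq> 0" using nz \<open>z \<noteq> 0\<close> by simp
    then have "((\<lambda>w. (rot n \<bullet> w) / (n \<bullet> w)) has_derivative (\<lambda>h. (rot n \<bullet> h) / norm z)) (at z)"
      by (auto intro!: derivative_eq_intros simp: nz)
    then have "(arctan \<circ> (\<lambda>w. (rot n \<bullet> w) / (n \<bullet> w)) has_derivative
        (\<lambda>x. inverse (1 + ((rot n \<bullet> z) / (n \<bullet> z))\<^sup>2) * x) \<circ> (\<lambda>h. (rot n \<bullet> h) / norm z)) (at z)"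
      by (rule diff_chain_at) (use DERIV_arctan has_field_derivative_def in blast)
    then have "((\<lambda>w. arctan ((rot n \<bullet> w) / (n \<bullet> w))) has_derivative (\<lambda>h. (rot n \<bullet> h) / norm z)) (at z)"
      by (simp add: nz o_def)
    then have "(\<psi> has_derivative (\<lambda>h. (rot n \<bullet> h) / norm z)) (at z)"
      unfolding \<psi>_def[abs_def] using has_derivative_add[OF has_derivative_const] by fastforce
    moreover have "(f has_derivative (\<lambda>x. x *\<^sub>R f')) (at (\<psi> z))"
      using f' by (simp add: \<psi>_def nz has_vector_derivative_def)
    ultimately have "(f \<circ> \<psi> has_derivative (\<lambda>x. x *\<^sub>R f') \<circ> (\<lambda>h. (rot n \<bullet> h) / norm z)) (at z)"
      by (rule diff_chain_at)
    moreover have "(rot z \<bullet> h) / (z \<bullet> z) = (rot n \<bullet> h) / norm z" for h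
    proof -
      have "rot z = norm z *\<^sub>R rot n" using z rot_algebra(3) by metis
      then show ?thesis using \<open>z \<noteq> 0\<close> by (simp add: dot_square_norm power2_eq_square)
    qed
    ultimately show ?thesis by (simp add: o_def)
  qed
  show ?thesis
    by (rule has_derivative_transform_within_open[OF der oW zW]) (rule eq)
qed

text \<open>By the addition formulas the translates of \<open>f\<close> by \<open>s\<close> and by \<open>t\<close> are the same function.\<close>

lemma derivative_factors_through_circ:
  fixes f :: "real \<Rightarrow> 'b::real_normed_vector"
  assumes wd: "\<And>s t. circ s = circ t \<Longrightarrow> f s = f t"
    and f': "\<And>t. (f has_vector_derivative f' t) (at t)" and "circ s = circ t"
  shows "f' s = f' t"
proof -
  have sh: "((\<lambda>h. f (r + h)) has_vector_derivative f' r) (at 0)" for r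
  proof -
    have "((\<lambda>h. r + h) has_vector_derivative 1) (at (0::real))"
      by (auto intro!: derivative_eq_intros)
    moreover have "(f has_vector_derivative f' r) (at (r + 0))" using f' by simp
    ultimately show ?thesis using vector_diff_chain_at[of "\<lambda>h. r + h" 1 0 f "f' r"] by (simp add: o_def)
  qed
  have "(\<lambda>h. f (s + h)) = (\<lambda>h. f (t + h))"
    by (intro ext wd) (simp add: circ_add assms(3))
  then show ?thesis using sh[of s] sh[of t] vector_derivative_unique_at by metis
qed

section \<open>Extension of entropies to the plane\<close>

lemma bounded_on_period:
  fixes f :: "real \<Rightarrow> 'b::real_normed_vector"
  assumes "continuous_on {0..2*pi} f"
  shows "\<exists>K. \<forall>t. 0 \<le> t \<and> t \<le> 2*pi \<longrightarrow> norm (f t) \<le> K"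
proof -
  have "bounded (f ` {0..2*pi})"
    by (intro compact_imp_bounded compact_continuous_image assms compact_Icc)
  then obtain K where K: "\<forall>y\<in>f ` {0..2*pi}. norm y \<le> K" unfolding bounded_iff by blast
  have "norm (f t) \<le> K" if "0 \<le> t \<and> t \<le> 2*pi" for t using K that by simp
  then show ?thesis by blast
qed

text \<open>On the circle \<open>\<Phi>' = \<kappa> \<tau>\<close> with the unit tangent \<open>\<tau>\<close>. The extension \<open>F z = \<bar>z\<bar>^4 \<Phi> (z / \<bar>z\<bar>)\<close> has
  derivative \<open>\<gamma> h + (z \<bullet> h) \<Psi> z\<close>, because \<open>\<tau> \<otimes> \<tau>\<close> is the identity minus the radial projection. Adding
  \<open>(1 - \<bar>z\<bar>^2) \<Psi> z / 2\<close> cancels the second term and leaves \<open>(1 - \<bar>z\<bar>^2) \<Psi>' z h / 2\<close>. The fourth power is what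
  makes everything differentiable at the origin. For a divergence-free field the multiple of the
  identity does not contribute to the divergence of \<open>G \<circ> M\<close>.\<close>

lemma entropy_extension:
  assumes "\<Phi> \<in> ENT"
  obtains G :: "real^2 \<Rightarrow> real^2" and \<gamma> :: "real^2 \<Rightarrow> real" and B C where
    "\<And>z. (G has_derivative (\<lambda>h. \<gamma> z *\<^sub>R h + (1 - z \<bullet> z) *\<^sub>R B z h)) (at z)"
    "\<And>z h. norm z \<le> 1 \<Longrightarrow> norm (B z h) \<le> C * norm h"
    "\<And>z. norm z \<le> 1 \<Longrightarrow> \<bar>\<gamma> z\<bar> \<le> C" "C \<ge> 0"
    "\<And>t. G (circ t) = \<Phi> (circ t)"
proof -
  obtain D D2 where D: "\<And>t. ((\<lambda>s. \<Phi> (circ s)) has_vector_derivative D t) (at t)"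
    "\<And>t. (D has_vector_derivative D2 t) (at t)" "continuous_on UNIV D2" "\<And>t. circ t \<bullet> D t = 0"
    using assms by (auto simp: ENT_def)
  define \<kappa> where "\<kappa> t = rot (circ t) \<bullet> D t" for t
  define \<kappa>' where "\<kappa>' t = rot (circ t) \<bullet> D2 t" for t
  have D\<kappa>: "D t = \<kappa> t *\<^sub>R rot (circ t)" for t
    using rot_frame[of "circ t" "D t"] D(4)[of t] by (simp add: \<kappa>_def)
  have \<kappa>d: "(\<kappa> has_vector_derivative \<kappa>' t) (at t)" for t
  proof -
    have "((\<lambda>t. rot (circ t) \<bullet> D t) has_vector_derivative (rot (circ t) \<bullet> D2 t + (- circ t) \<bullet> D t)) (at t)"
      by (rule bounded_bilinear.has_vector_derivative[OF bounded_bilinear_inner rot_circ_has_vector_derivative D(2)])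
    then show ?thesis unfolding \<kappa>_def[abs_def] \<kappa>'_def using D(4) by simp
  qed
  have wdD: "D s = D t" if "circ s = circ t" for s t
    by (rule derivative_factors_through_circ[where f="\<lambda>s. \<Phi> (circ s)", OF _ D(1) that]) simp
  have wd\<kappa>: "\<kappa> s = \<kappa> t" if "circ s = circ t" for s t
    using wdD[OF that] that by (simp add: \<kappa>_def)
  have ccirc: "continuous_on S circ" for S
    by (rule continuous_on_vector_derivative) (rule circ_has_vector_derivative)
  have "\<exists>K. \<forall>t. 0 \<le> t \<and> t \<le> 2*pi \<longrightarrow> norm (\<Phi> (circ t)) \<le> K"
    by (rule bounded_on_period)
      (rule continuous_on_vector_derivative, rule has_vector_derivative_at_within, rule D(1))
  then obtain K1 where K1: "\<And>t. 0 \<le> t \<Longrightarrow> t \<le> 2*pi \<Longrightarrow> norm (\<Phi> (circ t)) \<le> K1"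
    by blast
  have "\<exists>K. \<forall>t. 0 \<le> t \<and> t \<le> 2*pi \<longrightarrow> norm (\<kappa> t) \<le> K"
    by (rule bounded_on_period)
      (rule continuous_on_vector_derivative, rule has_vector_derivative_at_within, rule \<kappa>d)
  then obtain K2 where K2: "\<And>t. 0 \<le> t \<Longrightarrow> t \<le> 2*pi \<Longrightarrow> norm (\<kappa> t) \<le> K2"
    by blast
  have "\<exists>K. \<forall>t. 0 \<le> t \<and> t \<le> 2*pi \<longrightarrow> norm (\<kappa>' t) \<le> K"
    by (rule bounded_on_period)
      (unfold \<kappa>'_def, intro continuous_intros ccirc continuous_on_subset[OF D(3)] subset_UNIV)
  then obtain K3 where K3: "\<And>t. 0 \<le> t \<Longrightarrow> t \<le> 2*pi \<Longrightarrow> norm (\<kappa>' t) \<le> K3"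
    by blast
  define K where "K = max 0 (max K1 (max K2 K3))"
  define F where "F z = \<Phi> (circ (ang z))" for z
  define l where "l z = \<kappa> (ang z)" for z
  define l' where "l' z = \<kappa>' (ang z)" for z
  have K0: "K \<ge> 0" by (simp add: K_def)
  have FK: "norm (F z) \<le> K" for z using K1[OF ang(1,2)[of z]] by (simp add: F_def K_def)
  have lK: "\<bar>l z\<bar> \<le> K" for z using K2[OF ang(1,2)[of z]] by (simp add: l_def K_def)
  have l'K: "\<bar>l' z\<bar> \<le> K" for z using K3[OF ang(1,2)[of z]] by (simp add: l'_def K_def)
  define F' where "F' z h = ((rot z \<bullet> h) / (z \<bullet> z) * l z / norm z) *\<^sub>R rot z" for z h
  have dF: "(F has_derivative F' z) (at z)" if "z \<noteq> 0" for z
  proof -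
    have "(F has_derivative (\<lambda>h. ((rot z \<bullet> h) / (z \<bullet> z)) *\<^sub>R D (ang z))) (at z)"
      unfolding F_def[abs_def] by (rule has_derivative_angular[OF _ D(1) that]) simp
    moreover have "D (ang z) = (l z / norm z) *\<^sub>R rot z"
      using circ_ang[OF that] by (simp add: D\<kappa> l_def rot_algebra)
    ultimately show ?thesis by (simp add: F'_def[abs_def])
  qed
  have dl: "(l has_derivative (\<lambda>h. (rot z \<bullet> h) / (z \<bullet> z) * l' z)) (at z)" if "z \<noteq> 0" for z
    using has_derivative_angular[OF wd\<kappa> \<kappa>d that] unfolding l_def[abs_def] l'_def by simp
  define \<Psi> where "\<Psi> z = (4 * (z \<bullet> z)) *\<^sub>R F z - (norm z * l z) *\<^sub>R z" for z
  define \<Psi>' where "\<Psi>' z h = (8 * (z \<bullet> h)) *\<^sub>R F z + (4 * (z \<bullet> z)) *\<^sub>R F' z h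
     - ((z \<bullet> h) / norm z * l z + norm z * ((rot z \<bullet> h) / (z \<bullet> z) * l' z)) *\<^sub>R z - (norm z * l z) *\<^sub>R h" for z h
  have d\<Psi>: "(\<Psi> has_derivative \<Psi>' z) (at z)" if "z \<noteq> 0" for z
    unfolding \<Psi>_def[abs_def] \<Psi>'_def[abs_def]
    by (rule derivative_eq_intros dF[OF that] dl[OF that] has_derivative_norm that refl ext)+
      (simp add: sgn_div_norm inner_commute algebra_simps divide_inverse)
  define G where "G z = (z \<bullet> z)\<^sup>2 *\<^sub>R F z + ((1 - z \<bullet> z) / 2) *\<^sub>R \<Psi> z" for z
  define \<gamma> where "\<gamma> z = norm z * l z * (z \<bullet> z)" for z
  define B where "B z h = (if z = 0 then 0 else (1/2) *\<^sub>R \<Psi>' z h)" for z h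
  have dG: "(G has_derivative (\<lambda>h. \<gamma> z *\<^sub>R h + (1 - z \<bullet> z) *\<^sub>R B z h)) (at z)" if z: "z \<noteq> 0" for z
  proof -
    have "(G has_derivative (\<lambda>h. (4 * (z \<bullet> z) * (z \<bullet> h)) *\<^sub>R F z + (z \<bullet> z)\<^sup>2 *\<^sub>R F' z h
         + ((1 - z \<bullet> z) / 2) *\<^sub>R \<Psi>' z h - (z \<bullet> h) *\<^sub>R \<Psi> z)) (at z)"
    proof -
      have a: "((\<lambda>z. (z \<bullet> z)\<^sup>2) has_derivative (\<lambda>h. 4 * (z \<bullet> z) * (z \<bullet> h))) (at z)"
        by (auto intro!: derivative_eq_intros simp: inner_commute)
      have b: "((\<lambda>z. (1 - z \<bullet> z) / 2) has_derivative (\<lambda>h. - (z \<bullet> h))) (at z)"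
        by (auto intro!: derivative_eq_intros simp: inner_commute)
      show ?thesis unfolding G_def[abs_def]
        by (rule has_derivative_eq_rhs[OF has_derivative_add[OF has_derivative_scaleR[OF a dF[OF z]]
              has_derivative_scaleR[OF b d\<Psi>[OF z]]]])
          (simp add: fun_eq_iff algebra_simps)
    qed
    moreover have "(4 * (z \<bullet> z) * (z \<bullet> h)) *\<^sub>R F z + (z \<bullet> z)\<^sup>2 *\<^sub>R F' z h
         + ((1 - z \<bullet> z) / 2) *\<^sub>R \<Psi>' z h - (z \<bullet> h) *\<^sub>R \<Psi> z = \<gamma> z *\<^sub>R h + (1 - z \<bullet> z) *\<^sub>R B z h" for h
    proof -
      have "(z \<bullet> z)\<^sup>2 *\<^sub>R F' z h = ((z \<bullet> z) / norm z * l z) *\<^sub>R ((rot z \<bullet> h) *\<^sub>R rot z)"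
        using z by (simp add: F'_def power2_eq_square)
      also have "(z \<bullet> z) / norm z * l z = norm z * l z"
        using z by (simp add: dot_square_norm power2_eq_square)
      finally have 1: "(z \<bullet> z)\<^sup>2 *\<^sub>R F' z h = (norm z * l z) *\<^sub>R ((rot z \<bullet> h) *\<^sub>R rot z)" .
      have 2: "(4 * (z \<bullet> z) * (z \<bullet> h)) *\<^sub>R F z - (z \<bullet> h) *\<^sub>R \<Psi> z = (norm z * l z) *\<^sub>R ((z \<bullet> h) *\<^sub>R z)"
        by (simp add: \<Psi>_def algebra_simps)
      have 3: "\<gamma> z *\<^sub>R h = (norm z * l z) *\<^sub>R ((z \<bullet> h) *\<^sub>R z) + (norm z * l z) *\<^sub>R ((rot z \<bullet> h) *\<^sub>R rot z)"
        unfolding \<gamma>_def scaleR_scaleR[symmetric] rot_frame[of z h] by (simp add: scaleR_add_right)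
      have 4: "((1 - z \<bullet> z) / 2) *\<^sub>R \<Psi>' z h = (1 - z \<bullet> z) *\<^sub>R B z h"
        using z by (simp add: B_def)
      show ?thesis unfolding 3 4[symmetric] 1 2[symmetric] by simp
    qed
    ultimately show ?thesis by simp
  qed
  have cs: "\<bar>z \<bullet> h\<bar> \<le> norm z * norm h" "\<bar>rot z \<bullet> h\<bar> \<le> norm z * norm h" for z h :: "real^2"
    using Cauchy_Schwarz_ineq2[of z h] Cauchy_Schwarz_ineq2[of "rot z" h] by simp_all
  have B\<Psi>: "norm (\<Psi>' z h) \<le> 20 * K * norm h" if z: "z \<noteq> 0" "norm z \<le> 1" for z h
  proof -
    have nz: "norm z > 0" using z by simp
    have zz: "z \<bullet> z = norm z * norm z" by (simp add: dot_square_norm power2_eq_square)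
    have s: "norm z * norm h * K \<le> K * norm h"
      using z K0 mult_right_mono[of "norm z" 1 "norm h * K"] by (simp add: mult_ac)
    have "norm ((8 * (z \<bullet> h)) *\<^sub>R F z) \<le> 8 * (norm z * norm h) * K"
      unfolding norm_scaleR using cs(1)[of z h] FK[of z] K0 by (intro mult_mono) (auto simp: abs_mult)
    then have 1: "norm ((8 * (z \<bullet> h)) *\<^sub>R F z) \<le> 8 * (K * norm h)" using s by simp
    have "norm ((4 * (z \<bullet> z)) *\<^sub>R F' z h) = 4 * (\<bar>rot z \<bullet> h\<bar> * \<bar>l z\<bar>)"
      using nz by (simp add: F'_def abs_mult zz)
    also have "\<dots> \<le> 4 * ((norm z * norm h) * K)"
      using cs(2)[of z h] lK[of z] by (intro mult_left_mono mult_mono) auto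
    finally have 2: "norm ((4 * (z \<bullet> z)) *\<^sub>R F' z h) \<le> 4 * (K * norm h)" using s by simp
    have a: "\<bar>(z \<bullet> h) / norm z * l z\<bar> \<le> norm h * K"
      unfolding abs_mult using cs(1)[of z h] lK[of z] nz
      by (intro mult_mono) (auto simp: field_simps)
    have b: "\<bar>norm z * ((rot z \<bullet> h) / (z \<bullet> z) * l' z)\<bar> \<le> norm h * K"
    proof -
      have "\<bar>norm z * ((rot z \<bullet> h) / (z \<bullet> z) * l' z)\<bar> = \<bar>rot z \<bullet> h\<bar> / norm z * \<bar>l' z\<bar>"
        using nz by (simp add: zz abs_mult)
      also have "\<dots> \<le> norm h * K" using cs(2)[of z h] l'K[of z] nz
        by (intro mult_mono) (auto simp: field_simps)
      finally show ?thesis .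
    qed
    have "norm (((z \<bullet> h) / norm z * l z + norm z * ((rot z \<bullet> h) / (z \<bullet> z) * l' z)) *\<^sub>R z)
       \<le> (norm h * K + norm h * K) * 1"
      unfolding norm_scaleR using K0
      by (intro mult_mono order_trans[OF abs_triangle_ineq] add_mono a b z(2)) auto
    then have 3: "norm (((z \<bullet> h) / norm z * l z + norm z * ((rot z \<bullet> h) / (z \<bullet> z) * l' z)) *\<^sub>R z)
       \<le> 2 * (K * norm h)" by simp
    have "norm ((norm z * l z) *\<^sub>R h) \<le> (1 * K) * norm h"
      unfolding norm_scaleR abs_mult abs_norm_cancel using z lK[of z] K0 by (intro mult_mono) auto
    then have 4: "norm ((norm z * l z) *\<^sub>R h) \<le> K * norm h" by simp
    have "norm (\<Psi>' z h) \<le> 8 * (K * norm h) + 4 * (K * norm h) + 2 * (K * norm h) + K * norm h"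
      unfolding \<Psi>'_def
      by (intro order_trans[OF norm_triangle_ineq4] order_trans[OF norm_triangle_ineq] add_mono 1 2 3 4)
    also have "\<dots> \<le> 20 * K * norm h" using K0 by simp
    finally show ?thesis .
  qed
  have dG0: "(G has_derivative (\<lambda>h. \<gamma> 0 *\<^sub>R h + (1 - 0 \<bullet> 0) *\<^sub>R B 0 h)) (at 0)"
  proof -
    have "norm (G z) \<le> (10 * K) * norm z * norm z" if z: "norm z < 1" for z
    proof -
      have zz: "z \<bullet> z = norm z * norm z" by (simp add: dot_square_norm power2_eq_square)
      have n1: "norm z * norm z \<le> 1" using z mult_mono[of "norm z" 1 "norm z" 1] by simp
      have n0: "0 \<le> norm z * norm z" by simp
      have half: "\<bar>(1 - z \<bullet> z) / 2\<bar> \<le> 1" 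
      proof -
        have "\<bar>(1 - r) / 2\<bar> \<le> 1" if "0 \<le> r" "r \<le> 1" for r :: real using that by (simp add: abs_le_iff)
        then show ?thesis unfolding zz using n0 n1 by blast
      qed
      have "norm (\<Psi> z) \<le> (4 * (norm z * norm z)) * K + (norm z * K) * norm z"
        unfolding \<Psi>_def using FK[of z] lK[of z]
        by (intro order_trans[OF norm_triangle_ineq4] add_mono)
          (auto simp: zz abs_mult intro!: mult_mono mult_left_mono mult_right_mono)
      then have p: "norm (\<Psi> z) \<le> 5 * K * norm z * norm z" by (simp add: algebra_simps)
      have "norm (((1 - z \<bullet> z) / 2) *\<^sub>R \<Psi> z) \<le> 1 * (5 * K * norm z * norm z)"
        unfolding norm_scaleR by (intro mult_mono half p) auto
      moreover have "norm ((z \<bullet> z)\<^sup>2 *\<^sub>R F z) \<le> (norm z * norm z) * K"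
        using FK[of z] n1 mult_mono[of "norm z * norm z" 1 "norm z * norm z" "norm z * norm z"]
        unfolding norm_scaleR by (intro mult_mono) (auto simp: zz power2_eq_square)
      ultimately have "norm (G z) \<le> 1 * (5 * K * norm z * norm z) + (norm z * norm z) * K"
        unfolding G_def using norm_triangle_ineq[of "(z \<bullet> z)\<^sup>2 *\<^sub>R F z" "((1 - z \<bullet> z) / 2) *\<^sub>R \<Psi> z"]
        by linarith
      also have "\<dots> \<le> (10 * K) * norm z * norm z" using K0 by (simp add: algebra_simps)
      finally show ?thesis .
    qed
    then have "(G has_derivative (\<lambda>h. 0)) (at 0)"
      by (intro has_derivativeI_sandwich[where H="\<lambda>z. (10 * K) * norm z" and e=1])
        (auto intro!: tendsto_eq_intros simp: dist_norm divide_simps G_def \<Psi>_def)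
    then show ?thesis by (simp add: \<gamma>_def B_def)
  qed
  show ?thesis
  proof (rule that[of G \<gamma> B "20 * K"])
    show "(G has_derivative (\<lambda>h. \<gamma> z *\<^sub>R h + (1 - z \<bullet> z) *\<^sub>R B z h)) (at z)" for z
      using dG dG0 by (cases "z = 0") auto
    show "norm (B z h) \<le> 20 * K * norm h" if "norm z \<le> 1" for z h
    proof (cases "z = 0")
      case False
      then have "norm (B z h) \<le> norm (\<Psi>' z h)" by (simp add: B_def)
      then show ?thesis using B\<Psi>[OF False that, of h] by linarith
    qed (use K0 in \<open>simp add: B_def\<close>)
    show "\<bar>\<gamma> z\<bar> \<le> 20 * K" if "norm z \<le> 1" for z
    proof -
      have "\<bar>\<gamma> z\<bar> = norm z * norm z * norm z * \<bar>l z\<bar>"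
        by (simp add: \<gamma>_def abs_mult dot_square_norm power2_eq_square)
      also have "\<dots> \<le> 1 * 1 * 1 * K" using that lK[of z] by (intro mult_mono) auto
      finally show ?thesis using K0 by simp
    qed
    show "G (circ t) = \<Phi> (circ t)" for t
    proof -
      have "circ (ang (circ t)) = circ t" using ang(3)[of "circ t"] by simp
      then show ?thesis by (simp add: G_def F_def)
    qed
  qed (use K0 in simp)
qed

section \<open>Entropies approximating a sign\<close>

text \<open>The curve with support function \<open>\<phi> t = sqrt (cos\<^sup>2 (t - \<alpha>) + \<delta>\<^sup>2)\<close>, where \<open>\<xi>\<close> has angle \<open>\<alpha>\<close>: for every
  periodic \<open>\<phi>\<close> the map \<open>\<phi> n + \<phi>' \<tau>\<close> with radial and tangential unit vectors \<open>n\<close>, \<open>\<tau>\<close> has the tangential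
  derivative \<open>(\<phi> + \<phi>'') \<tau>\<close>, so it is an entropy. For \<open>\<delta> = 0\<close> it is \<open>sgn (z \<bullet> \<xi>) \<xi>\<close>.\<close>

definition sign_entropy :: "real \<Rightarrow> real^2 \<Rightarrow> real^2 \<Rightarrow> real^2" where
  "sign_entropy \<delta> \<xi> z = sqrt ((z \<bullet> \<xi>)\<^sup>2 + \<delta>\<^sup>2) *\<^sub>R z
     + ((z \<bullet> \<xi>) * (rot z \<bullet> \<xi>) / sqrt ((z \<bullet> \<xi>)\<^sup>2 + \<delta>\<^sup>2)) *\<^sub>R rot z"

lemma sign_entropy_in_ENT:
  assumes "\<delta> > 0" "norm \<xi> = 1"
  shows "sign_entropy \<delta> \<xi> \<in> ENT"
proof -
  define c where "c t = circ t \<bullet> \<xi>" for t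
  define c' where "c' t = rot (circ t) \<bullet> \<xi>" for t
  define q where "q t = sqrt ((c t)\<^sup>2 + \<delta>\<^sup>2)" for t
  define k where "k = \<delta>\<^sup>2 * (1 + \<delta>\<^sup>2)"
  define \<kappa> where "\<kappa> t = k / (q t)^3" for t
  define \<kappa>' where "\<kappa>' t = - 3 * k * c t * c' t / (q t)^5" for t
  have pos: "(c t)\<^sup>2 + \<delta>\<^sup>2 > 0" for t using assms by (simp add: add_nonneg_pos)
  have q: "q t > 0" "(q t)\<^sup>2 = (c t)\<^sup>2 + \<delta>\<^sup>2" for t using pos[of t] by (simp_all add: q_def)
  have cc: "(c t)\<^sup>2 + (c' t)\<^sup>2 = 1" for t
  proof -
    have "(circ t \<bullet> circ t) * (\<xi> \<bullet> \<xi>) = (c t)\<^sup>2 + (c' t)\<^sup>2"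
      unfolding c_def c'_def by (rule plane_lagrange)
    then show ?thesis using assms by (simp add: dot_square_norm)
  qed
  have dc: "(c has_real_derivative c' t) (at t)" for t
    unfolding has_real_derivative_iff_has_vector_derivative c_def c'_def
    by (rule bounded_linear.has_vector_derivative[OF bounded_linear_inner_left circ_has_vector_derivative])
  have dc': "(c' has_real_derivative - c t) (at t)" for t
    unfolding has_real_derivative_iff_has_vector_derivative c_def c'_def
    using bounded_linear.has_vector_derivative[OF bounded_linear_inner_left rot_circ_has_vector_derivative]
    by simp
  have dq: "(q has_real_derivative c t * c' t / q t) (at t)" for t
  proof -
    have "(q has_real_derivative (2 * c t * c' t) * (inverse (q t) / 2)) (at t)"
      unfolding q_def[abs_def] using pos[of t] by (auto intro!: derivative_eq_intros dc)
    then show ?thesis by (rule DERIV_cong) (use q(1)[of t] in \<open>simp add: field_simps\<close>)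
  qed
  define D where "D t = \<kappa> t *\<^sub>R rot (circ t)" for t
  define D2 where "D2 t = \<kappa>' t *\<^sub>R rot (circ t) - \<kappa> t *\<^sub>R circ t" for t
  have D: "((\<lambda>t. sign_entropy \<delta> \<xi> (circ t)) has_vector_derivative D t) (at t)" for t
  proof -
    have q0: "q t \<noteq> 0" using q(1)[of t] by simp
    have eq: "(\<lambda>t. sign_entropy \<delta> \<xi> (circ t)) = (\<lambda>t. q t *\<^sub>R circ t + (c t * c' t / q t) *\<^sub>R rot (circ t))"
      by (simp add: sign_entropy_def q_def c_def c'_def)
    have "((\<lambda>t. c t * c' t / q t) has_real_derivative
       ((c' t * c' t + c t * (- c t)) * q t - (c t * c' t) * (c t * c' t / q t)) / (q t * q t)) (at t)"
      by (rule derivative_eq_intros dc dc' dq refl q0)+ simp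
    then have "((\<lambda>t. q t *\<^sub>R circ t + (c t * c' t / q t) *\<^sub>R rot (circ t)) has_vector_derivative
       (q t *\<^sub>R rot (circ t) + (c t * c' t / q t) *\<^sub>R circ t) +
       ((c t * c' t / q t) *\<^sub>R (- circ t) + (((c' t * c' t + c t * (- c t)) * q t - (c t * c' t) * (c t * c' t / q t)) / (q t * q t)) *\<^sub>R rot (circ t))) (at t)"
      by (intro has_vector_derivative_add has_vector_derivative_scaleR dq
          circ_has_vector_derivative rot_circ_has_vector_derivative)
    moreover have "q t + ((c' t * c' t + c t * (- c t)) * q t - (c t * c' t) * (c t * c' t / q t)) / (q t * q t) = \<kappa> t"
    proof -
      have "q t + ((c' t * c' t + c t * (- c t)) * q t - (c t * c' t) * (c t * c' t / q t)) / (q t * q t)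
        = ((q t)\<^sup>2 * (q t)\<^sup>2 + ((c' t)\<^sup>2 - (c t)\<^sup>2) * (q t)\<^sup>2 - (c t)\<^sup>2 * (c' t)\<^sup>2) / (q t)^3"
        using q0 by (simp add: field_simps power2_eq_square power3_eq_cube)
      also have "(q t)\<^sup>2 * (q t)\<^sup>2 + ((c' t)\<^sup>2 - (c t)\<^sup>2) * (q t)\<^sup>2 - (c t)\<^sup>2 * (c' t)\<^sup>2 = \<delta>\<^sup>2 * ((c t)\<^sup>2 + (c' t)\<^sup>2 + \<delta>\<^sup>2)"
        unfolding q(2) by (simp add: algebra_simps)
      finally show ?thesis by (simp add: cc \<kappa>_def k_def)
    qed
    ultimately show ?thesis unfolding eq D_def
      by (simp flip: scaleR_add_left add: add.assoc add.left_commute)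
  qed
  have D2: "(D has_vector_derivative D2 t) (at t)" for t
  proof -
    have q0: "q t \<noteq> 0" using q(1)[of t] by simp
    have "(\<kappa> has_real_derivative \<kappa>' t) (at t)"
      unfolding \<kappa>_def[abs_def] \<kappa>'_def
      by (rule derivative_eq_intros dq refl | use q0 in \<open>simp add: field_simps eval_nat_numeral\<close>)+
    then have "(D has_vector_derivative \<kappa> t *\<^sub>R (- circ t) + \<kappa>' t *\<^sub>R rot (circ t)) (at t)"
      unfolding D_def[abs_def] by (intro has_vector_derivative_scaleR rot_circ_has_vector_derivative)
    then show ?thesis by (simp add: D2_def)
  qed
  have ccirc: "continuous_on UNIV circ"
    by (rule continuous_on_vector_derivative) (rule circ_has_vector_derivative)
  have cont: "continuous_on UNIV D2"
    unfolding D2_def[abs_def] \<kappa>_def \<kappa>'_def q_def c_def c'_def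
    by (intro continuous_intros ccirc) (use pos in \<open>auto simp: c_def less_imp_neq[symmetric]\<close>)
  have "circ t \<bullet> D t = 0" for t by (simp add: D_def)
  then show ?thesis using D D2 cont unfolding ENT_def by blast
qed

text \<open>For unit \<open>z\<close> one has \<open>\<xi> = (z \<bullet> \<xi>) z + (rot z \<bullet> \<xi>) rot z\<close>, which identifies the limit.\<close>

lemma sign_entropy_limit:
  assumes "norm z = 1"
  shows "((\<lambda>n. sign_entropy (inverse (real (Suc n))) \<xi> z) \<longlonglongrightarrow> sgn (z \<bullet> \<xi>) *\<^sub>R \<xi>)"
proof -
  define c where "c = z \<bullet> \<xi>"
  have xi: "\<xi> = c *\<^sub>R z + (rot z \<bullet> \<xi>) *\<^sub>R rot z"
    using rot_frame[of z \<xi>] assms by (simp add: c_def dot_square_norm)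
  have l: "(\<lambda>n. sqrt (c\<^sup>2 + (inverse (real (Suc n)))\<^sup>2)) \<longlonglongrightarrow> sqrt (c\<^sup>2 + 0\<^sup>2)"
    by (intro tendsto_intros LIMSEQ_inverse_real_of_nat)
  show ?thesis
  proof (cases "c = 0")
    case True
    then show ?thesis
      using tendsto_scaleR[OF LIMSEQ_inverse_real_of_nat tendsto_const[of z]]
      by (simp add: sign_entropy_def flip: c_def)
  next
    case False
    have "(\<lambda>n. sign_entropy (inverse (real (Suc n))) \<xi> z) \<longlonglongrightarrow>
        sqrt (c\<^sup>2 + 0\<^sup>2) *\<^sub>R z + (c * (rot z \<bullet> \<xi>) / sqrt (c\<^sup>2 + 0\<^sup>2)) *\<^sub>R rot z"
      unfolding sign_entropy_def c_def[symmetric] by (intro tendsto_intros l) (use False in simp)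
    also have "sqrt (c\<^sup>2 + 0\<^sup>2) *\<^sub>R z + (c * (rot z \<bullet> \<xi>) / sqrt (c\<^sup>2 + 0\<^sup>2)) *\<^sub>R rot z
       = sgn c *\<^sub>R (c *\<^sub>R z + (rot z \<bullet> \<xi>) *\<^sub>R rot z)"
      using False by (simp add: scaleR_add_right sgn_if abs_if)
    finally show ?thesis using xi by (simp add: c_def)
  qed
qed

lemma sign_entropy_bound:
  assumes "norm z = 1" "norm \<xi> = 1" "0 < \<delta>" "\<delta> \<le> 1"
  shows "norm (sign_entropy \<delta> \<xi> z) \<le> 3"
proof -
  define c where "c = z \<bullet> \<xi>"
  define q where "q = sqrt (c\<^sup>2 + \<delta>\<^sup>2)"
  have c: "\<bar>c\<bar> \<le> 1" "\<bar>rot z \<bullet> \<xi>\<bar> \<le> 1"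
    using Cauchy_Schwarz_ineq2[of z \<xi>] Cauchy_Schwarz_ineq2[of "rot z" \<xi>] assms by (simp_all add: c_def)
  have cq: "\<bar>c\<bar> \<le> q" by (simp add: q_def real_le_rsqrt)
  have q: "q > 0" using assms by (simp add: q_def add_nonneg_pos)
  have "c\<^sup>2 \<le> 1" "\<delta>\<^sup>2 \<le> 1" using c assms by (simp_all add: abs_square_le_1 power_le_one)
  then have "q \<le> sqrt 4" unfolding q_def by (intro real_sqrt_le_mono) linarith
  then have q2: "q \<le> 2" by simp
  have "\<bar>c * (rot z \<bullet> \<xi>) / q\<bar> = (\<bar>c\<bar> / q) * \<bar>rot z \<bullet> \<xi>\<bar>" using q by (simp add: abs_mult)
  also have "\<dots> \<le> 1 * 1" using c cq q by (intro mult_mono) auto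
  finally have "norm (q *\<^sub>R z) + norm ((c * (rot z \<bullet> \<xi>) / q) *\<^sub>R rot z) \<le> 3"
    using q2 q assms by (simp only: norm_scaleR norm_rot abs_of_pos)
  then show ?thesis unfolding sign_entropy_def c_def[symmetric] q_def[symmetric]
    using norm_triangle_ineq order_trans by blast
qed

section \<open>Smooth bumps\<close>

lemma power_le_fact_exp:
  fixes u :: real
  assumes "u \<ge> 0"
  shows "u ^ n \<le> fact n * exp u"
proof -
  have s: "(\<lambda>k. u ^ k /\<^sub>R fact k) sums exp u" by (rule exp_converges)
  have "sum (\<lambda>k. u ^ k /\<^sub>R fact k) {n} \<le> (\<Sum>k. u ^ k /\<^sub>R fact k)"
    by (rule sum_le_suminf) (use s assms in \<open>auto simp: sums_iff\<close>)
  then have "u ^ n /\<^sub>R fact n \<le> exp u" using s by (simp add: sums_iff)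
  then show ?thesis by (simp add: field_simps)
qed

definition flat :: "nat \<Rightarrow> real \<Rightarrow> real" where
  "flat n s = (if s \<le> 0 then 0 else inverse s ^ n * exp (- inverse s))"

lemma flat_le_square: "0 \<le> flat n s" "flat n s \<le> fact (n + 2) * s\<^sup>2"
proof -
  show "0 \<le> flat n s" by (simp add: flat_def)
  show "flat n s \<le> fact (n + 2) * s\<^sup>2"
  proof (cases "s \<le> 0")
    case False
    then have s: "s > 0" by simp
    have "inverse s ^ n * (inverse s)\<^sup>2 \<le> fact (n + 2) * exp (inverse s)"
      using power_le_fact_exp[of "inverse s" "n + 2"] s unfolding power_add by simp
    then have "inverse s ^ n * (inverse s)\<^sup>2 * (s\<^sup>2 * exp (- inverse s))
        \<le> fact (n + 2) * exp (inverse s) * (s\<^sup>2 * exp (- inverse s))"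
      by (rule mult_right_mono) simp
    moreover have "inverse s ^ n * (inverse s)\<^sup>2 * (s\<^sup>2 * exp (- inverse s)) = flat n s"
    proof -
      have "inverse s ^ n * (inverse s)\<^sup>2 * (s\<^sup>2 * exp (- inverse s))
          = inverse s ^ n * exp (- inverse s) * ((inverse s)\<^sup>2 * s\<^sup>2)"
        by (simp only: mult_ac)
      also have "(inverse s)\<^sup>2 * s\<^sup>2 = 1" using s by (simp flip: power_mult_distrib)
      finally show ?thesis using s by (simp add: flat_def)
    qed
    moreover have "fact (n + 2) * exp (inverse s) * (s\<^sup>2 * exp (- inverse s)) = fact (n + 2) * s\<^sup>2"
      by (simp add: exp_minus)
    ultimately show ?thesis by (simp only:)
  qed (simp add: flat_def)
qed

lemma flat_has_derivative:
  "(flat n has_real_derivative flat (n + 2) s - real n * flat (n + 1) s) (at s)"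
proof -
  consider "s > 0" | "s < 0" | "s = 0" by linarith
  then show ?thesis
  proof cases
    case 1
    have "((\<lambda>s. inverse s ^ n * exp (- inverse s)) has_real_derivative
       (flat (n + 2) s - real n * flat (n + 1) s)) (at s)"
      by (cases n) (rule derivative_eq_intros refl | use 1 in \<open>simp add: flat_def algebra_simps power2_eq_square\<close>)+
    then show ?thesis
      by (rule has_field_derivative_transform_within_open[where S="{0<..}"]) (use 1 in \<open>auto simp: flat_def\<close>)
  next
    case 2
    have "((\<lambda>s. 0) has_real_derivative (flat (n + 2) s - real n * flat (n + 1) s)) (at s)"
      using 2 by (simp add: flat_def)
    then show ?thesis
      by (rule has_field_derivative_transform_within_open[where S="{..<0}"]) (use 2 in \<open>auto simp: flat_def\<close>)
  next
    case 3
    have "(flat n has_derivative (\<lambda>h. 0)) (at 0)"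
    proof (rule has_derivativeI_sandwich[where e=1 and H="\<lambda>s. fact (n + 2) * \<bar>s\<bar>"])
      fix y :: real assume y: "y \<noteq> 0"
      have "\<bar>flat n y\<bar> \<le> (fact (n + 2) * \<bar>y\<bar>) * \<bar>y\<bar>"
        using flat_le_square[of n y] by (simp add: power2_eq_square mult.assoc)
      then show "norm (flat n y - flat n 0 - 0) / norm (y - 0) \<le> fact (n + 2) * \<bar>y\<bar>"
        using y by (simp add: flat_def divide_le_eq)
    qed (auto intro!: tendsto_eq_intros)
    moreover have "(\<lambda>h. 0) = (*) (0::real)" by auto
    ultimately show ?thesis using 3 by (simp add: has_field_derivative_def flat_def)
  qed
qed

text \<open>A class closed under partial derivatives, so that membership implies differentiability of every
  order by induction. Its generators contain smooth functions with support in a prescribed disc.\<close>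

inductive_set bumps :: "(real^2 \<Rightarrow> real) set" where
  const: "(\<lambda>x. c) \<in> bumps"
| coord: "(\<lambda>x. x $ i) \<in> bumps"
| bump: "(\<lambda>x. flat n (\<alpha> - \<beta> * ((x - a) \<bullet> (x - a)))) \<in> bumps"
| add: "f \<in> bumps \<Longrightarrow> g \<in> bumps \<Longrightarrow> (\<lambda>x. f x + g x) \<in> bumps"
| mult: "f \<in> bumps \<Longrightarrow> g \<in> bumps \<Longrightarrow> (\<lambda>x. f x * g x) \<in> bumps"

lemma bumps_gradient:
  assumes "f \<in> bumps"
  shows "\<exists>G. (\<forall>x. (f has_derivative (\<lambda>h. G x \<bullet> h)) (at x)) \<and> (\<forall>i. (\<lambda>x. G x $ i) \<in> bumps)"
  using assms
proof induction
  case (const c)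
  show ?case by (intro exI[of _ "\<lambda>x. 0"]) (auto intro: bumps.const)
next
  case (coord i)
  have "((\<lambda>x::real^2. x $ i) has_derivative (\<lambda>h. axis i 1 \<bullet> h)) (at x)" for x
    using bounded_linear_imp_has_derivative[OF bounded_linear_vec_nth[of i]] by (simp add: inner_axis')
  then show ?case by (intro exI[of _ "\<lambda>x. axis i 1"]) (auto intro: bumps.const)
next
  case (bump n \<alpha> \<beta> a)
  define s where "s x = \<alpha> - \<beta> * ((x - a) \<bullet> (x - a))" for x :: "real^2"
  define d where "d x = (flat (n + 2) (s x) + (- real n) * flat (n + 1) (s x)) * (- 2 * \<beta>)" for x
  have "((\<lambda>x. flat n (s x)) has_derivative (\<lambda>h. (d x *\<^sub>R (x - a)) \<bullet> h)) (at x)" for x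
  proof -
    have "(s has_derivative (\<lambda>h. - 2 * \<beta> * ((x - a) \<bullet> h))) (at x)"
      unfolding s_def[abs_def] by (auto intro!: derivative_eq_intros simp: inner_commute)
    moreover have "(flat n has_derivative (*) (flat (n + 2) (s x) - real n * flat (n + 1) (s x))) (at (s x))"
      using flat_has_derivative has_field_derivative_def by blast
    ultimately have "(flat n \<circ> s has_derivative
       (*) (flat (n + 2) (s x) - real n * flat (n + 1) (s x)) \<circ> (\<lambda>h. - 2 * \<beta> * ((x - a) \<bullet> h))) (at x)"
      by (rule diff_chain_at)
    then show ?thesis by (simp add: o_def d_def algebra_simps)
  qed
  moreover have "(\<lambda>x. (d x *\<^sub>R (x - a)) $ i) \<in> bumps" for i
  proof -
    have "d \<in> bumps" unfolding d_def[abs_def] s_def by (intro bumps.intros)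
    then have "(\<lambda>x. d x * (x $ i + (- a $ i))) \<in> bumps" by (intro bumps.intros)
    then show ?thesis by simp
  qed
  ultimately show ?case unfolding s_def by (intro exI[of _ "\<lambda>x. d x *\<^sub>R (x - a)"]) blast
next
  case (add f g)
  then obtain F G where F: "\<And>x. (f has_derivative (\<lambda>h. F x \<bullet> h)) (at x)" "\<And>i. (\<lambda>x. F x $ i) \<in> bumps"
    and G: "\<And>x. (g has_derivative (\<lambda>h. G x \<bullet> h)) (at x)" "\<And>i. (\<lambda>x. G x $ i) \<in> bumps"
    by blast
  have "((\<lambda>x. f x + g x) has_derivative (\<lambda>h. (F x + G x) \<bullet> h)) (at x)" for x
    unfolding inner_add_left by (intro has_derivative_add F G)
  moreover have "(\<lambda>x. (F x + G x) $ i) \<in> bumps" for i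
    using bumps.add[OF F(2) G(2)] by simp
  ultimately show ?case by (intro exI[of _ "\<lambda>x. F x + G x"]) blast
next
  case (mult f g)
  then obtain F G where F: "\<And>x. (f has_derivative (\<lambda>h. F x \<bullet> h)) (at x)" "\<And>i. (\<lambda>x. F x $ i) \<in> bumps"
    and G: "\<And>x. (g has_derivative (\<lambda>h. G x \<bullet> h)) (at x)" "\<And>i. (\<lambda>x. G x $ i) \<in> bumps"
    by blast
  have "((\<lambda>x. f x * g x) has_derivative (\<lambda>h. (f x *\<^sub>R G x + g x *\<^sub>R F x) \<bullet> h)) (at x)" for x
    using has_derivative_mult[OF F(1)[of x] G(1)[of x]] by (simp add: inner_add_left mult.commute)
  moreover have "(\<lambda>x. (f x *\<^sub>R G x + g x *\<^sub>R F x) $ i) \<in> bumps" for i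
    using bumps.add[OF bumps.mult[OF mult.hyps(1) G(2)] bumps.mult[OF mult.hyps(2) F(2)]] by simp
  ultimately show ?case by (intro exI[of _ "\<lambda>x. f x *\<^sub>R G x + g x *\<^sub>R F x"]) blast
qed

lemma bumps_continuous: "f \<in> bumps \<Longrightarrow> continuous_on S f"
  by (drule bumps_gradient) (auto intro!: continuous_at_imp_continuous_on intro: has_derivative_continuous)

lemma bumps_C_k: "f \<in> bumps \<Longrightarrow> C_k k f"
proof (induction k arbitrary: f)
  case (Suc k)
  then show ?case using bumps_gradient[of f] by auto
qed (simp add: bumps_continuous)

lemma gradient_eq:
  assumes "(\<phi> has_derivative (\<lambda>h. G \<bullet> h)) (at x)"
  shows "gradient \<phi> x = G"
  unfolding gradient_def frechet_derivative_at[OF assms, symmetric]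
  by (rule vec_eq_iff[THEN iffD2]) (simp add: inner_axis)

lemma compact_gradient_lipschitz:
  fixes f :: "real^2 \<Rightarrow> real"
  assumes G: "\<And>x. (f has_derivative (\<lambda>h. G x \<bullet> h)) (at x)" "continuous_on UNIV G"
    and S: "compact S" "\<And>x. x \<notin> S \<Longrightarrow> G x = 0"
  obtains L where "L \<ge> 0" "\<And>x y. \<bar>f x - f y\<bar> \<le> L * norm (x - y)" "\<And>x. norm (G x) \<le> L"
proof -
  have "bounded (G ` S)"
    by (intro compact_imp_bounded compact_continuous_image S continuous_on_subset[OF G(2)]) simp
  then obtain L where L: "\<And>x. x \<in> S \<Longrightarrow> norm (G x) \<le> L" unfolding bounded_iff by auto
  have b: "norm (G x) \<le> max 0 L" for x using L[of x] S(2)[of x] by (cases "x \<in> S") auto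
  have "norm (f x - f y) \<le> max 0 L * norm (x - y)" for x y
  proof (rule differentiable_bound[OF convex_UNIV])
    show "(f has_derivative (\<lambda>h. G x \<bullet> h)) (at x within UNIV)" for x using G by simp
    show "onorm (\<lambda>h. G x \<bullet> h) \<le> max 0 L" for x
      by (rule onorm_bound) (use b[of x] in \<open>auto intro!: order_trans[OF Cauchy_Schwarz_ineq2] mult_right_mono\<close>)
  qed auto
  then show ?thesis using that[of "max 0 L"] b by auto
qed

lemma taylor_quadratic:
  fixes f :: "real^2 \<Rightarrow> real"
  assumes G: "\<And>x. (f has_derivative (\<lambda>h. G x \<bullet> h)) (at x)"
    and L: "\<And>x y. norm (G x - G y) \<le> L * norm (x - y)"
  shows "\<bar>f (w + v) - f w - G w \<bullet> v\<bar> \<le> L * (norm v)\<^sup>2"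
proof -
  have "0 \<le> L * norm (v - 0)" using L[of v 0] norm_ge_zero order_trans by blast
  have "norm (f (w + v) - f w - (\<lambda>h. G w \<bullet> h) (w + v - w)) \<le> norm (w + v - w) * (L * norm v)"
  proof (rule differentiable_bound_linearization[where S="cball w (norm v)" and f'="\<lambda>x h. G x \<bullet> h"])
    show "w + t *\<^sub>R (w + v - w) \<in> cball w (norm v)" if "t \<in> {0..1}" for t
      using that by (auto simp: dist_norm mult_left_le_one_le)
    show "(f has_derivative (\<lambda>h. G x \<bullet> h)) (at x within cball w (norm v))" for x
      by (rule has_derivative_at_withinI[OF G])
    show "onorm ((\<lambda>h. G x \<bullet> h) - (\<lambda>h. G w \<bullet> h)) \<le> L * norm v" if x: "x \<in> cball w (norm v)" for x
    proof (rule onorm_bound)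
      show "0 \<le> L * norm v" using \<open>0 \<le> L * norm (v - 0)\<close> by simp
      have "norm (G x - G w) \<le> L * norm v"
      proof (cases "v = 0")
        case False
        then have "L \<ge> 0" using \<open>0 \<le> L * norm (v - 0)\<close> by (simp add: zero_le_mult_iff)
        then show ?thesis using L[of x w] x mult_left_mono[of "norm (x - w)" "norm v" L]
          by (auto simp: dist_norm norm_minus_commute)
      qed (use x in simp)
      then show "norm (((\<lambda>h. G x \<bullet> h) - (\<lambda>h. G w \<bullet> h)) h) \<le> L * norm v * norm h" for h
        using order_trans[OF Cauchy_Schwarz_ineq2[of "G x - G w" h]] by (simp add: inner_diff_left mult_right_mono)
    qed
  qed simp
  then show ?thesis by (simp add: power2_eq_square mult_ac)
qed

section \<open>Convolution kernels\<close>

lemma gradient_vanishes_off_support: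
  fixes f :: "real^2 \<Rightarrow> real"
  assumes G: "(f has_derivative (\<lambda>h. G \<bullet> h)) (at x)" and S: "closed S" "\<And>x. x \<notin> S \<Longrightarrow> f x = 0" "x \<notin> S"
  shows "G = 0"
proof -
  have "((\<lambda>x. 0) has_derivative (\<lambda>h. G \<bullet> h)) (at x)"
    by (rule has_derivative_transform_within_open[OF G, of "- S"]) (use S in auto)
  then have "(\<lambda>h. G \<bullet> h) = (\<lambda>h. 0)" by (rule has_derivative_unique) (rule has_derivative_const)
  then have "G \<bullet> G = 0" by meson
  then show ?thesis by simp
qed

lemma integrable_box_support:
  fixes f :: "real^2 \<Rightarrow> 'b::{banach, second_countable_topology}"
  assumes m: "f \<in> borel_measurable borel" and b: "\<And>x. norm (f x) \<le> M"
    and z: "\<And>x. x \<notin> cbox a b \<Longrightarrow> f x = 0"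
  shows "integrable lborel f" "norm (LBINT x. f x) \<le> M * measure lborel (cbox a b)"
proof -
  have i: "integrable lborel (\<lambda>x. M * indicator (cbox a b) x :: real)"
    by (intro integrable_mult_right integrable_real_indicator emeasure_lborel_cbox_finite) simp
  have M0: "0 \<le> M" using b[of undefined] norm_ge_zero order_trans by blast
  have le: "norm (f x) \<le> M * indicator (cbox a b) x" for x
    using b[of x] z[of x] M0 by (auto simp: indicator_def)
  show *: "integrable lborel f"
    by (rule Bochner_Integration.integrable_bound[OF i]) (use m le M0 in \<open>auto intro!: AE_I2 simp: abs_mult\<close>)
  have "norm (LBINT x. f x) \<le> (LBINT x. norm (f x))" by (rule integral_norm_bound)
  also have "\<dots> \<le> (LBINT x. M * indicator (cbox a b) x)"
    by (rule integral_mono) (use * i le in auto)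
  finally show "norm (LBINT x. f x) \<le> M * measure lborel (cbox a b)" by simp
qed

lemma lborel_integral_shift:
  fixes f :: "real^2 \<Rightarrow> 'b::{banach, second_countable_topology}"
  assumes "f \<in> borel_measurable borel"
  shows "(LBINT x. f (c + x)) = (LBINT x. f x)"
proof -
  have "(\<integral>x. f x \<partial>distr lborel borel ((+) c)) = (LBINT x. f (c + x))"
    by (rule integral_distr) (use assms in auto)
  then show ?thesis by (simp add: lborel_distr_plus)
qed

lemma lborel_nn_integral_shift:
  fixes f :: "real^2 \<Rightarrow> ennreal"
  assumes "f \<in> borel_measurable borel"
  shows "(\<integral>\<^sup>+x. f (c + x) \<partial>lborel) = (\<integral>\<^sup>+x. f x \<partial>lborel)"
proof -
  have "(\<integral>\<^sup>+x. f x \<partial>distr lborel borel ((+) c)) = (\<integral>\<^sup>+x. f (c + x) \<partial>lborel)"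
    by (rule nn_integral_distr) (use assms in auto)
  then show ?thesis by (simp add: lborel_distr_plus)
qed

lemma lborel_integral_scale:
  fixes f :: "real^2 \<Rightarrow> real"
  assumes [measurable]: "f \<in> borel_measurable borel" and "e > 0"
  shows "(LBINT x. f ((1 / e) *\<^sub>R x)) = e\<^sup>2 * (LBINT x. f x)"
proof -
  have "(LBINT x. f ((1 / e) *\<^sub>R x))
      = (\<integral>x. f ((1 / e) *\<^sub>R x) \<partial>density (distr lborel borel (\<lambda>x. 0 + e *\<^sub>R x)) (\<lambda>_. ennreal (e\<^sup>2)))"
    by (subst lborel_affine[of e 0]) (use assms(2) in \<open>simp_all add: ennreal_power\<close>)
  also have "\<dots> = (\<integral>x. e\<^sup>2 *\<^sub>R f ((1 / e) *\<^sub>R x) \<partial>distr lborel borel (\<lambda>x. 0 + e *\<^sub>R x))"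
    by (rule integral_density) auto
  also have "\<dots> = (LBINT x. e\<^sup>2 *\<^sub>R f ((1 / e) *\<^sub>R (0 + e *\<^sub>R x)))"
    by (rule integral_distr) auto
  also have "\<dots> = e\<^sup>2 * (LBINT x. f x)" using assms(2) by simp
  finally show ?thesis .
qed

lemma norm_le_side:
  fixes w :: "real^2"
  assumes "w \<in> cbox 0 (e *\<^sub>R One)"
  shows "norm w \<le> 2 * e"
proof -
  have "norm w \<le> (\<Sum>b\<in>Basis. \<bar>w \<bullet> b\<bar>)" by (rule norm_le_l1)
  also have "\<dots> \<le> (\<Sum>b\<in>(Basis :: (real^2) set). e)"
    using assms by (intro sum_mono) (auto simp: mem_box abs_le_iff dest: bspec intro: order_trans[of _ 0])
  finally show ?thesis by simp
qed

lemma cbox_subset_ball: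
  fixes x :: "real^2"
  assumes "2 * e < r"
  shows "cbox x (x + e *\<^sub>R One) \<subseteq> ball x r"
proof
  fix y assume "y \<in> cbox x (x + e *\<^sub>R One)"
  then have "y - x \<in> cbox 0 (e *\<^sub>R One)" by (auto simp: mem_box inner_diff_left inner_add_left algebra_simps)
  from norm_le_side[OF this] show "y \<in> ball x r" using assms by (simp add: dist_norm norm_minus_commute)
qed

lemma measure_square:
  fixes x :: "real^2"
  shows "0 < e \<Longrightarrow> measure lborel (cbox x (x + e *\<^sub>R One)) = e\<^sup>2"
  by (subst content_cbox) (auto simp: inner_add_left)

text \<open>The kernels live on the unit square with lower left corner at the origin, so that a convolution
  at \<open>x\<close> is an average over \<open>cbox x (x + e *\<^sub>R One)\<close>; averages over these squares converge almost everywhere.\<close>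

definition midpt :: "real^2" where "midpt = (1/2) *\<^sub>R One"

definition base :: "real^2 \<Rightarrow> real" where
  "base w = flat 0 (1/4 - (w - midpt) \<bullet> (w - midpt))"

definition base_grad :: "real^2 \<Rightarrow> real^2" where
  "base_grad = (SOME G. (\<forall>x. (base has_derivative (\<lambda>h. G x \<bullet> h)) (at x)) \<and> (\<forall>i. (\<lambda>x. G x $ i) \<in> bumps))"

lemma base_bumps: "base \<in> bumps"
  using bumps.bump[of 0 "1/4" 1 midpt] by (simp add: base_def[abs_def])

lemma base_grad: "(base has_derivative (\<lambda>h. base_grad x \<bullet> h)) (at x)" "(\<lambda>x. base_grad x $ i) \<in> bumps"
  using someI_ex[OF bumps_gradient[OF base_bumps]] by (auto simp: base_grad_def)

lemma base_bounds: "0 \<le> base w" "base w \<le> 1"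
  by (auto simp: base_def flat_def)

lemma base_support:
  assumes "w \<notin> cbox 0 One"
  shows "base w = 0" "base_grad w = 0"
proof -
  have z: "base w = 0" if w: "w \<notin> cbox 0 One" for w
  proof -
    have "1/4 < (w - midpt) \<bullet> (w - midpt)"
    proof -
      obtain i :: "real^2" where i: "i \<in> Basis" "w \<bullet> i < 0 \<or> w \<bullet> i > 1"
        using w unfolding mem_box by (auto simp: not_le)
      then have "1/2 < \<bar>(w - midpt) \<bullet> i\<bar>" by (auto simp: midpt_def inner_diff_left)
      then have "1/2 < norm (w - midpt)" using Basis_le_norm[OF i(1), of "w - midpt"] by linarith
      then have "(1/2)\<^sup>2 < (norm (w - midpt))\<^sup>2" by (intro power_strict_mono) auto
      then show ?thesis unfolding power2_norm_eq_inner by (simp add: power2_eq_square)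
    qed
    then show ?thesis by (simp add: base_def flat_def)
  qed
  then show "base w = 0" using assms .
  show "base_grad w = 0"
    by (rule gradient_vanishes_off_support[OF base_grad(1) closed_cbox z assms])
qed

lemma base_grad_lipschitz:
  obtains L where "L \<ge> 0" "\<And>w. norm (base_grad w) \<le> L"
    "\<And>x y. norm (base_grad x - base_grad y) \<le> L * norm (x - y)"
proof -
  have "\<exists>L. L \<ge> 0 \<and> (\<forall>x y. \<bar>base_grad x $ i - base_grad y $ i\<bar> \<le> L * norm (x - y))" for i
  proof -
    obtain H where H: "\<And>x. ((\<lambda>x. base_grad x $ i) has_derivative (\<lambda>h. H x \<bullet> h)) (at x)"
      "\<And>j. (\<lambda>x. H x $ j) \<in> bumps"
      using bumps_gradient[OF base_grad(2)[of i]] by blast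
    have "continuous_on UNIV H"
      unfolding continuous_on_componentwise[of _ H] Basis_vec_def
      using bumps_continuous[OF H(2)] by (auto simp: inner_axis)
    moreover have "H x = 0" if "x \<notin> cbox 0 One" for x
      by (rule gradient_vanishes_off_support[OF H(1) closed_cbox _ that]) (simp add: base_support)
    ultimately show ?thesis
      using compact_gradient_lipschitz[of "\<lambda>x. base_grad x $ i" H "cbox 0 One"] H(1) compact_cbox by metis
  qed
  then obtain K where K: "\<And>i. K i \<ge> 0" "\<And>i x y. \<bar>base_grad x $ i - base_grad y $ i\<bar> \<le> K i * norm (x - y)"
    by metis
  have cont: "continuous_on UNIV base_grad"
    unfolding continuous_on_componentwise[of _ base_grad] Basis_vec_def
    using bumps_continuous[OF base_grad(2)] by (auto simp: inner_axis)
  obtain M where M: "\<And>w. norm (base_grad w) \<le> M" "M \<ge> 0"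
    using compact_gradient_lipschitz[OF base_grad(1) cont compact_cbox base_support(2)] by metis
  define L where "L = max M (K 1 + K 2)"
  have "norm (base_grad x - base_grad y) \<le> L * norm (x - y)" for x y
  proof -
    have "norm (base_grad x - base_grad y) \<le> (\<Sum>i\<in>UNIV. \<bar>(base_grad x - base_grad y) $ i\<bar>)"
      by (rule norm_le_l1_cart)
    also have "\<dots> \<le> K 1 * norm (x - y) + K 2 * norm (x - y)"
      using K(2)[of x 1 y] K(2)[of x 2 y] by (simp add: sum_2)
    also have "\<dots> \<le> L * norm (x - y)"
      using mult_right_mono[of "K 1 + K 2" L "norm (x - y)"] by (simp add: L_def distrib_right)
    finally show ?thesis .
  qed
  moreover have "norm (base_grad w) \<le> L" for w using M(1)[of w] by (simp add: L_def)
  moreover have "L \<ge> 0" using M by (simp add: L_def)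
  ultimately show ?thesis using that by blast
qed

definition mass :: real where "mass = (LBINT w. base w)"

lemma base_measurable [measurable]: "base \<in> borel_measurable borel"
  by (intro borel_measurable_continuous_onI bumps_continuous base_bumps)

lemma mass_pos: "mass > 0"
proof -
  have i: "integrable lborel base"
    by (rule integrable_box_support[where M=1 and a=0 and b=One]) (use base_bounds base_support in auto)
  have "mass \<ge> 0" unfolding mass_def by (rule integral_nonneg_AE) (simp add: base_bounds)
  moreover have "mass \<noteq> 0"
  proof
    assume "mass = 0"
    then have "AE x in lborel. base x = 0"
      using integral_nonneg_eq_0_iff_AE[OF i] base_bounds by (simp add: mass_def)
    then have "{x. base x \<noteq> 0} \<in> null_sets lborel"
      by (subst (asm) AE_iff_null) simp_all
    then have "negligible {x. base x \<noteq> 0}"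
      by (simp add: negligible_iff_null_sets null_sets_completionI)
    moreover have "open {x. base x \<noteq> 0}"
      by (intro open_Collect_neq bumps_continuous base_bumps continuous_on_const)
    ultimately have "{x. base x \<noteq> 0} = {}" using open_not_negligible by blast
    moreover have "base midpt \<noteq> 0" by (simp add: base_def flat_def)
    ultimately show False by blast
  qed
  ultimately show ?thesis by simp
qed

definition kern :: "real \<Rightarrow> real^2 \<Rightarrow> real" where
  "kern e w = base ((1 / e) *\<^sub>R w) / (mass * e\<^sup>2)"

definition kern_grad :: "real \<Rightarrow> real^2 \<Rightarrow> real^2" where
  "kern_grad e w = (1 / (mass * e^3)) *\<^sub>R base_grad ((1 / e) *\<^sub>R w)"

lemma scaled_in_cbox:
  fixes w :: "real^2"
  assumes "e > 0"
  shows "(1 / e) *\<^sub>R w \<in> cbox 0 One \<longleftrightarrow> w \<in> cbox 0 (e *\<^sub>R One)"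
  using assms by (simp add: mem_box field_simps)

lemma kern_support:
  assumes "e > 0" "w \<notin> cbox 0 (e *\<^sub>R One)"
  shows "kern e w = 0" "kern_grad e w = 0"
  using assms base_support[of "(1 / e) *\<^sub>R w"] by (simp_all add: kern_def kern_grad_def scaled_in_cbox)

lemma kern_nonneg: "0 \<le> kern e w"
  using base_bounds mass_pos by (simp add: kern_def)

lemma kern_bumps: "e > 0 \<Longrightarrow> (\<lambda>z. kern e (z - x)) \<in> bumps"
proof -
  assume e: "e > 0"
  have s: "(1 / e) *\<^sub>R (z - x) - midpt = (1 / e) *\<^sub>R (z - (x + e *\<^sub>R midpt))" for z
    using e by (simp add: algebra_simps)
  have "kern e (z - x) = flat 0 (1/4 - (1 / e\<^sup>2) * ((z - (x + e *\<^sub>R midpt)) \<bullet> (z - (x + e *\<^sub>R midpt)))) * (1 / (mass * e\<^sup>2))" for z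
    unfolding kern_def base_def s by (simp add: power2_eq_square)
  then show ?thesis by (simp only:) (intro bumps.intros)
qed

lemma kern_measurable [measurable]: "kern e \<in> borel_measurable borel"
  unfolding kern_def[abs_def] by measurable

lemma base_grad_measurable [measurable]: "base_grad \<in> borel_measurable borel"
  by (subst borel_measurable_euclidean_space)
    (auto simp: Basis_vec_def inner_axis intro!: borel_measurable_continuous_onI bumps_continuous base_grad(2))

lemma kern_grad_measurable [measurable]: "kern_grad e \<in> borel_measurable borel"
  unfolding kern_grad_def[abs_def] by measurable

lemma kern_has_derivative:
  assumes "e > 0"
  shows "(kern e has_derivative (\<lambda>h. kern_grad e w \<bullet> h)) (at w)"
proof -
  have "((\<lambda>w. (1 / e) *\<^sub>R w) has_derivative (\<lambda>h. (1 / e) *\<^sub>R h)) (at w)"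
    by (auto intro!: derivative_eq_intros)
  then have "(base \<circ> (\<lambda>w. (1 / e) *\<^sub>R w) has_derivative
     (\<lambda>h. base_grad ((1 / e) *\<^sub>R w) \<bullet> h) \<circ> (\<lambda>h. (1 / e) *\<^sub>R h)) (at w)"
    by (rule diff_chain_at) (rule base_grad)
  then have "((\<lambda>w. (1 / (mass * e\<^sup>2)) * base ((1 / e) *\<^sub>R w)) has_derivative
     (\<lambda>h. (1 / (mass * e\<^sup>2)) * (base_grad ((1 / e) *\<^sub>R w) \<bullet> ((1 / e) *\<^sub>R h)))) (at w)"
    unfolding o_def by (rule has_derivative_mult_right)
  moreover have "(\<lambda>h. (1 / (mass * e\<^sup>2)) * (base_grad ((1 / e) *\<^sub>R w) \<bullet> ((1 / e) *\<^sub>R h))) = (\<lambda>h. kern_grad e w \<bullet> h)"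
    by (simp add: kern_grad_def fun_eq_iff power2_eq_square power3_eq_cube)
  moreover have "(\<lambda>w. (1 / (mass * e\<^sup>2)) * base ((1 / e) *\<^sub>R w)) = kern e"
    by (simp add: kern_def fun_eq_iff)
  ultimately show ?thesis by simp
qed

lemma kern_integral:
  assumes "e > 0"
  shows "(LBINT w. kern e w) = 1"
proof -
  have "(LBINT w. kern e w) = (LBINT w. base ((1 / e) *\<^sub>R w)) / (mass * e\<^sup>2)"
    unfolding kern_def by simp
  also have "\<dots> = 1"
    unfolding lborel_integral_scale[OF base_measurable assms] mass_def[symmetric]
    using assms mass_pos by simp
  finally show ?thesis .
qed

lemma kern_bounds:
  obtains C where "C > 0" "\<And>e w. e > 0 \<Longrightarrow> kern e w \<le> C / e\<^sup>2"
    "\<And>e w. e > 0 \<Longrightarrow> norm (kern_grad e w) \<le> C / e^3"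
    "\<And>e x y. e > 0 \<Longrightarrow> norm (kern_grad e x - kern_grad e y) \<le> C / e^4 * norm (x - y)"
proof -
  obtain L where L: "L \<ge> 0" "\<And>w. norm (base_grad w) \<le> L"
    "\<And>x y. norm (base_grad x - base_grad y) \<le> L * norm (x - y)"
    using base_grad_lipschitz by blast
  define C where "C = (1 + L) / mass"
  have C: "C > 0" "1 / mass \<le> C" "L / mass \<le> C" using L(1) mass_pos by (simp_all add: C_def divide_simps)
  show ?thesis
  proof (rule that[OF C(1)])
    fix e :: real and w assume e: "e > 0"
    have "kern e w \<le> (1 / mass) / e\<^sup>2"
      using base_bounds mass_pos e by (simp add: kern_def divide_right_mono)
    also have "\<dots> \<le> C / e\<^sup>2" using C by (intro divide_right_mono) auto
    finally show "kern e w \<le> C / e\<^sup>2" .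
    have "norm (kern_grad e w) \<le> (L / mass) / e^3"
      using L(2)[of "(1 / e) *\<^sub>R w"] mass_pos e by (simp add: kern_grad_def divide_right_mono)
    also have "\<dots> \<le> C / e^3" using C e by (intro divide_right_mono) auto
    finally show "norm (kern_grad e w) \<le> C / e^3" .
  next
    fix e :: real and x y assume e: "e > 0"
    have "norm (kern_grad e x - kern_grad e y)
        = (1 / (mass * e^3)) * norm (base_grad ((1 / e) *\<^sub>R x) - base_grad ((1 / e) *\<^sub>R y))"
      unfolding kern_grad_def scaleR_diff_right[symmetric] using mass_pos e by simp
    also have "\<dots> \<le> (1 / (mass * e^3)) * (L * norm ((1 / e) *\<^sub>R x - (1 / e) *\<^sub>R y))"
      using mass_pos e by (intro mult_left_mono L) auto
    also have "\<dots> = (L / mass) / e^4 * norm (x - y)"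
      unfolding scaleR_diff_right[symmetric] using e by (simp add: eval_nat_numeral)
    also have "\<dots> \<le> C / e^4 * norm (x - y)" using C e by (intro mult_right_mono divide_right_mono) auto
    finally show "norm (kern_grad e x - kern_grad e y) \<le> C / e^4 * norm (x - y)" .
  qed
qed

definition kern_const :: real where
  "kern_const = (SOME C. C > 0 \<and> (\<forall>e w. e > 0 \<longrightarrow> kern e w \<le> C / e\<^sup>2 \<and> norm (kern_grad e w) \<le> C / e^3) \<and>
     (\<forall>e x y. e > 0 \<longrightarrow> norm (kern_grad e x - kern_grad e y) \<le> C / e^4 * norm (x - y)))"

lemma kern_const:
  "kern_const > 0"
  "e > 0 \<Longrightarrow> kern e w \<le> kern_const / e\<^sup>2"
  "e > 0 \<Longrightarrow> norm (kern_grad e w) \<le> kern_const / e^3"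
  "e > 0 \<Longrightarrow> norm (kern_grad e x - kern_grad e y) \<le> kern_const / e^4 * norm (x - y)"
proof -
  have "\<exists>C. C > 0 \<and> (\<forall>e w. e > 0 \<longrightarrow> kern e w \<le> C / e\<^sup>2 \<and> norm (kern_grad e w) \<le> C / e^3) \<and>
     (\<forall>e x y. e > 0 \<longrightarrow> norm (kern_grad e x - kern_grad e y) \<le> C / e^4 * norm (x - y))"
    by (rule kern_bounds) (intro exI conjI allI impI)
  from someI_ex[OF this] show
    "kern_const > 0"
    "e > 0 \<Longrightarrow> kern e w \<le> kern_const / e\<^sup>2"
    "e > 0 \<Longrightarrow> norm (kern_grad e w) \<le> kern_const / e^3"
    "e > 0 \<Longrightarrow> norm (kern_grad e x - kern_grad e y) \<le> kern_const / e^4 * norm (x - y)"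
    unfolding kern_const_def by auto
qed

section \<open>Mollification and approximate continuity\<close>

definition mollify :: "real \<Rightarrow> (real^2 \<Rightarrow> 'b::euclidean_space) \<Rightarrow> real^2 \<Rightarrow> 'b" where
  "mollify e u x = (LBINT z. kern e (z - x) *\<^sub>R u z)"

lemma kern_shift_support:
  assumes "e > 0" "z \<notin> cbox x (x + e *\<^sub>R One)"
  shows "kern e (z - x) = 0" "kern_grad e (z - x) = 0"
proof -
  have "z - x \<notin> cbox 0 (e *\<^sub>R One)"
    using assms(2) by (auto simp: mem_box inner_diff_left inner_add_left algebra_simps)
  then show "kern e (z - x) = 0" "kern_grad e (z - x) = 0" using kern_support assms(1) by blast+
qed

lemma kern_weighted_integrable:
  fixes u :: "real^2 \<Rightarrow> 'b::euclidean_space"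
  assumes e: "e > 0" and [measurable]: "u \<in> borel_measurable borel" and b: "\<And>z. norm (u z) \<le> M"
  shows "integrable lborel (\<lambda>z. kern e (z - x) *\<^sub>R u z)"
    "integrable lborel (\<lambda>z. (kern_grad e (z - x) \<bullet> h) *\<^sub>R u z)"
proof -
  define C where "C = kern_const"
  note C = kern_const[folded C_def]
  have M: "M \<ge> 0" using b[of 0] norm_ge_zero order_trans by blast
  show "integrable lborel (\<lambda>z. kern e (z - x) *\<^sub>R u z)"
  proof (rule integrable_box_support(1)[where a=x and b="x + e *\<^sub>R One" and M="C / e\<^sup>2 * M"])
    show "norm (kern e (z - x) *\<^sub>R u z) \<le> C / e\<^sup>2 * M" for z
      unfolding norm_scaleR using C(2)[OF e, of "z - x"] kern_nonneg[of e "z - x"] b[of z] M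
      by (intro mult_mono) auto
  qed (use kern_shift_support[OF e] in auto)
  show "integrable lborel (\<lambda>z. (kern_grad e (z - x) \<bullet> h) *\<^sub>R u z)"
  proof (rule integrable_box_support(1)[where a=x and b="x + e *\<^sub>R One" and M="(C / e^3 * norm h) * M"])
    show "norm ((kern_grad e (z - x) \<bullet> h) *\<^sub>R u z) \<le> (C / e^3 * norm h) * M" for z
      unfolding norm_scaleR real_norm_def using b[of z] M e C
      by (intro mult_mono order_trans[OF Cauchy_Schwarz_ineq2] C(3)[OF e]) auto
  qed (use kern_shift_support[OF e] in auto)
qed

text \<open>All derivatives fall on the kernel, whose Taylor remainder is quadratic uniformly in the
  integration variable; \<open>u\<close> is only bounded and measurable.\<close>

lemma mollify_has_derivative:
  fixes u :: "real^2 \<Rightarrow> 'b::euclidean_space"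
  assumes e: "e > 0" and [measurable]: "u \<in> borel_measurable borel" and b: "\<And>z. norm (u z) \<le> M"
  shows "(mollify e u has_derivative (\<lambda>h. - (LBINT z. (kern_grad e (z - x) \<bullet> h) *\<^sub>R u z))) (at x)"
proof -
  define C where "C = kern_const"
  note C = kern_const[folded C_def]
  have M: "M \<ge> 0" using b[of 0] norm_ge_zero order_trans by blast
  note int = kern_weighted_integrable[OF e assms(2) b]
  let ?D = "\<lambda>h. - (LBINT z. (kern_grad e (z - x) \<bullet> h) *\<^sub>R u z)"
  let ?V = "measure lborel (cbox x (x + e *\<^sub>R One))"
  define W where "W = measure lborel (cbox (x - One) (x + (1 + e) *\<^sub>R One))"
  show ?thesis
  proof (rule has_derivativeI_sandwich[where e=1 and H="\<lambda>y. (C / e^4 * M * W) * norm (y - x)"])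
    show "bounded_linear ?D"
    proof (rule bounded_linear_intro[where K="(C / e^3) * M * ?V"])
      fix h k :: "real^2" and r :: real
      show "?D (h + k) = ?D h + ?D k"
        using int(2) by (simp add: inner_add_right scaleR_add_left)
      have "(LBINT z. (kern_grad e (z - x) \<bullet> (r *\<^sub>R h)) *\<^sub>R u z)
          = (LBINT z. r *\<^sub>R ((kern_grad e (z - x) \<bullet> h) *\<^sub>R u z))"
        by (simp only: inner_scaleR_right scaleR_scaleR)
      also have "\<dots> = r *\<^sub>R (LBINT z. (kern_grad e (z - x) \<bullet> h) *\<^sub>R u z)"
        by (rule integral_scaleR_right)
      finally show "?D (r *\<^sub>R h) = r *\<^sub>R ?D h" by (simp only: scaleR_minus_right)
      have "norm (LBINT z. (kern_grad e (z - x) \<bullet> h) *\<^sub>R u z) \<le> ((C / e^3 * norm h) * M) * ?V"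
      proof (rule integrable_box_support(2))
        show "norm ((kern_grad e (z - x) \<bullet> h) *\<^sub>R u z) \<le> (C / e^3 * norm h) * M" for z
          unfolding norm_scaleR real_norm_def using b[of z] M e C
          by (intro mult_mono order_trans[OF Cauchy_Schwarz_ineq2] C(3)[OF e]) auto
      qed (use kern_shift_support[OF e] in auto)
      then show "norm (?D h) \<le> norm h * (C / e^3 * M * ?V)" by (simp add: mult_ac)
    qed
    fix y assume y: "y \<noteq> x" "dist y x < 1"
    have "norm (LBINT z. (kern e (z - y) - kern e (z - x) + kern_grad e (z - x) \<bullet> (y - x)) *\<^sub>R u z)
        \<le> (C / e^4 * (norm (y - x))\<^sup>2 * M) * W"
      unfolding W_def
    proof (rule integrable_box_support(2))
      fix z
      have "\<bar>kern e ((z - x) + (x - y)) - kern e (z - x) - kern_grad e (z - x) \<bullet> (x - y)\<bar> \<le> C / e^4 * (norm (x - y))\<^sup>2"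
        by (rule taylor_quadratic[OF kern_has_derivative[OF e] C(4)[OF e]])
      then have t: "\<bar>kern e (z - y) - kern e (z - x) + kern_grad e (z - x) \<bullet> (y - x)\<bar> \<le> C / e^4 * (norm (y - x))\<^sup>2"
        by (simp add: norm_minus_commute inner_diff_right)
      then show "norm ((kern e (z - y) - kern e (z - x) + kern_grad e (z - x) \<bullet> (y - x)) *\<^sub>R u z)
          \<le> C / e^4 * (norm (y - x))\<^sup>2 * M"
        unfolding norm_scaleR real_norm_def using b[of z] M C(1) e by (intro mult_mono) auto
      assume z: "z \<notin> cbox (x - One) (x + (1 + e) *\<^sub>R One)"
      have sub: "w \<in> cbox (x - One) (x + (1 + e) *\<^sub>R One)"
        if w: "w \<in> cbox v (v + e *\<^sub>R One)" "norm (v - x) \<le> 1" for v w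
      proof -
        have "\<bar>v \<bullet> i - x \<bullet> i\<bar> \<le> 1" if "i \<in> Basis" for i
          using Basis_le_norm[OF that, of "v - x"] w(2) by (simp add: inner_diff_left)
        then show ?thesis using w(1) e unfolding mem_box
          by (fastforce simp: inner_diff_left inner_add_left abs_le_iff)
      qed
      have "z \<notin> cbox y (y + e *\<^sub>R One)" "z \<notin> cbox x (x + e *\<^sub>R One)"
        using sub[of z y] sub[of z x] z y(2) by (auto simp: dist_norm)
      then show "(kern e (z - y) - kern e (z - x) + kern_grad e (z - x) \<bullet> (y - x)) *\<^sub>R u z = 0"
        using kern_shift_support[OF e] by simp
    qed measurable
    also have "(LBINT z. (kern e (z - y) - kern e (z - x) + kern_grad e (z - x) \<bullet> (y - x)) *\<^sub>R u z)
        = mollify e u y - mollify e u x - ?D (y - x)"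
      unfolding mollify_def scaleR_add_left scaleR_diff_left using int by simp
    finally have "norm (mollify e u y - mollify e u x - ?D (y - x)) / norm (y - x)
        \<le> (C / e^4 * (norm (y - x))\<^sup>2 * M) * W / norm (y - x)"
      by (rule divide_right_mono) simp
    also have "\<dots> = (C / e^4 * M * W) * norm (y - x)"
      using y e by (simp add: power2_eq_square)
    finally show "norm (mollify e u y - mollify e u x - ?D (y - x)) / norm (y - x) \<le> (C / e^4 * M * W) * norm (y - x)" .
  qed (use e in \<open>auto intro!: tendsto_eq_intros\<close>)
qed

lemma kern_shift_integral:
  assumes "e > 0"
  shows "(LBINT z. kern e (z - x)) = 1"
  using lborel_integral_shift[of "kern e" "- x"] kern_integral[OF assms] by simp

lemma kern_grad_integral:
  assumes e: "e > 0"
  shows "(LBINT z. kern_grad e (z - x) \<bullet> h) = 0"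
proof -
  have "mollify e (\<lambda>_. 1::real) = (\<lambda>_. 1)" by (rule ext) (simp add: mollify_def kern_shift_integral[OF e])
  then have "((\<lambda>_. 1::real) has_derivative (\<lambda>h. - (LBINT z. (kern_grad e (z - x) \<bullet> h) *\<^sub>R (1::real)))) (at x)"
    using mollify_has_derivative[OF e, of "\<lambda>_. 1::real" 1 x] by simp
  then have "(\<lambda>h. - (LBINT z. (kern_grad e (z - x) \<bullet> h) *\<^sub>R (1::real))) = (\<lambda>h. 0)"
    by (rule has_derivative_unique) (rule has_derivative_const)
  then show ?thesis by (simp add: fun_eq_iff)
qed

lemma norm_mollify_le:
  fixes u :: "real^2 \<Rightarrow> 'b::euclidean_space"
  assumes e: "e > 0" and m: "u \<in> borel_measurable borel" and b: "\<And>z. norm (u z) \<le> 1"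
  shows "norm (mollify e u x) \<le> 1"
proof -
  have "norm (mollify e u x) \<le> (LBINT z. norm (kern e (z - x) *\<^sub>R u z))"
    unfolding mollify_def by (rule integral_norm_bound)
  also have "\<dots> \<le> (LBINT z. kern e (z - x))"
  proof (rule integral_mono)
    show "integrable lborel (\<lambda>z. norm (kern e (z - x) *\<^sub>R u z))"
      by (rule integrable_norm) (rule kern_weighted_integrable[OF e m b])
    show "integrable lborel (\<lambda>z. kern e (z - x))"
      using kern_weighted_integrable(1)[OF e, of "\<lambda>_. 1::real" 1 x] by simp
    show "norm (kern e (z - x) *\<^sub>R u z) \<le> kern e (z - x)" for z
      using b[of z] kern_nonneg[of e "z - x"] by (simp add: mult_left_le)
  qed
  finally show ?thesis by (simp add: kern_shift_integral[OF e])
qed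

text \<open>For unit vectors \<open>1 - u \<bullet> v = \<bar>u - v\<bar>^2 / 2\<close>, so these are the points at which \<open>m\<close> is approximately
  continuous in mean square.\<close>

definition approx_points :: "(real^2 \<Rightarrow> real^2) \<Rightarrow> (real^2) set" where
  "approx_points m = {x. ((\<lambda>e. LBINT z. kern e (z - x) * (1 - m z \<bullet> m x)) \<longlongrightarrow> 0) (at_right 0)}"

lemma unit_inner_le: "norm u = 1 \<Longrightarrow> norm v = 1 \<Longrightarrow> u \<bullet> v \<le> 1" "norm u = 1 \<Longrightarrow> norm v = 1 \<Longrightarrow> -1 \<le> u \<bullet> v"
  for u v :: "real^2"
  using Cauchy_Schwarz_ineq2[of u v] by (auto simp: abs_le_iff)

lemma kern_excess_integrable:
  fixes m :: "real^2 \<Rightarrow> real^2"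
  assumes e: "e > 0" and [measurable]: "m \<in> borel_measurable borel" and unit: "\<And>z. norm (m z) = 1"
  shows "integrable lborel (\<lambda>z. kern e (z - x) * (1 - m z \<bullet> m y))"
proof -
  have "integrable lborel (\<lambda>z. kern e (z - x) *\<^sub>R (1 - m z \<bullet> m y))"
  proof (rule kern_weighted_integrable[OF e, where M=2])
    show "norm (1 - m z \<bullet> m y) \<le> 2" for z
      using unit_inner_le[OF unit[of z] unit[of y]] by simp
  qed measurable
  then show ?thesis by simp
qed

text \<open>Convergence of the plain averages of \<open>m\<close> to \<open>m x\<close> suffices: the integrand \<open>1 - m z \<bullet> m x\<close> is
  nonnegative and affine in \<open>m z\<close>, since \<open>m x\<close> is an extreme point of the disc.\<close>

lemma approx_points_full:
  fixes m :: "real^2 \<Rightarrow> real^2"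
  assumes [measurable]: "m \<in> borel_measurable borel" and unit: "\<And>z. norm (m z) = 1"
  obtains N where "N \<in> null_sets lebesgue" "- N \<subseteq> approx_points m"
proof -
  define C where "C = kern_const"
  note C = kern_const[folded C_def]
  have i: "set_integrable lborel (cbox a b) m" for a b
    unfolding set_integrable_def
    by (rule integrable_box_support(1)[where M=1 and a=a and b=b]) (auto simp: unit indicator_def)
  have "m integrable_on cbox a b" for a b
    using set_borel_integral_eq_integral(1)[OF i] .
  then obtain N where N: "negligible N" "\<And>x e. \<lbrakk>x \<notin> N; 0 < e\<rbrakk> \<Longrightarrow>
      \<exists>d>0. \<forall>h. 0 < h \<and> h < d \<longrightarrow> norm (integral (cbox x (x + h *\<^sub>R One)) m /\<^sub>R h ^ DIM(real^2) - m x) < e"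
    using integrable_ccontinuous_explicit[of m] by metis
  have "x \<in> approx_points m" if x: "x \<notin> N" for x
    unfolding approx_points_def mem_Collect_eq tendsto_iff
  proof (intro allI impI)
    fix r :: real assume r: "r > 0"
    obtain d where d: "d > 0" "\<And>h. 0 < h \<Longrightarrow> h < d \<Longrightarrow>
        norm (integral (cbox x (x + h *\<^sub>R One)) m /\<^sub>R h ^ DIM(real^2) - m x) < r / C"
      using N(2)[OF x, of "r / C"] r C by auto
    have "dist (LBINT z. kern e (z - x) * (1 - m z \<bullet> m x)) 0 < r" if e: "0 < e" "e < d" for e
    proof -
      let ?Q = "cbox x (x + e *\<^sub>R One)"
      define I where "I = (LBINT z. indicator ?Q z *\<^sub>R m z)"
      have I: "I = integral ?Q m"
        using set_borel_integral_eq_integral(2)[OF i] by (simp add: I_def set_lebesgue_integral_def)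
      have dim: "e ^ DIM(real^2) = e\<^sup>2" by simp
      have "norm (I /\<^sub>R e\<^sup>2 - m x) < r / C" using d(2)[OF e] unfolding I dim .
      then have "\<bar>(m x - I /\<^sub>R e\<^sup>2) \<bullet> m x\<bar> < r / C"
        using Cauchy_Schwarz_ineq2[of "m x - I /\<^sub>R e\<^sup>2" "m x"] by (simp add: unit norm_minus_commute)
      then have lt: "1 - (I \<bullet> m x) / e\<^sup>2 < r / C"
        by (simp add: inner_diff_left dot_square_norm unit divide_inverse mult.commute)
      have integ: "integrable lborel (\<lambda>z. indicator ?Q z *\<^sub>R m z)" using i by (simp add: set_integrable_def)
      have nonneg: "0 \<le> (LBINT z. kern e (z - x) * (1 - m z \<bullet> m x))"
        by (intro integral_nonneg_AE AE_I2 mult_nonneg_nonneg kern_nonneg) (simp add: unit_inner_le unit)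
      have ind: "integrable lborel (indicat_real ?Q)"
        by (intro integrable_real_indicator emeasure_lborel_cbox_finite) simp
      have "(LBINT z. kern e (z - x) * (1 - m z \<bullet> m x))
          \<le> (LBINT z. C / e\<^sup>2 * (indicator ?Q z - (indicator ?Q z *\<^sub>R m z) \<bullet> m x))"
      proof (rule integral_mono[OF kern_excess_integrable[OF e(1)]])
        show "integrable lborel (\<lambda>z. C / e\<^sup>2 * (indicator ?Q z - (indicator ?Q z *\<^sub>R m z) \<bullet> m x))"
          by (intro integrable_mult_right Bochner_Integration.integrable_diff ind integrable_inner_left integ)
        fix z
        show "kern e (z - x) * (1 - m z \<bullet> m x) \<le> C / e\<^sup>2 * (indicator ?Q z - (indicator ?Q z *\<^sub>R m z) \<bullet> m x)"
          using kern_shift_support[OF e(1), of z x] C(2)[OF e(1), of "z - x"] unit_inner_le(1)[OF unit[of z] unit[of x]]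
            mult_right_mono[of "kern e (z - x)" "C / e\<^sup>2" "1 - m z \<bullet> m x"]
          by (cases "z \<in> ?Q") auto
      qed (simp_all add: unit)
      also have "\<dots> = C / e\<^sup>2 * (e\<^sup>2 - I \<bullet> m x)"
        unfolding integral_mult_right_zero Bochner_Integration.integral_diff[OF ind integrable_inner_left[OF integ]]
          integral_inner_left[OF integ]
        by (simp add: I_def measure_square[OF e(1)])
      also have "\<dots> = C * (1 - (I \<bullet> m x) / e\<^sup>2)" using e by (simp add: field_simps)
      also have "\<dots> < C * (r / C)" using lt C by (intro mult_strict_left_mono)
      finally show ?thesis using C nonneg by simp
    qed
    then show "\<forall>\<^sub>F e in at_right 0. dist (LBINT z. kern e (z - x) * (1 - m z \<bullet> m x)) 0 < r"
      using d(1) unfolding eventually_at_right_field by (intro exI[of _ d]) simp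
  qed
  then show ?thesis using that[of N] N(1) by (auto simp: negligible_iff_null_sets)
qed

lemma kern_excess_eq:
  fixes m :: "real^2 \<Rightarrow> real^2"
  assumes e: "e > 0" and m: "m \<in> borel_measurable borel" and unit: "\<And>z. norm (m z) = 1"
  shows "(LBINT z. kern e (z - x) * (1 - m z \<bullet> m y)) = 1 - mollify e m x \<bullet> m y"
proof -
  have 1: "integrable lborel (\<lambda>z. kern e (z - x) *\<^sub>R m z)"
    by (rule kern_weighted_integrable[OF e m, where M=1]) (simp add: unit)
  have 2: "integrable lborel (\<lambda>z. kern e (z - x))"
    using kern_weighted_integrable(1)[OF e, of "\<lambda>_. 1::real" 1 x] by simp
  have "(LBINT z. kern e (z - x) * (1 - m z \<bullet> m y))
      = (LBINT z. kern e (z - x) - (kern e (z - x) *\<^sub>R m z) \<bullet> m y)"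
    by (simp add: right_diff_distrib)
  also have "\<dots> = (LBINT z. kern e (z - x)) - (LBINT z. (kern e (z - x) *\<^sub>R m z) \<bullet> m y)"
    by (rule Bochner_Integration.integral_diff[OF 2 integrable_inner_left[OF 1]])
  also have "\<dots> = 1 - mollify e m x \<bullet> m y"
    unfolding mollify_def kern_shift_integral[OF e] integral_inner_left[OF 1] ..
  finally show ?thesis .
qed

lemma mollify_tendsto:
  fixes m :: "real^2 \<Rightarrow> real^2"
  assumes m: "m \<in> borel_measurable borel" and unit: "\<And>z. norm (m z) = 1" and x: "x \<in> approx_points m"
  shows "((\<lambda>e. mollify e m x) \<longlongrightarrow> m x) (at_right 0)"
proof -
  let ?E = "\<lambda>e. LBINT z. kern e (z - x) * (1 - m z \<bullet> m x)"
  have "((\<lambda>e. sqrt (2 * ?E e)) \<longlongrightarrow> sqrt (2 * 0)) (at_right 0)"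
    using x unfolding approx_points_def by (intro tendsto_intros) simp
  moreover have "\<forall>\<^sub>F e in at_right 0. norm (mollify e m x - m x) \<le> sqrt (2 * ?E e)"
    unfolding eventually_at_right_field
  proof (intro exI[of _ 1] conjI allI impI)
    fix e :: real assume e: "0 < e"
    have "(norm (mollify e m x))\<^sup>2 \<le> 1"
      using norm_mollify_le[OF e m, of x] unit by (simp add: power_le_one)
    moreover have "(norm (mollify e m x - m x))\<^sup>2 = (norm (mollify e m x))\<^sup>2 + 1 - 2 * (mollify e m x \<bullet> m x)"
      using dot_norm_neg[of "mollify e m x" "m x"] by (simp add: unit)
    ultimately have "(norm (mollify e m x - m x))\<^sup>2 \<le> 2 * ?E e"
      unfolding kern_excess_eq[OF e m unit] by simp
    then show "norm (mollify e m x - m x) \<le> sqrt (2 * ?E e)" by (rule real_le_rsqrt)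
  qed simp
  ultimately have "((\<lambda>e. mollify e m x - m x) \<longlongrightarrow> 0) (at_right 0)"
    using Lim_null_comparison by fastforce
  then show ?thesis by (rule LIM_zero_cancel)
qed

section \<open>The commutator estimate\<close>

text \<open>A difference quotient of \<open>g\<close> has integral zero by translation invariance.\<close>

lemma integral_derivative_zero:
  fixes g :: "real^2 \<Rightarrow> real"
  assumes d: "\<And>x. (g has_derivative g' x) (at x)" and lip: "\<And>x y. \<bar>g x - g y\<bar> \<le> L * norm (x - y)" and L0: "0 \<le> L"
    and supp: "\<And>x. x \<notin> cbox a b \<Longrightarrow> g x = 0"
  shows "integrable lborel (\<lambda>x. g' x e)" "(LBINT x. g' x e) = 0"
proof -
  define t where "t n = inverse (real (Suc n))" for n
  have t: "0 < t n" "t n \<le> 1" for n by (auto simp: t_def inverse_le_1_iff)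
  have t0: "t \<longlonglongrightarrow> 0" unfolding t_def by (rule LIMSEQ_inverse_real_of_nat)
  define q where "q n x = (g (x + t n *\<^sub>R e) - g x) / t n" for n x
  have gc: "continuous_on UNIV g"
    using d has_derivative_continuous by (intro continuous_at_imp_continuous_on) blast
  have gm [measurable]: "g \<in> borel_measurable borel" using gc by (rule borel_measurable_continuous_onI)
  have qm [measurable]: "q n \<in> borel_measurable borel" for n unfolding q_def[abs_def] by measurable
  have qlim: "(\<lambda>n. q n x) \<longlonglongrightarrow> g' x e" for x
  proof -
    have lin: "bounded_linear (g' x)" using d has_derivative_bounded_linear by blast
    have "((\<lambda>s. g (x + s *\<^sub>R e)) has_derivative (\<lambda>s. g' x (s *\<^sub>R e))) (at 0)"
    proof -
      have "((\<lambda>s::real. x + s *\<^sub>R e) has_derivative (\<lambda>s. s *\<^sub>R e)) (at 0)"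
        by (auto intro!: derivative_eq_intros)
      then have "(g \<circ> (\<lambda>s. x + s *\<^sub>R e) has_derivative g' x \<circ> (\<lambda>s. s *\<^sub>R e)) (at 0)"
        by (rule diff_chain_at) (simp add: d)
      then show ?thesis by (simp add: o_def)
    qed
    then have "((\<lambda>s. g (x + s *\<^sub>R e)) has_real_derivative g' x e) (at 0)"
      unfolding has_field_derivative_def
      by (rule has_derivative_eq_rhs) (simp add: fun_eq_iff linear_cmul[OF bounded_linear.linear[OF lin]] mult.commute)
    then have "((\<lambda>h. (g (x + h *\<^sub>R e) - g x) / h) \<longlongrightarrow> g' x e) (at 0)"
      by (simp add: DERIV_def)
    moreover have "filterlim t (at 0) sequentially"
      unfolding filterlim_at using t0 t(1) by (auto intro!: always_eventually simp: less_imp_neq[symmetric])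
    ultimately show ?thesis unfolding q_def by (rule filterlim_compose)
  qed
  define S where "S = cbox (a - norm e *\<^sub>R One) (b + norm e *\<^sub>R One)"
  have bound: "norm (q n x) \<le> L * norm e * indicator S x" for n x
  proof (cases "x \<in> S")
    case True
    have "\<bar>g (x + t n *\<^sub>R e) - g x\<bar> \<le> L * (t n * norm e)"
      using lip[of "x + t n *\<^sub>R e" x] t(1)[of n] by simp
    then show ?thesis using True t(1)[of n] by (simp add: q_def divide_le_eq mult_ac)
  next
    case False
    have out: "y \<notin> cbox a b" if y: "norm (y - x) \<le> norm e" for y
    proof
      assume yb: "y \<in> cbox a b"
      have "\<bar>y \<bullet> i - x \<bullet> i\<bar> \<le> norm e" if "i \<in> Basis" for i
        using Basis_le_norm[OF that, of "y - x"] y by (simp add: inner_diff_left)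
      then have "x \<in> S" using yb unfolding S_def mem_box
        by (fastforce simp: inner_diff_left inner_add_left abs_le_iff)
      then show False using False by simp
    qed
    have "x + t n *\<^sub>R e \<notin> cbox a b" using t[of n] by (intro out) (simp add: mult_left_le_one_le)
    moreover have "x \<notin> cbox a b" by (rule out) simp
    ultimately show ?thesis using supp L0 False by (simp add: q_def)
  qed
  have w: "integrable lborel (\<lambda>x. L * norm e * indicator S x)"
    unfolding S_def by (intro integrable_mult_right integrable_real_indicator emeasure_lborel_cbox_finite) simp
  have g'm: "(\<lambda>x. g' x e) \<in> borel_measurable lborel"
    by (rule borel_measurable_LIMSEQ_real[of lborel q]) (use qlim in auto)
  have gi: "integrable lborel g"
  proof -
    have "compact (g ` cbox a b)"
      by (intro compact_continuous_image compact_cbox continuous_on_subset[OF gc]) simp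
    then have "bounded (g ` cbox a b)" by (rule compact_imp_bounded)
    then obtain K where K: "\<forall>y\<in>g ` cbox a b. norm y \<le> K" unfolding bounded_iff by blast
    have "norm (g x) \<le> max 0 K" for x
      using K supp[of x] by (cases "x \<in> cbox a b") (auto simp: le_max_iff_disj)
    then show ?thesis by (rule integrable_box_support(1)[OF gm]) (rule supp)
  qed
  have "(LBINT x. q n x) = 0" for n
  proof -
    have gi': "integrable lborel (\<lambda>x. g (x + t n *\<^sub>R e))"
    proof -
      have "integrable (distr lborel borel ((+) (t n *\<^sub>R e))) g" using gi by (simp add: lborel_distr_plus)
      then show ?thesis by (subst (asm) integrable_distr_eq) (auto simp: add.commute)
    qed
    have "(LBINT x. q n x) = ((LBINT x. g (x + t n *\<^sub>R e)) - (LBINT x. g x)) / t n"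
      unfolding q_def using gi gi' by simp
    also have "(LBINT x. g (x + t n *\<^sub>R e)) = (LBINT x. g x)"
      using lborel_integral_shift[OF gm, of "t n *\<^sub>R e"] by (simp add: add.commute)
    finally show ?thesis by simp
  qed
  moreover have "(\<lambda>n. LBINT x. q n x) \<longlonglongrightarrow> (LBINT x. g' x e)"
    by (rule integral_dominated_convergence[OF g'm _ w]) (use qlim bound in auto)
  ultimately show "(LBINT x. g' x e) = 0" by (simp add: LIMSEQ_const_iff)
  show "integrable lborel (\<lambda>x. g' x e)"
    by (rule integrable_dominated_convergence[where s=q, OF g'm _ w]) (use qlim bound in auto)
qed

text \<open>The product is a double integral of \<open>f z ^ 2 * f x\<close>, and \<open>p^2 q \<le> p^3 + q^3\<close> for nonnegative numbers.\<close>

lemma moment_product: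
  fixes f :: "real^2 \<Rightarrow> real" and a b :: "real^2"
  assumes [measurable]: "f \<in> borel_measurable borel" and b: "\<And>x. 0 \<le> f x" "\<And>x. f x \<le> K"
  defines "I k \<equiv> (LBINT x. indicator (cbox a b) x * f x ^ k)"
  shows "I 2 * I 1 \<le> 2 * measure lborel (cbox a b) * I 3"
proof -
  let ?Q = "cbox a b"
  let ?V = "measure lborel ?Q"
  have i: "integrable lborel (\<lambda>x. indicator ?Q x * f x ^ k)" for k
    by (rule integrable_box_support(1)[where a=a and b=b and M="K^k"])
      (use b in \<open>auto simp: indicator_def abs_mult intro: power_mono zero_le_power order_trans[OF b(1) b(2)]\<close>)
  have ind: "integrable lborel (indicat_real ?Q)"
    by (intro integrable_real_indicator emeasure_lborel_cbox_finite) simp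
  have young: "p\<^sup>2 * q \<le> p^3 + q^3" if "0 \<le> p" "0 \<le> q" for p q :: real
  proof (cases "q \<le> p")
    case True
    then have "p\<^sup>2 * q \<le> p\<^sup>2 * p" using that by (intro mult_left_mono) auto
    then show ?thesis using that by (simp add: power2_eq_square power3_eq_cube add_increasing2)
  next
    case False
    then have "p\<^sup>2 * q \<le> q\<^sup>2 * q" using that by (intro mult_right_mono power_mono) auto
    then show ?thesis using that by (simp add: power2_eq_square power3_eq_cube add_increasing)
  qed
  have pt: "(f z)\<^sup>2 * I 1 \<le> ?V * (f z)^3 + I 3" for z
  proof -
    have "(f z)\<^sup>2 * I 1 = (LBINT x. (f z)\<^sup>2 * (indicator ?Q x * f x ^ 1))"
      by (simp add: I_def)
    also have "\<dots> \<le> (LBINT x. indicator ?Q x * (f z)^3 + indicator ?Q x * f x ^ 3)"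
    proof (rule integral_mono)
      show "integrable lborel (\<lambda>x. (f z)\<^sup>2 * (indicator ?Q x * f x ^ 1))" by (intro integrable_mult_right i)
      show "integrable lborel (\<lambda>x. indicator ?Q x * (f z)^3 + indicator ?Q x * f x ^ 3)"
        by (intro Bochner_Integration.integrable_add integrable_mult_left ind i)
      show "(f z)\<^sup>2 * (indicator ?Q x * f x ^ 1) \<le> indicator ?Q x * (f z)^3 + indicator ?Q x * f x ^ 3" for x
        using young[OF b(1)[of z] b(1)[of x]] by (auto simp: indicator_def)
    qed
    also have "\<dots> = ?V * (f z)^3 + I 3"
      using ind i[of 3] by (simp add: I_def)
    finally show ?thesis .
  qed
  have "I 2 * I 1 = (LBINT z. indicator ?Q z * f z ^ 2 * I 1)" by (simp add: I_def)
  also have "\<dots> \<le> (LBINT z. ?V * (indicator ?Q z * f z ^ 3) + indicator ?Q z * I 3)"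
  proof (rule integral_mono)
    show "integrable lborel (\<lambda>z. indicator ?Q z * f z ^ 2 * I 1)" by (intro integrable_mult_left i)
    show "integrable lborel (\<lambda>z. ?V * (indicator ?Q z * f z ^ 3) + indicator ?Q z * I 3)"
      by (intro Bochner_Integration.integrable_add integrable_mult_left integrable_mult_right ind i)
    show "indicator ?Q z * f z ^ 2 * I 1 \<le> ?V * (indicator ?Q z * f z ^ 3) + indicator ?Q z * I 3" for z
      using pt[of z] by (auto simp: indicator_def)
  qed
  also have "\<dots> = ?V * I 3 + ?V * I 3" using ind i[of 3] by (simp add: I_def)
  finally show ?thesis by (simp add: mult_ac)
qed

definition dmollify :: "real \<Rightarrow> (real^2 \<Rightarrow> real^2) \<Rightarrow> real^2 \<Rightarrow> real^2 \<Rightarrow> real^2" where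
  "dmollify e m x h = - (LBINT z. (kern_grad e (z - x) \<bullet> h) *\<^sub>R m z)"

text \<open>With increments \<open>\<bar>m z - m x\<bar>\<close>, the defect \<open>1 - \<bar>M x\<bar>^2\<close> is at most an average of their squares (compare
  \<open>M x\<close> with the unit vector \<open>m x\<close>), and the derivative is at most an average of the increments divided
  by \<open>e\<close> (subtract \<open>m x\<close>, as the gradient of the kernel has mean zero). The product of the two averages is
  controlled by the third moment.\<close>

lemma commutator_pointwise:
  fixes m :: "real^2 \<Rightarrow> real^2"
  assumes e: "e > 0" and m [measurable]: "m \<in> borel_measurable borel" and unit: "\<And>z. norm (m z) = 1"
    and h: "norm h = 1"
  shows "(1 - mollify e m x \<bullet> mollify e m x) * norm (dmollify e m x h)
    \<le> 2 * kern_const\<^sup>2 / e^3 * (LBINT z. indicator (cbox x (x + e *\<^sub>R One)) z * (norm (m z - m x))^3)"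
proof -
  define C where "C = kern_const"
  note C = kern_const[folded C_def]
  let ?Q = "cbox x (x + e *\<^sub>R One)"
  define f where "f z = norm (m z - m x)" for z
  have fm [measurable]: "f \<in> borel_measurable borel" unfolding f_def[abs_def] by measurable
  have fb: "0 \<le> f z" "f z \<le> 2" for z
    using norm_triangle_ineq4[of "m z" "m x"] by (simp_all add: f_def unit)
  define I where "I k = (LBINT z. indicator ?Q z * f z ^ k)" for k
  have i: "integrable lborel (\<lambda>z. indicator ?Q z * f z ^ k)" for k
    by (rule integrable_box_support(1)[where a=x and b="x + e *\<^sub>R One" and M="2^k"])
      (use fb in \<open>auto simp: indicator_def abs_mult intro: power_mono\<close>)
  have I0: "0 \<le> I k" for k unfolding I_def by (intro integral_nonneg_AE AE_I2) (simp add: fb)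
  have sq: "(f z)\<^sup>2 = 2 * (1 - m z \<bullet> m x)" for z
    using dot_norm_neg[of "m z" "m x"] by (simp add: f_def unit)
  let ?M = "mollify e m x"
  have "0 \<le> (?M - m x) \<bullet> (?M - m x)" by simp
  then have "1 - ?M \<bullet> ?M \<le> 2 * (1 - ?M \<bullet> m x)"
    by (simp add: inner_diff_left inner_diff_right inner_commute dot_square_norm[of "m x"] unit)
  also have "\<dots> = (LBINT z. kern e (z - x) * (f z)\<^sup>2)"
    unfolding kern_excess_eq[OF e m unit, symmetric] sq integral_mult_right_zero[symmetric]
    by (simp only: mult.left_commute)
  also have "\<dots> \<le> (LBINT z. C / e\<^sup>2 * (indicator ?Q z * f z ^ 2))"
  proof (rule integral_mono)
    have "integrable lborel (\<lambda>z. 2 * (kern e (z - x) * (1 - m z \<bullet> m x)))"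
      by (intro integrable_mult_right kern_excess_integrable e m unit)
    then show "integrable lborel (\<lambda>z. kern e (z - x) * (f z)\<^sup>2)" unfolding sq by (simp only: mult.left_commute)
    show "integrable lborel (\<lambda>z. C / e\<^sup>2 * (indicator ?Q z * f z ^ 2))" by (intro integrable_mult_right i)
    show "kern e (z - x) * (f z)\<^sup>2 \<le> C / e\<^sup>2 * (indicator ?Q z * f z ^ 2)" for z
      using kern_shift_support[OF e, of z x] mult_right_mono[OF C(2)[OF e, of "z - x"], of "(f z)\<^sup>2"]
      by (cases "z \<in> ?Q") auto
  qed
  also have "\<dots> = C / e\<^sup>2 * I 2" by (simp add: I_def)
  finally have A: "1 - ?M \<bullet> ?M \<le> C / e\<^sup>2 * I 2" .
  have "norm ?M \<le> 1" by (rule norm_mollify_le[OF e m]) (simp add: unit)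
  then have A0: "0 \<le> 1 - ?M \<bullet> ?M" by (simp add: dot_square_norm power_le_one)
  have k1: "integrable lborel (\<lambda>z. (kern_grad e (z - x) \<bullet> h) *\<^sub>R m z)"
    by (rule kern_weighted_integrable[OF e m, where M=1]) (simp add: unit)
  have k2: "integrable lborel (\<lambda>z. (kern_grad e (z - x) \<bullet> h) *\<^sub>R m x)"
    by (rule kern_weighted_integrable[OF e _, where M=1]) (simp_all add: unit)
  have k3: "integrable lborel (\<lambda>z. kern_grad e (z - x) \<bullet> h)"
    using kern_weighted_integrable(2)[OF e, of "\<lambda>_. 1::real" 1 x h] by simp
  have "(LBINT z. (kern_grad e (z - x) \<bullet> h) *\<^sub>R m x) = 0"
    using k3 by (simp add: kern_grad_integral[OF e])
  then have "dmollify e m x h = - (LBINT z. (kern_grad e (z - x) \<bullet> h) *\<^sub>R (m z - m x))"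
    using k1 k2 by (simp add: dmollify_def scaleR_diff_right)
  then have "norm (dmollify e m x h) \<le> (LBINT z. norm ((kern_grad e (z - x) \<bullet> h) *\<^sub>R (m z - m x)))"
    by (simp only: norm_minus_cancel integral_norm_bound)
  also have "\<dots> \<le> (LBINT z. C / e^3 * (indicator ?Q z * f z ^ 1))"
  proof (rule integral_mono)
    have "integrable lborel (\<lambda>z. (kern_grad e (z - x) \<bullet> h) *\<^sub>R m z - (kern_grad e (z - x) \<bullet> h) *\<^sub>R m x)"
      by (rule Bochner_Integration.integrable_diff[OF k1 k2])
    then show "integrable lborel (\<lambda>z. norm ((kern_grad e (z - x) \<bullet> h) *\<^sub>R (m z - m x)))"
      unfolding scaleR_diff_right by (rule integrable_norm)
    show "integrable lborel (\<lambda>z. C / e^3 * (indicator ?Q z * f z ^ 1))" by (intro integrable_mult_right i)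
    fix z
    have "\<bar>kern_grad e (z - x) \<bullet> h\<bar> \<le> C / e^3"
      using Cauchy_Schwarz_ineq2[of "kern_grad e (z - x)" h] C(3)[OF e, of "z - x"] h by simp
    then have "\<bar>kern_grad e (z - x) \<bullet> h\<bar> * f z \<le> C / e^3 * f z" using fb by (intro mult_right_mono)
    then show "norm ((kern_grad e (z - x) \<bullet> h) *\<^sub>R (m z - m x)) \<le> C / e^3 * (indicator ?Q z * f z ^ 1)"
      using kern_shift_support[OF e, of z x] by (cases "z \<in> ?Q") (auto simp: f_def)
  qed
  also have "\<dots> = C / e^3 * I 1" by (simp add: I_def)
  finally have D: "norm (dmollify e m x h) \<le> C / e^3 * I 1" .
  have p5: "e^5 = e\<^sup>2 * e^3" by (simp flip: power_add)
  have "(1 - ?M \<bullet> ?M) * norm (dmollify e m x h) \<le> (C / e\<^sup>2 * I 2) * (C / e^3 * I 1)"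
    using A0 A D by (intro mult_mono) auto
  also have "\<dots> = C\<^sup>2 / e^5 * (I 2 * I 1)"
    unfolding p5 by (simp add: power2_eq_square[of C])
  also have "\<dots> \<le> C\<^sup>2 / e^5 * (2 * e\<^sup>2 * I 3)"
    using moment_product[OF fm fb, of x "x + e *\<^sub>R One"] e
    by (intro mult_left_mono) (auto simp: measure_square[OF e] I_def)
  also have "\<dots> = 2 * C\<^sup>2 / e^3 * I 3" using e by (simp add: field_simps eval_nat_numeral)
  finally show ?thesis by (simp add: I_def f_def C_def)
qed

text \<open>The cube of the condition that \<open>t powr (-1/3)\<close> times the \<open>L\<^sup>3\<close> modulus of continuity tends to zero.\<close>

definition vanishing_increments :: "(real^2 \<Rightarrow> real^2) \<Rightarrow> (real^2) set \<Rightarrow> bool" where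
  "vanishing_increments m U \<longleftrightarrow> (\<forall>\<eta>>0. \<exists>\<delta>>0. \<forall>z. norm z < \<delta> \<longrightarrow>
     (\<integral>\<^sup>+x. indicator U x * ennreal (norm (m (x + z) - m x) ^ 3) \<partial>lborel) \<le> ennreal (\<eta> * norm z))"

text \<open>Integrating the pointwise bound in \<open>x\<close> first turns the third moment into increments by a fixed
  vector, which are \<open>o(e)\<close> and compensate the remaining factor \<open>1 / e\<close>.\<close>

lemma commutator_vanishes:
  fixes m :: "real^2 \<Rightarrow> real^2"
  assumes m [measurable]: "m \<in> borel_measurable borel" and unit: "\<And>z. norm (m z) = 1"
    and h: "norm h = 1" and U [measurable]: "U \<in> sets borel" and vi: "vanishing_increments m U" and "\<eta> > 0"
  obtains \<delta> where "\<delta> > 0" "\<And>e. 0 < e \<Longrightarrow> e < \<delta> \<Longrightarrow>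
    (\<integral>\<^sup>+x. indicator U x * ennreal ((1 - mollify e m x \<bullet> mollify e m x) * norm (dmollify e m x h)) \<partial>lborel) \<le> ennreal \<eta>"
proof -
  define C where "C = kern_const"
  have C: "C > 0" by (simp add: C_def kern_const)
  \<comment> \<open>the factor \<open>2 C\<^sup>2 / e^3\<close>, the area \<open>e\<^sup>2\<close> of the square and the bound \<open>2 e\<close> for its vectors multiply to \<open>4 C\<^sup>2\<close>\<close>
  define \<eta>' where "\<eta>' = \<eta> / (4 * C\<^sup>2)"
  have "\<eta>' > 0" using \<open>\<eta> > 0\<close> C by (simp add: \<eta>'_def)
  then have "\<exists>\<delta>>0. \<forall>z. norm z < \<delta> \<longrightarrow>
     (\<integral>\<^sup>+x. indicator U x * ennreal (norm (m (x + z) - m x) ^ 3) \<partial>lborel) \<le> ennreal (\<eta>' * norm z)"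
    using vi[unfolded vanishing_increments_def] by blast
  then obtain \<delta>0 where \<delta>0: "\<delta>0 > 0" "\<And>z. norm z < \<delta>0 \<Longrightarrow>
     (\<integral>\<^sup>+x. indicator U x * ennreal (norm (m (x + z) - m x) ^ 3) \<partial>lborel) \<le> ennreal (\<eta>' * norm z)"
    by blast
  have main: "(\<integral>\<^sup>+x. indicator U x * ennreal ((1 - mollify e m x \<bullet> mollify e m x) * norm (dmollify e m x h)) \<partial>lborel) \<le> ennreal \<eta>"
    if e: "0 < e" "e < \<delta>0 / 2" for e
  proof -
    let ?B = "cbox 0 (e *\<^sub>R One) :: (real^2) set"
    have vol: "emeasure lborel ?B = ennreal (e\<^sup>2)"
      using e by (subst emeasure_lborel_cbox) auto
    have pt: "ennreal ((1 - mollify e m x \<bullet> mollify e m x) * norm (dmollify e m x h))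
      \<le> ennreal (2 * C\<^sup>2 / e^3) * (\<integral>\<^sup>+w. indicator ?B w * ennreal (norm (m (x + w) - m x) ^ 3) \<partial>lborel)" for x
    proof -
      let ?Q = "cbox x (x + e *\<^sub>R One)"
      have i: "integrable lborel (\<lambda>z. indicator ?Q z * norm (m z - m x) ^ 3)"
      proof (rule integrable_box_support(1)[where a=x and b="x + e *\<^sub>R One" and M="2^3"])
        show "norm (indicator ?Q z * norm (m z - m x) ^ 3 :: real) \<le> 2 ^ 3" for z
          using norm_triangle_ineq4[of "m z" "m x"] power_mono[of "norm (m z - m x)" 2 3]
          by (auto simp: indicator_def unit)
      qed auto
      have "ennreal ((1 - mollify e m x \<bullet> mollify e m x) * norm (dmollify e m x h))
          \<le> ennreal (2 * C\<^sup>2 / e^3 * (LBINT z. indicator ?Q z * (norm (m z - m x))^3))"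
        unfolding C_def by (intro ennreal_leI commutator_pointwise e m unit h)
      also have "\<dots> = ennreal (2 * C\<^sup>2 / e^3) * ennreal (LBINT z. indicator ?Q z * (norm (m z - m x))^3)"
        by (rule ennreal_mult') (use e in simp)
      also have "ennreal (LBINT z. indicator ?Q z * (norm (m z - m x))^3)
          = (\<integral>\<^sup>+z. ennreal (indicator ?Q z * (norm (m z - m x))^3) \<partial>lborel)"
        by (rule nn_integral_eq_integral[OF i, symmetric]) auto
      also have "(\<integral>\<^sup>+z. ennreal (indicator ?Q z * (norm (m z - m x))^3) \<partial>lborel)
          = (\<integral>\<^sup>+w. ennreal (indicator ?Q (x + w) * (norm (m (x + w) - m x))^3) \<partial>lborel)"
        by (rule lborel_nn_integral_shift[symmetric]) measurable
      also have "\<dots> = (\<integral>\<^sup>+w. indicator ?B w * ennreal (norm (m (x + w) - m x) ^ 3) \<partial>lborel)"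
        by (intro nn_integral_cong) (auto simp: indicator_def mem_box inner_add_left)
      finally show ?thesis .
    qed
    have "(\<integral>\<^sup>+x. indicator U x * ennreal ((1 - mollify e m x \<bullet> mollify e m x) * norm (dmollify e m x h)) \<partial>lborel)
        \<le> (\<integral>\<^sup>+x. ennreal (2 * C\<^sup>2 / e^3) * (\<integral>\<^sup>+w. indicator ?B w * (indicator U x * ennreal (norm (m (x + w) - m x) ^ 3)) \<partial>lborel) \<partial>lborel)"
      by (intro nn_integral_mono) (use pt in \<open>auto simp: indicator_def\<close>)
    also have "\<dots> = ennreal (2 * C\<^sup>2 / e^3) * (\<integral>\<^sup>+x. \<integral>\<^sup>+w. indicator ?B w * (indicator U x * ennreal (norm (m (x + w) - m x) ^ 3)) \<partial>lborel \<partial>lborel)"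
      by (rule nn_integral_cmult) measurable
    also have "(\<integral>\<^sup>+x. \<integral>\<^sup>+w. indicator ?B w * (indicator U x * ennreal (norm (m (x + w) - m x) ^ 3)) \<partial>lborel \<partial>lborel)
        = (\<integral>\<^sup>+w. \<integral>\<^sup>+x. indicator ?B w * (indicator U x * ennreal (norm (m (x + w) - m x) ^ 3)) \<partial>lborel \<partial>lborel)"
      by (rule lborel_pair.Fubini'[symmetric]) measurable
    also have "\<dots> = (\<integral>\<^sup>+w. indicator ?B w * (\<integral>\<^sup>+x. indicator U x * ennreal (norm (m (x + w) - m x) ^ 3) \<partial>lborel) \<partial>lborel)"
      by (intro nn_integral_cong nn_integral_cmult) measurable
    also have "\<dots> \<le> (\<integral>\<^sup>+w. ennreal (\<eta>' * (2 * e)) * indicator ?B w \<partial>lborel)"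
    proof (intro nn_integral_mono)
      fix w
      show "indicator ?B w * (\<integral>\<^sup>+x. indicator U x * ennreal (norm (m (x + w) - m x) ^ 3) \<partial>lborel) \<le> ennreal (\<eta>' * (2 * e)) * indicator ?B w"
      proof (cases "w \<in> ?B")
        case True
        have "(\<integral>\<^sup>+x. indicator U x * ennreal (norm (m (x + w) - m x) ^ 3) \<partial>lborel) \<le> ennreal (\<eta>' * norm w)"
          using norm_le_side[OF True] e by (intro \<delta>0(2)) simp
        also have "\<dots> \<le> ennreal (\<eta>' * (2 * e))"
          using norm_le_side[OF True] \<open>\<eta>' > 0\<close> by (intro ennreal_leI mult_left_mono) auto
        finally show ?thesis using True by simp
      qed simp
    qed
    also have "\<dots> = ennreal (\<eta>' * (2 * e)) * ennreal (e\<^sup>2)"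
      by (simp add: nn_integral_cmult_indicator vol)
    finally have "(\<integral>\<^sup>+x. indicator U x * ennreal ((1 - mollify e m x \<bullet> mollify e m x) * norm (dmollify e m x h)) \<partial>lborel)
        \<le> ennreal (2 * C\<^sup>2 / e^3) * (ennreal (\<eta>' * (2 * e)) * ennreal (e\<^sup>2))"
      by (simp add: mult_left_mono)
    also have "\<dots> = ennreal (2 * C\<^sup>2 / e^3 * (\<eta>' * (2 * e) * e\<^sup>2))"
      using e \<open>\<eta>' > 0\<close> by (simp flip: ennreal_mult')
    also have "2 * C\<^sup>2 / e^3 * (\<eta>' * (2 * e) * e\<^sup>2) = \<eta>"
      using e C by (simp add: \<eta>'_def power2_eq_square power3_eq_cube)
    finally show ?thesis .
  qed
  show ?thesis by (rule that[of "\<delta>0 / 2"]) (use \<delta>0(1) main in auto)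
qed

section \<open>Vanishing entropy production\<close>

text \<open>The integral over the whole plane is the one over \<open>\<Omega>\<close>, as the gradients of test functions vanish outside.\<close>

definition weakly_div_free :: "(real^2) set \<Rightarrow> (real^2 \<Rightarrow> real^2) \<Rightarrow> bool" where
  "weakly_div_free \<Omega> F \<longleftrightarrow> (\<forall>\<phi>\<in>test_functions \<Omega>. (LBINT x. F x \<bullet> gradient \<phi> x) = 0)"

lemma test_function_gradient:
  assumes "\<phi> \<in> test_functions \<Omega>"
  obtains K G L where "compact K" "K \<subseteq> \<Omega>" "\<And>x. (\<phi> has_derivative (\<lambda>h. G x \<bullet> h)) (at x)"
    "continuous_on UNIV G" "\<And>x. x \<notin> K \<Longrightarrow> \<phi> x = 0" "\<And>x. x \<notin> K \<Longrightarrow> G x = 0" "gradient \<phi> = G"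
    "0 \<le> L" "\<And>x. norm (G x) \<le> L" "\<And>x. \<bar>\<phi> x\<bar> \<le> L"
proof -
  define K where "K = closure {x. \<phi> x \<noteq> 0}"
  have K: "compact K" "K \<subseteq> \<Omega>"
    using assms by (auto simp: test_functions_def compactly_contained_def K_def)
  have "C_k (Suc 0) \<phi>" using assms by (simp add: test_functions_def del: C_k.simps)
  then obtain G where G: "\<And>x. (\<phi> has_derivative (\<lambda>h. G x \<bullet> h)) (at x)" "\<And>i. continuous_on UNIV (\<lambda>x. G x $ i)"
    by auto
  have contG: "continuous_on UNIV G"
    unfolding continuous_on_componentwise[of _ G] Basis_vec_def using G(2) by (auto simp: inner_axis)
  have z: "\<phi> x = 0" if "x \<notin> K" for x using that closure_subset[of "{x. \<phi> x \<noteq> 0}"] by (auto simp: K_def)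
  have Gz: "G x = 0" if "x \<notin> K" for x
    by (rule gradient_vanishes_off_support[OF G(1) _ z that]) (simp add: K_def)
  obtain L where L: "L \<ge> 0" "\<And>x. norm (G x) \<le> L"
    by (rule compact_gradient_lipschitz[OF G(1) contG K(1) Gz]) auto
  have c\<phi>: "continuous_on UNIV \<phi>"
    by (intro continuous_at_imp_continuous_on ballI has_derivative_continuous[OF G(1)])
  have "bounded (\<phi> ` K)"
    by (intro compact_imp_bounded compact_continuous_image K continuous_on_subset[OF c\<phi> subset_UNIV])
  then obtain M where M: "\<forall>y\<in>\<phi> ` K. norm y \<le> M" unfolding bounded_iff by blast
  have Mb: "\<bar>\<phi> x\<bar> \<le> max L M" for x
    using M z[of x] L(1) by (cases "x \<in> K") (auto simp: le_max_iff_disj)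
  have "norm (G x) \<le> max L M" for x using L(2)[of x] by simp
  moreover have "gradient \<phi> = G" by (rule ext) (rule gradient_eq[OF G(1)])
  ultimately show ?thesis
    using that[OF K G(1) contG z Gz, of "max L M"] L(1) Mb by auto
qed

lemma kern_test_function:
  assumes e: "e > 0" and sub: "cbox x (x + e *\<^sub>R One) \<subseteq> \<Omega>"
  shows "(\<lambda>z. kern e (z - x)) \<in> test_functions \<Omega>" "gradient (\<lambda>z. kern e (z - x)) z = kern_grad e (z - x)"
proof -
  have s: "closure {z. kern e (z - x) \<noteq> 0} \<subseteq> cbox x (x + e *\<^sub>R One)"
    using kern_shift_support(1)[OF e] by (intro closure_minimal closed_cbox) blast
  then have "compact (closure {z. kern e (z - x) \<noteq> 0})"
    using compact_Int_closed[OF compact_cbox closed_closure] by (metis inf.absorb2)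
  then show "(\<lambda>z. kern e (z - x)) \<in> test_functions \<Omega>"
    using s sub bumps_C_k[OF kern_bumps[OF e]] by (auto simp: test_functions_def compactly_contained_def)
  have "((\<lambda>z. z - x) has_derivative (\<lambda>h. h)) (at z)" by (auto intro!: derivative_eq_intros)
  then have "(kern e \<circ> (\<lambda>z. z - x) has_derivative (\<lambda>h. kern_grad e (z - x) \<bullet> h) \<circ> (\<lambda>h. h)) (at z)"
    by (rule diff_chain_at) (rule kern_has_derivative[OF e])
  then show "gradient (\<lambda>z. kern e (z - x)) z = kern_grad e (z - x)"
    by (intro gradient_eq) (simp add: o_def)
qed

lemma mollify_div_free:
  fixes m :: "real^2 \<Rightarrow> real^2"
  assumes e: "e > 0" and m: "m \<in> borel_measurable borel" and b: "\<And>z. norm (m z) \<le> 1"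
    and div: "weakly_div_free \<Omega> m" and sub: "cbox x (x + e *\<^sub>R One) \<subseteq> \<Omega>"
  shows "dmollify e m x (axis 1 1) $ 1 + dmollify e m x (axis 2 1) $ 2 = 0"
proof -
  have i: "integrable lborel (\<lambda>z. (kern_grad e (z - x) \<bullet> h) *\<^sub>R m z)" for h
    by (rule kern_weighted_integrable[OF e m b])
  have c: "dmollify e m x (axis j 1) $ j = - (LBINT z. kern_grad e (z - x) $ j * m z $ j)" for j
  proof -
    have "(LBINT z. (kern_grad e (z - x) \<bullet> axis j 1) *\<^sub>R m z) \<bullet> axis j 1
        = (LBINT z. ((kern_grad e (z - x) \<bullet> axis j 1) *\<^sub>R m z) \<bullet> axis j 1)"
      by (rule integral_inner_left[symmetric]) (rule i)
    then show ?thesis by (simp add: dmollify_def inner_axis)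
  qed
  have ic: "integrable lborel (\<lambda>z. kern_grad e (z - x) $ j * m z $ j)" for j
  proof -
    have "integrable lborel (\<lambda>z. ((kern_grad e (z - x) \<bullet> axis j 1) *\<^sub>R m z) \<bullet> axis j 1)"
      by (rule integrable_inner_left) (rule i)
    then show ?thesis by (simp add: inner_axis)
  qed
  have "(LBINT z. m z \<bullet> gradient (\<lambda>z. kern e (z - x)) z) = 0"
    using div kern_test_function(1)[OF e sub] unfolding weakly_div_free_def by blast
  then have "(LBINT z. kern_grad e (z - x) $ 1 * m z $ 1 + kern_grad e (z - x) $ 2 * m z $ 2) = 0"
    unfolding kern_test_function(2)[OF e sub] by (simp add: inner_plane mult.commute)
  then show ?thesis unfolding c using ic by simp
qed

lemma norm_dmollify_le:
  fixes m :: "real^2 \<Rightarrow> real^2"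
  assumes e: "e > 0" and m [measurable]: "m \<in> borel_measurable borel" and b: "\<And>z. norm (m z) \<le> 1"
  shows "norm (dmollify e m x h) \<le> kern_const / e * norm h"
proof -
  have "norm (LBINT z. (kern_grad e (z - x) \<bullet> h) *\<^sub>R m z)
      \<le> (kern_const / e^3 * norm h) * 1 * measure lborel (cbox x (x + e *\<^sub>R One))"
  proof (rule integrable_box_support(2))
    show "norm ((kern_grad e (z - x) \<bullet> h) *\<^sub>R m z) \<le> kern_const / e^3 * norm h * 1" for z
      unfolding norm_scaleR real_norm_def using b[of z] e kern_const(1)
      by (intro mult_mono order_trans[OF Cauchy_Schwarz_ineq2] kern_const(3)) auto
  qed (use kern_shift_support[OF e] in auto)
  then show ?thesis unfolding measure_square[OF e] dmollify_def using e by (simp add: power2_eq_square power3_eq_cube)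
qed

lemma dmollify_measurable [measurable]:
  fixes m :: "real^2 \<Rightarrow> real^2"
  assumes [measurable]: "m \<in> borel_measurable borel"
  shows "(\<lambda>x. dmollify e m x h) \<in> borel_measurable borel"
  unfolding dmollify_def by measurable

lemma mollify_continuous:
  fixes m :: "real^2 \<Rightarrow> real^2"
  assumes "e > 0" "m \<in> borel_measurable borel" "\<And>z. norm (m z) \<le> 1"
  shows "continuous_on S (mollify e m)"
  by (intro continuous_at_imp_continuous_on ballI has_derivative_continuous[OF mollify_has_derivative[OF assms]])

lemma vanishing_increments_subset:
  assumes "vanishing_increments m U" "V \<subseteq> U"
  shows "vanishing_increments m V"
proof -
  have "(\<integral>\<^sup>+x. indicator V x * ennreal (norm (m (x + z) - m x) ^ 3) \<partial>lborel)
      \<le> (\<integral>\<^sup>+x. indicator U x * ennreal (norm (m (x + z) - m x) ^ 3) \<partial>lborel)" for z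
    using assms(2) by (intro nn_integral_mono) (auto simp: indicator_def)
  then show ?thesis using assms(1) unfolding vanishing_increments_def by (meson order_trans)
qed

lemma vanishing_increments_Un:
  fixes m :: "real^2 \<Rightarrow> real^2"
  assumes [measurable]: "m \<in> borel_measurable borel" "U \<in> sets borel" "V \<in> sets borel"
    and U: "vanishing_increments m U" and V: "vanishing_increments m V"
  shows "vanishing_increments m (U \<union> V)"
  unfolding vanishing_increments_def
proof (intro allI impI)
  fix \<eta> :: real assume "\<eta> > 0"
  then have h: "\<eta> / 2 > 0" by simp
  let ?I = "\<lambda>U z. \<integral>\<^sup>+x. indicator U x * ennreal (norm (m (x + z) - m x) ^ 3) \<partial>lborel"
  have "\<exists>\<delta>>0. \<forall>z. norm z < \<delta> \<longrightarrow> ?I U z \<le> ennreal (\<eta> / 2 * norm z)"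
    using U[unfolded vanishing_increments_def] h by blast
  then obtain d1 where d1: "d1 > 0" "\<forall>z. norm z < d1 \<longrightarrow> ?I U z \<le> ennreal (\<eta> / 2 * norm z)" by blast
  have "\<exists>\<delta>>0. \<forall>z. norm z < \<delta> \<longrightarrow> ?I V z \<le> ennreal (\<eta> / 2 * norm z)"
    using V[unfolded vanishing_increments_def] h by blast
  then obtain d2 where d2: "d2 > 0" "\<forall>z. norm z < d2 \<longrightarrow> ?I V z \<le> ennreal (\<eta> / 2 * norm z)" by blast
  have "?I (U \<union> V) z \<le> ennreal (\<eta> * norm z)" if z: "norm z < min d1 d2" for z
  proof -
    have "?I (U \<union> V) z \<le> (\<integral>\<^sup>+x. indicator U x * ennreal (norm (m (x + z) - m x) ^ 3)
        + indicator V x * ennreal (norm (m (x + z) - m x) ^ 3) \<partial>lborel)"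
      by (intro nn_integral_mono) (auto simp: indicator_def)
    also have "\<dots> = ?I U z + ?I V z" by (rule nn_integral_add) measurable
    also have "\<dots> \<le> ennreal (\<eta> / 2 * norm z) + ennreal (\<eta> / 2 * norm z)"
      using d1(2) d2(2) z by (intro add_mono) auto
    also have "\<dots> = ennreal (\<eta> * norm z)" using \<open>\<eta> > 0\<close> by (simp flip: ennreal_plus)
    finally show ?thesis .
  qed
  then show "\<exists>\<delta>>0. \<forall>z. norm z < \<delta> \<longrightarrow> ?I (U \<union> V) z \<le> ennreal (\<eta> * norm z)"
    using d1(1) d2(1) by (intro exI[of _ "min d1 d2"]) simp
qed

lemma vanishing_increments_compact:
  fixes m :: "real^2 \<Rightarrow> real^2"
  assumes m: "m \<in> borel_measurable borel" and K: "compact K" "K \<subseteq> \<Omega>"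
    and loc: "\<And>a. a \<in> \<Omega> \<Longrightarrow> \<exists>r>0. vanishing_increments m (ball a r)"
  shows "vanishing_increments m K"
proof -
  have "\<forall>a\<in>K. \<exists>r>0. vanishing_increments m (ball a r)" using loc K(2) by blast
  then obtain r where r: "\<forall>a\<in>K. r a > 0 \<and> vanishing_increments m (ball a (r a))" by metis
  have cov: "K \<subseteq> (\<Union>a\<in>K. ball a (r a))" using r by force
  obtain F where F: "F \<subseteq> K" "finite F" "K \<subseteq> (\<Union>a\<in>F. ball a (r a))"
    by (rule compactE_image[OF K(1) _ cov]) auto
  have "vanishing_increments m (\<Union>a\<in>F. ball a (r a))" using F(2,1)
  proof (induction F)
    case empty
    then show ?case by (auto simp: vanishing_increments_def intro: exI[of _ 1])
  next
    case (insert a F)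
    then show ?case
      unfolding UN_insert using r by (intro vanishing_increments_Un m) auto
  qed
  then show ?thesis using F(3) vanishing_increments_subset by blast
qed

text \<open>For the mollified field \<open>M\<close> and the extension \<open>G\<close>, integration by parts moves the gradient of the
  test function to the divergence of \<open>G \<circ> M\<close>, which is bounded by the commutator \<open>(1 - \<bar>M\<bar>^2) \<bar>\<nabla>M\<bar>\<close> on the
  support. The other side converges to the weak divergence of \<open>\<Phi> \<circ> m\<close> by dominated convergence.\<close>

theorem entropy_production_vanishes:
  fixes m :: "real^2 \<Rightarrow> real^2"
  assumes "open \<Omega>" and m [measurable]: "m \<in> borel_measurable borel" and unit: "\<And>z. norm (m z) = 1"
    and div: "weakly_div_free \<Omega> m"
    and loc: "\<And>a. a \<in> \<Omega> \<Longrightarrow> \<exists>r>0. vanishing_increments m (ball a r)"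
    and ent: "\<Phi> \<in> ENT"
  shows "weakly_div_free \<Omega> (\<lambda>x. \<Phi> (m x))"
  unfolding weakly_div_free_def
proof
  fix \<phi> assume "\<phi> \<in> test_functions \<Omega>"
  then obtain K P L where K: "compact K" "K \<subseteq> \<Omega>" and P: "\<And>x. (\<phi> has_derivative (\<lambda>h. P x \<bullet> h)) (at x)"
    "continuous_on UNIV P" and z: "\<And>x. x \<notin> K \<Longrightarrow> \<phi> x = 0" "\<And>x. x \<notin> K \<Longrightarrow> P x = 0" and grad: "gradient \<phi> = P"
    and L: "0 \<le> L" "\<And>x. norm (P x) \<le> L" "\<And>x. \<bar>\<phi> x\<bar> \<le> L"
    by (rule test_function_gradient) blast
  obtain G :: "real^2 \<Rightarrow> real^2" and \<gamma> :: "real^2 \<Rightarrow> real" and B C where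
    G: "\<And>z. (G has_derivative (\<lambda>h. \<gamma> z *\<^sub>R h + (1 - z \<bullet> z) *\<^sub>R B z h)) (at z)"
    and B: "\<And>z h. norm z \<le> 1 \<Longrightarrow> norm (B z h) \<le> C * norm h"
    and \<gamma>: "\<And>z. norm z \<le> 1 \<Longrightarrow> \<bar>\<gamma> z\<bar> \<le> C" and C: "C \<ge> 0"
    and G\<Phi>: "\<And>t. G (circ t) = \<Phi> (circ t)"
    by (rule entropy_extension[OF ent]) blast
  have b: "norm (m z) \<le> 1" for z by (simp add: unit)
  have GmPhi: "\<Phi> (m x) = G (m x)" for x
    using unit_is_circ[OF unit[of x]] G\<Phi> by metis
  have vK: "vanishing_increments m K" by (rule vanishing_increments_compact[OF m K loc])
  have Kb [measurable]: "K \<in> sets borel" by (rule borel_closed[OF compact_imp_closed[OF K(1)]])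
  obtain c where "K \<subseteq> cbox (- c) c"
    by (rule bounded_subset_cbox_symmetric[OF compact_imp_bounded[OF K(1)]])
  then obtain a where box: "K \<subseteq> cbox a c" by blast
  have out: "x \<notin> K" if "x \<notin> cbox a c" for x using that box by blast
  obtain \<delta>1 where \<delta>1: "\<delta>1 > 0" "(\<Union>x\<in>K. ball x \<delta>1) \<subseteq> \<Omega>"
    by (rule compact_subset_open_imp_ball_epsilon_subset[OF K(1) \<open>open \<Omega>\<close> K(2)])
  have contG: "continuous_on S G" for S
    by (intro continuous_at_imp_continuous_on ballI has_derivative_continuous[OF G])
  have [measurable]: "G \<in> borel_measurable borel" "P \<in> borel_measurable borel"
    using contG P(2) by (auto intro: borel_measurable_continuous_onI)
  have "bounded (G ` cball 0 1)"
    by (intro compact_imp_bounded compact_continuous_image contG compact_cball)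
  then obtain MG where MG: "\<forall>y\<in>G ` cball 0 1. norm y \<le> MG" unfolding bounded_iff by blast
  have GM: "norm (G z) \<le> MG" if "norm z \<le> 1" for z using MG that by auto
  have MG0: "0 \<le> MG" using order_trans[OF norm_ge_zero GM[of 0]] by simp
  define dG where "dG z h = \<gamma> z *\<^sub>R h + (1 - z \<bullet> z) *\<^sub>R B z h" for z h
  have dG_le: "norm (dG z h) \<le> 2 * C * norm h" if "norm z \<le> 1" for z h
  proof -
    have "\<bar>1 - z \<bullet> z\<bar> \<le> 1" using that by (simp add: dot_square_norm power_le_one abs_le_iff)
    then have "norm ((1 - z \<bullet> z) *\<^sub>R B z h) \<le> 1 * (C * norm h)"
      unfolding norm_scaleR using B[OF that] by (intro mult_mono) auto
    moreover have "norm (\<gamma> z *\<^sub>R h) \<le> C * norm h"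
      unfolding norm_scaleR using \<gamma>[OF that] by (intro mult_right_mono) auto
    ultimately show ?thesis unfolding dG_def using norm_triangle_ineq[of "\<gamma> z *\<^sub>R h" "(1 - z \<bullet> z) *\<^sub>R B z h"]
      by linarith
  qed
  have est: "\<bar>LBINT x. G (mollify e m x) \<bullet> P x\<bar> \<le> L * C * (2 * \<eta>)"
    if e: "0 < e" "2 * e < \<delta>1" and \<eta>: "\<eta> > 0"
      and small: "\<And>h. h = axis 1 1 \<or> h = axis 2 1 \<Longrightarrow>
        (\<integral>\<^sup>+x. indicator K x * ennreal ((1 - mollify e m x \<bullet> mollify e m x) * norm (dmollify e m x h)) \<partial>lborel) \<le> ennreal \<eta>"
    for e \<eta>
  proof -
    define M where "M = mollify e m"
    define M' where "M' = dmollify e m"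
    have M1: "norm (M x) \<le> 1" for x unfolding M_def by (rule norm_mollify_le[OF e(1) m b])
    have dM: "(M has_derivative M' x) (at x)" for x
      using mollify_has_derivative[OF e(1) m b, of x] by (simp add: M_def M'_def dmollify_def[abs_def])
    have M'le: "norm (M' x h) \<le> kern_const / e * norm h" for x h
      unfolding M'_def by (rule norm_dmollify_le[OF e(1) m b])
    have contM: "continuous_on UNIV M" unfolding M_def by (rule mollify_continuous[OF e(1) m b])
    have [measurable]: "M \<in> borel_measurable borel" using contM by (rule borel_measurable_continuous_onI)
    have [measurable]: "(\<lambda>x. M' x h) \<in> borel_measurable borel" for h unfolding M'_def by measurable
    define W' where "W' i x h = (P x \<bullet> h) * G (M x) $ i + \<phi> x * dG (M x) (M' x h) $ i" for i x h
    have dW: "((\<lambda>x. \<phi> x * G (M x) $ i) has_derivative W' i x) (at x)" for i x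
    proof -
      have "(G has_derivative dG (M x)) (at (M x))" using G[of "M x"] by (simp add: dG_def[abs_def])
      from diff_chain_at[OF dM this]
      have "((\<lambda>x. G (M x)) has_derivative (\<lambda>h. dG (M x) (M' x h))) (at x)" by (simp add: o_def)
      then have "((\<lambda>x. G (M x) $ i) has_derivative (\<lambda>h. dG (M x) (M' x h) $ i)) (at x)"
        by (rule bounded_linear.has_derivative[OF bounded_linear_vec_nth])
      from has_derivative_mult[OF P(1) this] show ?thesis
        unfolding W'_def by (rule has_derivative_eq_rhs) (simp add: fun_eq_iff)
    qed
    define Q where "Q = L * MG + L * (2 * C * (kern_const / e))"
    have Q0: "0 \<le> Q" unfolding Q_def using L(1) MG0 C e(1) kern_const(1)
      by (intro add_nonneg_nonneg mult_nonneg_nonneg divide_nonneg_nonneg) auto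
    have W'le: "\<bar>W' i x h\<bar> \<le> Q * norm h" for i x h
    proof -
      have "\<bar>(P x \<bullet> h) * G (M x) $ i\<bar> \<le> (L * norm h) * MG"
        unfolding abs_mult using L(1,2) order_trans[OF component_le_norm_cart GM[OF M1]]
        by (intro mult_mono order_trans[OF Cauchy_Schwarz_ineq2] mult_right_mono) auto
      moreover have "\<bar>\<phi> x * dG (M x) (M' x h) $ i\<bar> \<le> L * (2 * C * (kern_const / e * norm h))"
        unfolding abs_mult using L(1) C M'le
        by (intro mult_mono L(3) order_trans[OF component_le_norm_cart order_trans[OF dG_le[OF M1]]] mult_left_mono) auto
      ultimately show ?thesis
        unfolding W'_def Q_def by (simp add: algebra_simps abs_triangle_ineq[THEN order_trans])
    qed
    have lip: "\<bar>\<phi> x * G (M x) $ i - \<phi> y * G (M y) $ i\<bar> \<le> Q * norm (x - y)" for i x y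
    proof -
      have "norm (\<phi> x * G (M x) $ i - \<phi> y * G (M y) $ i) \<le> Q * norm (x - y)"
      proof (rule differentiable_bound[OF convex_UNIV, where f="\<lambda>x. \<phi> x * G (M x) $ i" and f'="W' i"])
        show "((\<lambda>x. \<phi> x * G (M x) $ i) has_derivative W' i x) (at x within UNIV)" for x using dW by simp
        show "onorm (W' i x) \<le> Q" for x by (rule onorm_bound[OF Q0]) (use W'le in simp)
      qed auto
      then show ?thesis by simp
    qed
    have supp: "\<phi> x * G (M x) $ i = 0" if "x \<notin> cbox a c" for x i using z(1)[OF out[OF that]] by simp
    have int0: "integrable lborel (\<lambda>x. W' i x h)" "(LBINT x. W' i x h) = 0" for i h
      using integral_derivative_zero[OF dW lip Q0 supp] by blast+
    \<comment> \<open>the part of the divergence of \<open>\<phi> (G \<circ> M)\<close> that does not contain the gradient of \<open>\<phi>\<close>\<close>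
    define R where "R x = \<phi> x * (dG (M x) (M' x (axis 1 1)) $ 1 + dG (M x) (M' x (axis 2 1)) $ 2)" for x
    have sum: "W' 1 x (axis 1 1) + W' 2 x (axis 2 1) = G (M x) \<bullet> P x + R x" for x
      by (simp add: W'_def R_def inner_axis inner_plane axis_def algebra_simps)
    have iG: "integrable lborel (\<lambda>x. G (M x) \<bullet> P x)"
    proof (rule integrable_box_support(1)[where a=a and b=c and M="MG * L"])
      show "norm (G (M x) \<bullet> P x) \<le> MG * L" for x
        unfolding real_norm_def using GM[OF M1] L(2) MG0
        by (intro order_trans[OF Cauchy_Schwarz_ineq2] mult_mono) auto
      show "G (M x) \<bullet> P x = 0" if "x \<notin> cbox a c" for x using z(2)[OF out[OF that]] by simp
    qed measurable
    have iS: "integrable lborel (\<lambda>x. G (M x) \<bullet> P x + R x)"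
      unfolding sum[symmetric] by (intro Bochner_Integration.integrable_add int0)
    have iR: "integrable lborel R"
      using Bochner_Integration.integrable_diff[OF iS iG] by simp
    have "(LBINT x. G (M x) \<bullet> P x + R x) = 0"
      unfolding sum[symmetric] using int0 by simp
    then have eq: "(LBINT x. G (M x) \<bullet> P x) = - (LBINT x. R x)"
      using iG iR by simp
    define p where "p h x = (1 - M x \<bullet> M x) * norm (M' x h)" for h x
    have [measurable]: "(\<lambda>x. p h x) \<in> borel_measurable borel" for h unfolding p_def by measurable
    have p0: "0 \<le> p h x" for h x unfolding p_def using M1[of x]
      by (intro mult_nonneg_nonneg) (auto simp: dot_square_norm power_le_one)
    have Rle: "\<bar>R x\<bar> \<le> L * C * (p (axis 1 1) x + p (axis 2 1) x)" if x: "x \<in> K" for x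
    proof -
      have "cbox x (x + e *\<^sub>R One) \<subseteq> ball x \<delta>1" by (rule cbox_subset_ball[OF e(2)])
      then have "cbox x (x + e *\<^sub>R One) \<subseteq> \<Omega>" using \<delta>1(2) x by blast
      then have dv: "M' x (axis 1 1) $ 1 + M' x (axis 2 1) $ 2 = 0"
        unfolding M'_def by (rule mollify_div_free[OF e(1) m b div])
      have "R x = \<phi> x * ((1 - M x \<bullet> M x) * (B (M x) (M' x (axis 1 1)) $ 1 + B (M x) (M' x (axis 2 1)) $ 2)
           + \<gamma> (M x) * (M' x (axis 1 1) $ 1 + M' x (axis 2 1) $ 2))"
        unfolding R_def dG_def by (simp add: algebra_simps)
      also have "\<dots> = \<phi> x * ((1 - M x \<bullet> M x) * (B (M x) (M' x (axis 1 1)) $ 1 + B (M x) (M' x (axis 2 1)) $ 2))"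
        using dv by simp
      finally have R: "R x = \<phi> x * ((1 - M x \<bullet> M x) * (B (M x) (M' x (axis 1 1)) $ 1 + B (M x) (M' x (axis 2 1)) $ 2))" .
      have A0: "0 \<le> 1 - M x \<bullet> M x" using M1[of x] by (simp add: dot_square_norm power_le_one)
      have Bc: "\<bar>B (M x) (M' x h) $ i\<bar> \<le> C * norm (M' x h)" for h i
        by (rule order_trans[OF component_le_norm_cart B[OF M1]])
      have "\<bar>B (M x) (M' x (axis 1 1)) $ 1 + B (M x) (M' x (axis 2 1)) $ 2\<bar>
          \<le> C * norm (M' x (axis 1 1)) + C * norm (M' x (axis 2 1))"
        by (intro order_trans[OF abs_triangle_ineq] add_mono Bc)
      then have "\<bar>R x\<bar> \<le> L * ((1 - M x \<bullet> M x) * (C * norm (M' x (axis 1 1)) + C * norm (M' x (axis 2 1))))"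
        unfolding R abs_mult using A0 L C by (intro mult_mono) auto
      also have "\<dots> = L * C * (p (axis 1 1) x + p (axis 2 1) x)" by (simp add: p_def algebra_simps)
      finally show ?thesis .
    qed
    have "ennreal \<bar>LBINT x. R x\<bar> \<le> (\<integral>\<^sup>+x. ennreal \<bar>R x\<bar> \<partial>lborel)"
      using integral_norm_bound_ennreal[OF iR] by simp
    also have "\<dots> \<le> (\<integral>\<^sup>+x. ennreal (L * C) * (indicator K x * ennreal (p (axis 1 1) x) + indicator K x * ennreal (p (axis 2 1) x)) \<partial>lborel)"
    proof (intro nn_integral_mono)
      fix x
      show "ennreal \<bar>R x\<bar> \<le> ennreal (L * C) * (indicator K x * ennreal (p (axis 1 1) x) + indicator K x * ennreal (p (axis 2 1) x))"
      proof (cases "x \<in> K")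
        case True
        have "ennreal \<bar>R x\<bar> \<le> ennreal (L * C * (p (axis 1 1) x + p (axis 2 1) x))"
          by (rule ennreal_leI[OF Rle[OF True]])
        also have "\<dots> = ennreal (L * C) * (ennreal (p (axis 1 1) x) + ennreal (p (axis 2 1) x))"
          using p0 L C by (simp add: ennreal_mult')
        finally show ?thesis using True by simp
      qed (simp add: R_def z)
    qed
    also have "\<dots> = ennreal (L * C) * ((\<integral>\<^sup>+x. indicator K x * ennreal (p (axis 1 1) x) \<partial>lborel)
        + (\<integral>\<^sup>+x. indicator K x * ennreal (p (axis 2 1) x) \<partial>lborel))"
      by (simp add: nn_integral_cmult nn_integral_add)
    also have "\<dots> \<le> ennreal (L * C) * (ennreal \<eta> + ennreal \<eta>)"
      using small unfolding p_def M_def M'_def by (intro mult_left_mono add_mono) auto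
    also have "\<dots> = ennreal (L * C * (2 * \<eta>))"
      using \<eta> L C by (simp add: ennreal_mult' flip: ennreal_plus)
    finally have "\<bar>LBINT x. R x\<bar> \<le> L * C * (2 * \<eta>)"
      using \<eta> L C by (subst (asm) ennreal_le_iff) auto
    then show ?thesis using eq by (simp add: M_def)
  qed
  define s where "s n = inverse (real (Suc n))" for n
  have s0: "0 < s n" for n by (simp add: s_def)
  have slim: "filterlim s (at_right 0) sequentially"
    unfolding filterlim_at using LIMSEQ_inverse_real_of_nat
    by (auto simp: s_def[abs_def] intro!: always_eventually)
  have "(\<lambda>n. LBINT x. G (mollify (s n) m x) \<bullet> P x) \<longlonglongrightarrow> 0"
  proof (rule LIMSEQ_I)
    fix r :: real assume "r > 0"
    define \<eta> where "\<eta> = r / (2 * (L * C + 1))"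
    have LC: "0 \<le> L * C" using L C by simp
    have cancel: "Z * (2 * (r / (2 * Z))) = r" if "Z > 0" for Z :: real using that by simp
    then have \<eta>: "\<eta> > 0" unfolding \<eta>_def using \<open>r > 0\<close> LC by (intro divide_pos_pos mult_pos_pos add_nonneg_pos) auto
    let ?J = "\<lambda>e h. \<integral>\<^sup>+x. indicator K x * ennreal ((1 - mollify e m x \<bullet> mollify e m x) * norm (dmollify e m x h)) \<partial>lborel"
    have ex: "\<exists>d>0. \<forall>e. 0 < e \<and> e < d \<longrightarrow> ?J e h \<le> ennreal \<eta>" if "norm h = 1" for h
      by (rule commutator_vanishes[OF m unit that Kb vK \<eta>]) blast
    obtain d1 where d1: "d1 > 0" "\<And>e. 0 < e \<Longrightarrow> e < d1 \<Longrightarrow> ?J e (axis 1 1) \<le> ennreal \<eta>"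
      using ex[of "axis 1 1"] by auto
    obtain d2 where d2: "d2 > 0" "\<And>e. 0 < e \<Longrightarrow> e < d2 \<Longrightarrow> ?J e (axis 2 1) \<le> ennreal \<eta>"
      using ex[of "axis 2 1"] by auto
    have "eventually (\<lambda>n. s n < min (\<delta>1 / 2) (min d1 d2)) sequentially"
      using order_tendstoD(2)[OF LIMSEQ_inverse_real_of_nat, of "min (\<delta>1 / 2) (min d1 d2)"] \<delta>1(1) d1(1) d2(1)
      by (simp add: s_def)
    then obtain N where N: "\<And>n. n \<ge> N \<Longrightarrow> s n < min (\<delta>1 / 2) (min d1 d2)"
      unfolding eventually_sequentially by blast
    have "norm ((LBINT x. G (mollify (s n) m x) \<bullet> P x) - 0) < r" if "n \<ge> N" for n
    proof -
      have "\<bar>LBINT x. G (mollify (s n) m x) \<bullet> P x\<bar> \<le> L * C * (2 * \<eta>)"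
        by (rule est[OF s0 _ \<eta>]) (use N[OF that] d1(2)[OF s0[of n]] d2(2)[OF s0[of n]] in auto)
      also have "\<dots> < (L * C + 1) * (2 * \<eta>)" using \<eta> by (simp add: distrib_right)
      also have "\<dots> = r" unfolding \<eta>_def using LC by (intro cancel) simp
      finally show ?thesis by simp
    qed
    then show "\<exists>N. \<forall>n\<ge>N. norm ((LBINT x. G (mollify (s n) m x) \<bullet> P x) - 0) < r" by blast
  qed
  moreover have "(\<lambda>n. LBINT x. G (mollify (s n) m x) \<bullet> P x) \<longlonglongrightarrow> (LBINT x. G (m x) \<bullet> P x)"
  proof (rule integral_dominated_convergence[where w="\<lambda>x. MG * L * indicator (cbox a c) x"])
    have [measurable]: "mollify (s n) m \<in> borel_measurable borel" for n
      by (rule borel_measurable_continuous_onI) (rule mollify_continuous[OF s0 m b])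
    show "(\<lambda>x. G (mollify (s n) m x) \<bullet> P x) \<in> borel_measurable lborel" for n by measurable
    show "integrable lborel (\<lambda>x. MG * L * indicator (cbox a c) x)"
      by (intro integrable_mult_right integrable_real_indicator emeasure_lborel_cbox_finite) simp
    obtain N where N: "N \<in> null_sets lebesgue" "- N \<subseteq> approx_points m"
      by (rule approx_points_full[OF m unit])
    have "AE x in lebesgue. (\<lambda>n. G (mollify (s n) m x) \<bullet> P x) \<longlonglongrightarrow> G (m x) \<bullet> P x"
    proof (rule AE_I'[OF N(1)], clarify)
      fix x assume nl: "\<not> (\<lambda>n. G (mollify (s n) m x) \<bullet> P x) \<longlonglongrightarrow> G (m x) \<bullet> P x"
      show "x \<in> N"
      proof (rule ccontr)
        assume "x \<notin> N"
        then have "x \<in> approx_points m" using N(2) by blast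
        from filterlim_compose[OF mollify_tendsto[OF m unit this] slim]
        have lim: "(\<lambda>n. mollify (s n) m x) \<longlonglongrightarrow> m x" .
        have "isCont G (m x)" by (rule has_derivative_continuous[OF G])
        from isCont_tendsto_compose[OF this lim]
        have "(\<lambda>n. G (mollify (s n) m x)) \<longlonglongrightarrow> G (m x)" .
        then have "(\<lambda>n. G (mollify (s n) m x) \<bullet> P x) \<longlonglongrightarrow> G (m x) \<bullet> P x"
          by (intro tendsto_inner tendsto_const)
        then show False using nl by simp
      qed
    qed
    then show "AE x in lborel. (\<lambda>n. G (mollify (s n) m x) \<bullet> P x) \<longlonglongrightarrow> G (m x) \<bullet> P x"
      by (simp add: AE_completion_iff)
    have bd: "norm (G (mollify (s n) m x) \<bullet> P x) \<le> MG * L * indicator (cbox a c) x" for n x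
    proof (cases "x \<in> K")
      case True
      have "norm (G (mollify (s n) m x) \<bullet> P x) \<le> MG * L"
        unfolding real_norm_def using GM[OF norm_mollify_le[OF s0 m b]] L(2) MG0
        by (intro order_trans[OF Cauchy_Schwarz_ineq2] mult_mono) auto
      then show ?thesis using True box by (auto simp: indicator_def)
    qed (use z MG0 L in auto)
    then show "AE x in lborel. norm (G (mollify (s n) m x) \<bullet> P x) \<le> MG * L * indicator (cbox a c) x" for n
      by simp
  qed measurable
  ultimately have "(LBINT x. G (m x) \<bullet> P x) = 0" by (rule LIMSEQ_unique[symmetric])
  then show "(LBINT x. \<Phi> (m x) \<bullet> gradient \<phi> x) = 0" by (simp add: GmPhi grad)
qed

section \<open>Transport of signs and the structure of zero-energy states\<close>

lemma rot_measurable [measurable]: "rot \<in> borel_measurable borel"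
  by (intro borel_measurable_continuous_onI continuous_on_rot continuous_on_id)

text \<open>The kinetic equation \<open>\<xi> \<bullet> \<nabla> sgn (m \<bullet> \<xi>) = 0\<close>, as the limit of the equations for smooth entropies.\<close>

lemma sign_transport:
  fixes m :: "real^2 \<Rightarrow> real^2"
  assumes m [measurable]: "m \<in> borel_measurable borel" and unit: "\<And>z. norm (m z) = 1"
    and ent: "\<And>\<Phi>. \<Phi> \<in> ENT \<Longrightarrow> weakly_div_free \<Omega> (\<lambda>x. \<Phi> (m x))" and \<xi>: "norm \<xi> = 1"
  shows "weakly_div_free \<Omega> (\<lambda>x. sgn (m x \<bullet> \<xi>) *\<^sub>R \<xi>)"
  unfolding weakly_div_free_def
proof
  fix \<phi> assume \<phi>: "\<phi> \<in> test_functions \<Omega>"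
  then obtain K P L where K: "compact K" and P: "continuous_on UNIV P"
    and z: "\<And>x. x \<notin> K \<Longrightarrow> P x = 0" and grad: "gradient \<phi> = P"
    and L: "0 \<le> L" "\<And>x. norm (P x) \<le> L"
    by (rule test_function_gradient) blast
  obtain c where "K \<subseteq> cbox (- c) c"
    by (rule bounded_subset_cbox_symmetric[OF compact_imp_bounded[OF K(1)]])
  then obtain a where box: "K \<subseteq> cbox a c" by blast
  have [measurable]: "P \<in> borel_measurable borel" using P by (rule borel_measurable_continuous_onI)
  define s where "s n = inverse (real (Suc n))" for n
  have s: "0 < s n" "s n \<le> 1" for n by (auto simp: s_def inverse_le_1_iff)
  have "(\<lambda>n. LBINT x. sign_entropy (s n) \<xi> (m x) \<bullet> P x) \<longlonglongrightarrow> (LBINT x. (sgn (m x \<bullet> \<xi>) *\<^sub>R \<xi>) \<bullet> P x)"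
  proof (rule integral_dominated_convergence[where w="\<lambda>x. 3 * L * indicator (cbox a c) x"])
    show "(\<lambda>x. sign_entropy (s n) \<xi> (m x) \<bullet> P x) \<in> borel_measurable lborel" for n
      unfolding sign_entropy_def by measurable
    show "integrable lborel (\<lambda>x. 3 * L * indicator (cbox a c) x)"
      by (intro integrable_mult_right integrable_real_indicator emeasure_lborel_cbox_finite) simp
    have "(\<lambda>n. sign_entropy (s n) \<xi> (m x) \<bullet> P x) \<longlonglongrightarrow> (sgn (m x \<bullet> \<xi>) *\<^sub>R \<xi>) \<bullet> P x" for x
      using sign_entropy_limit[OF unit[of x], of \<xi>] unfolding s_def by (intro tendsto_inner tendsto_const)
    then show "AE x in lborel. (\<lambda>n. sign_entropy (s n) \<xi> (m x) \<bullet> P x) \<longlonglongrightarrow> (sgn (m x \<bullet> \<xi>) *\<^sub>R \<xi>) \<bullet> P x"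
      by simp
    have "norm (sign_entropy (s n) \<xi> (m x) \<bullet> P x) \<le> 3 * L * indicator (cbox a c) x" for n x
    proof (cases "x \<in> K")
      case True
      have "norm (sign_entropy (s n) \<xi> (m x) \<bullet> P x) \<le> 3 * L"
        unfolding real_norm_def using sign_entropy_bound[OF unit \<xi> s] L(2)
        by (intro order_trans[OF Cauchy_Schwarz_ineq2] mult_mono) auto
      moreover have "x \<in> cbox a c" using True box by blast
      ultimately show ?thesis by simp
    next
      case False
      then show ?thesis using z[OF False] L(1) by simp
    qed
    then show "AE x in lborel. norm (sign_entropy (s n) \<xi> (m x) \<bullet> P x) \<le> 3 * L * indicator (cbox a c) x" for n
      by simp
  qed measurable
  moreover have "(LBINT x. sign_entropy (s n) \<xi> (m x) \<bullet> P x) = 0" for n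
    using ent[OF sign_entropy_in_ENT[OF s(1) \<xi>]] \<phi> unfolding weakly_div_free_def grad[symmetric] by blast
  ultimately show "(LBINT x. (sgn (m x \<bullet> \<xi>) *\<^sub>R \<xi>) \<bullet> gradient \<phi> x) = 0"
    by (simp add: LIMSEQ_const_iff grad)
qed

lemma mollify_constant_along_transport:
  fixes \<theta> :: "real^2 \<Rightarrow> real"
  assumes e: "e > 0" and \<theta>: "\<theta> \<in> borel_measurable borel" "\<And>z. norm (\<theta> z) \<le> 1"
    and tr: "weakly_div_free \<Omega> (\<lambda>x. \<theta> x *\<^sub>R \<xi>)"
    and T: "0 \<le> T" "\<And>t. 0 \<le> t \<Longrightarrow> t \<le> T \<Longrightarrow> cbox (x + t *\<^sub>R \<xi>) (x + t *\<^sub>R \<xi> + e *\<^sub>R One) \<subseteq> \<Omega>"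
  shows "mollify e \<theta> (x + T *\<^sub>R \<xi>) = mollify e \<theta> x"
proof -
  have "((\<lambda>t. mollify e \<theta> (x + t *\<^sub>R \<xi>)) has_derivative (\<lambda>h. 0)) (at t within {0..T})" if t: "t \<in> {0..T}" for t
  proof -
    let ?y = "x + t *\<^sub>R \<xi>"
    have sub: "cbox ?y (?y + e *\<^sub>R One) \<subseteq> \<Omega>" using T(2) t by simp
    have "(LBINT z. (\<theta> z *\<^sub>R \<xi>) \<bullet> gradient (\<lambda>z. kern e (z - ?y)) z) = 0"
      using tr kern_test_function(1)[OF e sub] unfolding weakly_div_free_def by blast
    then have zero: "(LBINT z. (kern_grad e (z - ?y) \<bullet> \<xi>) *\<^sub>R \<theta> z) = 0"
      unfolding kern_test_function(2)[OF e sub] by (simp add: inner_commute mult.commute)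
    have "((\<lambda>t. x + t *\<^sub>R \<xi>) has_derivative (\<lambda>h. h *\<^sub>R \<xi>)) (at t)"
      by (auto intro!: derivative_eq_intros)
    from diff_chain_at[OF this mollify_has_derivative[OF e \<theta>]]
    have "((\<lambda>t. mollify e \<theta> (x + t *\<^sub>R \<xi>)) has_derivative
        (\<lambda>h. - (LBINT z. (kern_grad e (z - ?y) \<bullet> (h *\<^sub>R \<xi>)) *\<^sub>R \<theta> z))) (at t)"
      by (simp add: o_def)
    moreover have "(LBINT z. (kern_grad e (z - ?y) \<bullet> (h *\<^sub>R \<xi>)) *\<^sub>R \<theta> z) = 0" for h
    proof -
      have "(LBINT z. (kern_grad e (z - ?y) \<bullet> (h *\<^sub>R \<xi>)) *\<^sub>R \<theta> z)
          = (LBINT z. h *\<^sub>R ((kern_grad e (z - ?y) \<bullet> \<xi>) *\<^sub>R \<theta> z))"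
        by (simp only: inner_scaleR_right scaleR_scaleR)
      also have "\<dots> = h *\<^sub>R (LBINT z. (kern_grad e (z - ?y) \<bullet> \<xi>) *\<^sub>R \<theta> z)"
        by (rule integral_scaleR_right)
      finally show ?thesis unfolding zero by simp
    qed
    ultimately show ?thesis by (simp add: has_derivative_at_withinI)
  qed
  then obtain c where c: "\<And>t. t \<in> {0..T} \<Longrightarrow> mollify e \<theta> (x + t *\<^sub>R \<xi>) = c"
    using has_derivative_zero_constant[OF convex_real_interval(5), of 0 T "\<lambda>t. mollify e \<theta> (x + t *\<^sub>R \<xi>)"] by blast
  show ?thesis using c[of 0] c[of T] T(1) by simp
qed

text \<open>Where the sign of \<open>m \<bullet> \<xi>\<close> differs from that at \<open>x\<close>, the field is at distance at least
  \<open>\<bar>m x \<bullet> \<xi>\<bar>\<close> from \<open>m x\<close>, so the averages of the sign are controlled by those of \<open>1 - m \<bullet> m x\<close>.\<close>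

lemma mollify_sign_tendsto:
  fixes m :: "real^2 \<Rightarrow> real^2"
  assumes m [measurable]: "m \<in> borel_measurable borel" and unit: "\<And>z. norm (m z) = 1"
    and x: "x \<in> approx_points m" and \<xi>: "norm \<xi> = 1" and nz: "m x \<bullet> \<xi> \<noteq> 0"
  shows "((\<lambda>e. mollify e (\<lambda>z. sgn (m z \<bullet> \<xi>)) x) \<longlongrightarrow> sgn (m x \<bullet> \<xi>)) (at_right 0)"
proof -
  define \<theta> where "\<theta> z = sgn (m z \<bullet> \<xi>)" for z
  define s where "s = \<bar>m x \<bullet> \<xi>\<bar>"
  have s: "s > 0" using nz by (simp add: s_def)
  have [measurable]: "\<theta> \<in> borel_measurable borel" unfolding \<theta>_def[abs_def] sgn_if by measurable
  have \<theta>1: "norm (\<theta> z) \<le> 1" for z by (simp add: \<theta>_def sgn_if)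
  let ?E = "\<lambda>e. LBINT z. kern e (z - x) * (1 - m z \<bullet> m x)"
  have pt: "\<bar>\<theta> z - \<theta> x\<bar> \<le> 4 / s\<^sup>2 * (1 - m z \<bullet> m x)" for z
  proof (cases "\<theta> z = \<theta> x")
    case True
    have "0 \<le> 4 / s\<^sup>2 * (1 - m z \<bullet> m x)"
      by (intro mult_nonneg_nonneg) (simp_all add: unit_inner_le unit)
    then show ?thesis using True by simp
  next
    case False
    have "s \<le> \<bar>(m z - m x) \<bullet> \<xi>\<bar>"
      using False nz unfolding \<theta>_def s_def sgn_if inner_diff_left by (auto split: if_splits)
    also have "\<dots> \<le> norm (m z - m x)" using Cauchy_Schwarz_ineq2[of "m z - m x" \<xi>] \<xi> by simp
    finally have "s\<^sup>2 \<le> (norm (m z - m x))\<^sup>2" using s by (intro power_mono) auto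
    also have "\<dots> = 2 * (1 - m z \<bullet> m x)" using dot_norm_neg[of "m z" "m x"] by (simp add: unit)
    finally have "s\<^sup>2 / 2 \<le> 1 - m z \<bullet> m x" by simp
    then have "4 / s\<^sup>2 * (s\<^sup>2 / 2) \<le> 4 / s\<^sup>2 * (1 - m z \<bullet> m x)" by (rule mult_left_mono) simp
    then have "2 \<le> 4 / s\<^sup>2 * (1 - m z \<bullet> m x)" using s by simp
    moreover have "\<bar>\<theta> z - \<theta> x\<bar> \<le> 2" using \<theta>1[of z] \<theta>1[of x] by simp
    ultimately show ?thesis by (rule order_trans[rotated])
  qed
  have bd: "norm (mollify e \<theta> x - \<theta> x) \<le> 4 / s\<^sup>2 * ?E e" if e: "0 < e" for e
  proof -
    have k: "integrable lborel (\<lambda>z. kern e (z - x) *\<^sub>R \<theta> z)"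
      by (rule kern_weighted_integrable[OF e _ \<theta>1]) measurable
    have k1: "integrable lborel (\<lambda>z. kern e (z - x) *\<^sub>R \<theta> x)"
      by (rule kern_weighted_integrable[OF e _ \<theta>1]) measurable
    have "(LBINT z. kern e (z - x) *\<^sub>R \<theta> x) = \<theta> x" by (simp add: kern_shift_integral[OF e])
    then have "mollify e \<theta> x - \<theta> x = (LBINT z. kern e (z - x) *\<^sub>R \<theta> z - kern e (z - x) *\<^sub>R \<theta> x)"
      unfolding mollify_def using Bochner_Integration.integral_diff[OF k k1] by simp
    then have "norm (mollify e \<theta> x - \<theta> x) \<le> (LBINT z. norm (kern e (z - x) *\<^sub>R \<theta> z - kern e (z - x) *\<^sub>R \<theta> x))"
      by (simp only: integral_norm_bound)
    also have "\<dots> \<le> (LBINT z. 4 / s\<^sup>2 * (kern e (z - x) * (1 - m z \<bullet> m x)))"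
    proof (rule integral_mono)
      show "integrable lborel (\<lambda>z. norm (kern e (z - x) *\<^sub>R \<theta> z - kern e (z - x) *\<^sub>R \<theta> x))"
        by (intro integrable_norm Bochner_Integration.integrable_diff k k1)
      show "integrable lborel (\<lambda>z. 4 / s\<^sup>2 * (kern e (z - x) * (1 - m z \<bullet> m x)))"
        by (intro integrable_mult_right kern_excess_integrable e m unit)
      fix z
      have "norm (kern e (z - x) *\<^sub>R \<theta> z - kern e (z - x) *\<^sub>R \<theta> x) = kern e (z - x) * \<bar>\<theta> z - \<theta> x\<bar>"
        unfolding scaleR_diff_right[symmetric] norm_scaleR real_norm_def using kern_nonneg[of e "z - x"] by (simp add: abs_mult)
      also have "\<dots> \<le> kern e (z - x) * (4 / s\<^sup>2 * (1 - m z \<bullet> m x))"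
        by (intro mult_left_mono pt kern_nonneg)
      finally show "norm (kern e (z - x) *\<^sub>R \<theta> z - kern e (z - x) *\<^sub>R \<theta> x)
          \<le> 4 / s\<^sup>2 * (kern e (z - x) * (1 - m z \<bullet> m x))" by (simp only: mult.left_commute)
    qed
    finally show ?thesis by simp
  qed
  have "((\<lambda>e. 4 / s\<^sup>2 * ?E e) \<longlongrightarrow> 4 / s\<^sup>2 * 0) (at_right 0)"
    using x unfolding approx_points_def by (intro tendsto_mult tendsto_const) simp
  then have lim0: "((\<lambda>e. 4 / s\<^sup>2 * ?E e) \<longlongrightarrow> 0) (at_right 0)" by simp
  have "\<forall>\<^sub>F e in at_right 0. norm (mollify e \<theta> x - \<theta> x) \<le> 4 / s\<^sup>2 * ?E e"
    unfolding eventually_at_right_field by (intro exI[of _ 1]) (use bd in auto)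
  from Lim_null_comparison[OF this lim0] have "((\<lambda>e. mollify e \<theta> x) \<longlongrightarrow> \<theta> x) (at_right 0)"
    by (rule LIM_zero_cancel)
  then show ?thesis by (simp add: \<theta>_def[abs_def])
qed

text \<open>The averages of \<open>sgn (m \<bullet> \<xi>)\<close> around \<open>x\<close> and \<open>y\<close> agree when \<open>\<xi>\<close> is the direction of the chord, and they
  converge to the signs at the two points. The doubled radius keeps the squares used for averaging
  inside \<open>\<Omega>\<close>.\<close>

lemma approx_points_sign_compatible:
  fixes m :: "real^2 \<Rightarrow> real^2"
  assumes m [measurable]: "m \<in> borel_measurable borel" and unit: "\<And>z. norm (m z) = 1"
    and ent: "\<And>\<Phi>. \<Phi> \<in> ENT \<Longrightarrow> weakly_div_free \<Omega> (\<lambda>x. \<Phi> (m x))"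
    and r: "r > 0" "ball a (2 * r) \<subseteq> \<Omega>"
  shows "sign_compatible (approx_points m \<inter> ball a r) m"
  unfolding sign_compatible_def
proof (intro ballI)
  fix x y assume x: "x \<in> approx_points m \<inter> ball a r" and y: "y \<in> approx_points m \<inter> ball a r"
  show "0 \<le> (m x \<bullet> (y - x)) * (m y \<bullet> (y - x))"
  proof (rule ccontr)
    assume neg: "\<not> ?thesis"
    define T where "T = norm (y - x)"
    have T: "T > 0" using neg by (auto simp: T_def)
    define \<xi> where "\<xi> = (1 / T) *\<^sub>R (y - x)"
    have \<xi>: "norm \<xi> = 1" using T by (simp add: \<xi>_def T_def)
    have yx: "y = x + T *\<^sub>R \<xi>" using T by (simp add: \<xi>_def)
    have yx': "y - x = T *\<^sub>R \<xi>" using yx by simp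
    have "(m x \<bullet> (y - x)) * (m y \<bullet> (y - x)) = T\<^sup>2 * ((m x \<bullet> \<xi>) * (m y \<bullet> \<xi>))"
      unfolding yx' by (simp add: power2_eq_square)
    then have "(m x \<bullet> \<xi>) * (m y \<bullet> \<xi>) < 0" using neg T by (simp add: not_le mult_less_0_iff)
    then have nz: "m x \<bullet> \<xi> \<noteq> 0" "m y \<bullet> \<xi> \<noteq> 0" and sg: "sgn (m x \<bullet> \<xi>) \<noteq> sgn (m y \<bullet> \<xi>)"
      by (auto simp: mult_less_0_iff)
    let ?\<theta> = "\<lambda>z. sgn (m z \<bullet> \<xi>)"
    have \<theta>: "?\<theta> \<in> borel_measurable borel" unfolding sgn_if by measurable
    have \<theta>1: "norm (?\<theta> z) \<le> 1" for z by (simp add: sgn_if)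
    have tr: "weakly_div_free \<Omega> (\<lambda>x. ?\<theta> x *\<^sub>R \<xi>)" by (rule sign_transport[OF m unit ent \<xi>])
    have eq: "mollify e ?\<theta> y = mollify e ?\<theta> x" if e: "0 < e" "e < r / 2" for e
      unfolding yx
    proof (rule mollify_constant_along_transport[OF e(1) \<theta> \<theta>1 tr])
      fix t assume t: "0 \<le> t" "t \<le> T"
      have "(1 - t / T) *\<^sub>R x + (t / T) *\<^sub>R y \<in> ball a r"
        using x y t T convex_ball[of a r] by (auto simp: convex_alt)
      moreover have "(1 - t / T) *\<^sub>R x + (t / T) *\<^sub>R y = x + t *\<^sub>R \<xi>"
        using T by (simp add: \<xi>_def algebra_simps)
      ultimately have p: "x + t *\<^sub>R \<xi> \<in> ball a r" by simp
      have "cbox (x + t *\<^sub>R \<xi>) (x + t *\<^sub>R \<xi> + e *\<^sub>R One) \<subseteq> ball (x + t *\<^sub>R \<xi>) r"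
        by (rule cbox_subset_ball) (use e in simp)
      also have "\<dots> \<subseteq> ball a (2 * r)"
      proof
        fix w assume "w \<in> ball (x + t *\<^sub>R \<xi>) r"
        then show "w \<in> ball a (2 * r)" using p dist_triangle[of a w "x + t *\<^sub>R \<xi>"] by simp
      qed
      finally show "cbox (x + t *\<^sub>R \<xi>) (x + t *\<^sub>R \<xi> + e *\<^sub>R One) \<subseteq> \<Omega>" using r(2) by blast
    qed (use T in simp)
    have lx: "((\<lambda>e. mollify e ?\<theta> x) \<longlongrightarrow> ?\<theta> x) (at_right 0)"
      by (rule mollify_sign_tendsto[OF m unit _ \<xi> nz(1)]) (use x in simp)
    have ly: "((\<lambda>e. mollify e ?\<theta> y) \<longlongrightarrow> ?\<theta> y) (at_right 0)"
      by (rule mollify_sign_tendsto[OF m unit _ \<xi> nz(2)]) (use y in simp)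
    have "\<forall>\<^sub>F e in at_right 0. mollify e ?\<theta> y = mollify e ?\<theta> x"
      unfolding eventually_at_right_field by (intro exI[of _ "r / 2"]) (use eq r(1) in auto)
    then have "((\<lambda>e. mollify e ?\<theta> x) \<longlongrightarrow> ?\<theta> y) (at_right 0)"
      using ly by (rule Lim_transform_eventually[rotated])
    then have "?\<theta> x = ?\<theta> y" using lx tendsto_unique[OF trivial_limit_at_right_real] by blast
    then show False using sg by simp
  qed
qed

lemma approx_points_dense:
  fixes m :: "real^2 \<Rightarrow> real^2"
  assumes "m \<in> borel_measurable borel" "\<And>z. norm (m z) = 1" "open B"
  shows "B \<subseteq> closure (approx_points m \<inter> B)"
proof -
  obtain N where N: "N \<in> null_sets lebesgue" "- N \<subseteq> approx_points m"
    by (rule approx_points_full[OF assms(1,2)])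
  have "negligible (- approx_points m)"
    by (rule negligible_subset[of N]) (use N in \<open>auto simp: negligible_iff_null_sets\<close>)
  have "closure (approx_points m) = UNIV"
  proof (rule ccontr)
    assume "closure (approx_points m) \<noteq> UNIV"
    then have "- closure (approx_points m) \<noteq> {}" by auto
    moreover have "open (- closure (approx_points m))" by auto
    ultimately have "\<not> negligible (- closure (approx_points m))" using open_not_negligible by blast
    moreover have "- closure (approx_points m) \<subseteq> - approx_points m" using closure_subset by blast
    ultimately show False using \<open>negligible (- approx_points m)\<close> negligible_subset by blast
  qed
  then show ?thesis using open_Int_closure_subset[OF assms(3), of "approx_points m"] by (simp add: Int_commute)
qed

text \<open>Local Lipschitz extensions of a function on a dense set agree, because all of them are limits
  of its values.\<close>

lemma locally_lipschitz_extension: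
  fixes m :: "real^2 \<Rightarrow> real^2"
  assumes dense: "V \<subseteq> closure A" and "open V"
    and loc: "\<And>x. x \<in> V \<Longrightarrow> \<exists>s>0. \<exists>L. L-lipschitz_on (ball x s \<inter> A) m"
  obtains n where "\<And>x. x \<in> A \<Longrightarrow> n x = m x"
    "\<And>x. x \<in> V \<Longrightarrow> \<exists>s>0. \<exists>L. L-lipschitz_on (ball x s) n"
proof -
  define n where "n x = (if x \<in> A then m x else Lim (at x within A) m)" for x
  have "\<exists>s>0. \<exists>L. L-lipschitz_on (ball x s) n" if x: "x \<in> V" for x
  proof -
    obtain s L where s: "s > 0" "L-lipschitz_on (ball x s \<inter> A) m" using loc[OF x] by blast
    obtain e where e: "e > 0" "ball x e \<subseteq> V" using openE[OF \<open>open V\<close> x] by metis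
    define d where "d = min s e"
    have d: "d > 0" "ball x d \<subseteq> V" "d \<le> s" using s e by (auto simp: d_def)
    have "L-lipschitz_on (ball x d \<inter> A) m" by (rule lipschitz_on_subset[OF s(2)]) (use d(3) in auto)
    then obtain g where g: "L-lipschitz_on (closure (ball x d \<inter> A)) g" "\<forall>y\<in>ball x d \<inter> A. g y = m y"
      using lipschitz_extend_closure by blast
    have sub: "ball x d \<subseteq> closure (ball x d \<inter> A)"
      using open_Int_closure_subset[OF open_ball, of x d A] d(2) dense by blast
    have "n y = g y" if y: "y \<in> ball x d" for y
    proof (cases "y \<in> A")
      case False
      have cont: "continuous_on (closure (ball x d \<inter> A)) g" by (rule lipschitz_on_continuous_on[OF g(1)])
      have "(g \<longlongrightarrow> g y) (at y within closure (ball x d \<inter> A))"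
        using cont sub y unfolding continuous_on_def by blast
      then have "(g \<longlongrightarrow> g y) (at y within ball x d \<inter> A)"
        by (rule tendsto_within_subset) (rule closure_subset)
      then have "(m \<longlongrightarrow> g y) (at y within ball x d \<inter> A)"
        by (rule Lim_transform_within[OF _ zero_less_one]) (use g(2) in auto)
      moreover have "at y within ball x d \<inter> A = at y within A"
        by (rule at_within_nhd[OF y open_ball]) auto
      ultimately have lim: "(m \<longlongrightarrow> g y) (at y within A)" by simp
      have "y \<in> closure A" using y d(2) dense by blast
      then have "y islimpt A" using False by (auto simp: closure_def)
      then have "\<not> trivial_limit (at y within A)" by (simp add: trivial_limit_within)
      then have "Lim (at y within A) m = g y" using lim tendsto_Lim by blast
      then show ?thesis using False by (simp add: n_def)
    qed (use g(2) y in \<open>simp add: n_def\<close>)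
    moreover have "L-lipschitz_on (ball x d) g" by (rule lipschitz_on_subset[OF g(1) sub])
    ultimately have "L-lipschitz_on (ball x d) n" using lipschitz_on_transform by metis
    then show ?thesis using d(1) by blast
  qed
  then show ?thesis using that[of n] by (simp add: n_def)
qed

text \<open>Singular points are those where \<open>m\<close> has no Lipschitz restriction to the approximate continuity
  points nearby. A small ball contains at most one of them.\<close>

theorem zero_energy_structure:
  fixes m :: "real^2 \<Rightarrow> real^2"
  assumes "open \<Omega>" and m: "m \<in> borel_measurable borel" and unit: "\<And>z. norm (m z) = 1"
    and ent: "\<And>\<Phi>. \<Phi> \<in> ENT \<Longrightarrow> weakly_div_free \<Omega> (\<lambda>x. \<Phi> (m x))"
  obtains S n where "locally_finite_subset S \<Omega>" "open (\<Omega> - S)"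
    "\<And>x. x \<in> approx_points m \<Longrightarrow> n x = m x"
    "\<And>x. x \<in> \<Omega> - S \<Longrightarrow> \<exists>s>0. \<exists>L. L-lipschitz_on (ball x s) n"
proof -
  define A where "A = approx_points m"
  define good where "good x \<longleftrightarrow> (\<exists>s>0. \<exists>L. L-lipschitz_on (ball x s \<inter> A) m)" for x
  define S where "S = {x\<in>\<Omega>. \<not> good x}"
  have one: "\<exists>p r. r > 0 \<and> S \<inter> ball a r \<subseteq> {p}" if a: "a \<in> \<Omega>" for a
  proof -
    obtain e where e: "e > 0" "ball a e \<subseteq> \<Omega>" using openE[OF \<open>open \<Omega>\<close> a] by metis
    define r where "r = e / 2"
    have r: "r > 0" "ball a (2 * r) \<subseteq> \<Omega>" using e by (simp_all add: r_def)
    have comp: "sign_compatible (A \<inter> ball a r) m"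
      unfolding A_def by (rule approx_points_sign_compatible[OF m unit ent r])
    have dense: "ball a r \<subseteq> closure (A \<inter> ball a r)"
      unfolding A_def by (rule approx_points_dense[OF m unit open_ball])
    obtain p where p: "\<And>x. x \<in> ball a r \<Longrightarrow> x \<noteq> p \<Longrightarrow> \<exists>s>0. \<exists>L. L-lipschitz_on (ball x s \<inter> (A \<inter> ball a r)) m"
      using sign_compatible_regularity[OF unit comp dense open_ball] by metis
    have "good x" if x: "x \<in> ball a r" "x \<noteq> p" for x
    proof -
      obtain s L where s: "s > 0" "L-lipschitz_on (ball x s \<inter> (A \<inter> ball a r)) m" using p[OF x] by blast
      obtain d where d: "d > 0" "ball x d \<subseteq> ball a r" using openE[OF open_ball x(1)] by metis
      have "ball x (min s d) \<inter> A \<subseteq> ball x s \<inter> (A \<inter> ball a r)" using d(2) by auto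
      then have "L-lipschitz_on (ball x (min s d) \<inter> A) m" by (rule lipschitz_on_subset[OF s(2)])
      moreover have "min s d > 0" using s(1) d(1) by simp
      ultimately show ?thesis unfolding good_def by blast
    qed
    then have "S \<inter> ball a r \<subseteq> {p}" unfolding S_def by blast
    then show ?thesis using r(1) by blast
  qed
  have lf: "locally_finite_subset S \<Omega>"
    unfolding locally_finite_subset_def
  proof (intro conjI ballI)
    show "S \<subseteq> \<Omega>" by (auto simp: S_def)
    fix a assume "a \<in> \<Omega>"
    then obtain p r where "r > 0" "S \<inter> ball a r \<subseteq> {p}" using one by blast
    then show "\<exists>e>0. finite (S \<inter> ball a e)" using finite_subset by blast
  qed
  have op: "open (\<Omega> - S)"
    unfolding open_contains_ball
  proof
    fix x assume x: "x \<in> \<Omega> - S"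
    then obtain s L where s: "s > 0" "L-lipschitz_on (ball x s \<inter> A) m" by (auto simp: S_def good_def)
    obtain e where e: "e > 0" "ball x e \<subseteq> \<Omega>" using openE[OF \<open>open \<Omega>\<close>, of x] x by blast
    have "good y" if y: "y \<in> ball x s" for y
    proof -
      obtain d where d: "d > 0" "ball y d \<subseteq> ball x s" using openE[OF open_ball y] by metis
      then have "ball y d \<inter> A \<subseteq> ball x s \<inter> A" by blast
      then have "L-lipschitz_on (ball y d \<inter> A) m" by (rule lipschitz_on_subset[OF s(2)])
      then show ?thesis using d(1) unfolding good_def by blast
    qed
    then have "ball x (min s e) \<subseteq> \<Omega> - S" using e(2) by (auto simp: S_def)
    moreover have "min s e > 0" using s(1) e(1) by simp
    ultimately show "\<exists>e>0. ball x e \<subseteq> \<Omega> - S" by blast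
  qed
  have "\<Omega> - S \<subseteq> closure A"
    using approx_points_dense[OF m unit open_UNIV] by (auto simp: A_def)
  moreover have "\<exists>s>0. \<exists>L. L-lipschitz_on (ball x s \<inter> A) m" if "x \<in> \<Omega> - S" for x
    using that by (auto simp: S_def good_def)
  ultimately obtain n where n: "\<And>x. x \<in> A \<Longrightarrow> n x = m x"
    "\<And>x. x \<in> \<Omega> - S \<Longrightarrow> \<exists>s>0. \<exists>L. L-lipschitz_on (ball x s) n"
    using locally_lipschitz_extension[of "\<Omega> - S" A m] op by metis
  show ?thesis by (rule that[OF lf op n(1)[unfolded A_def] n(2)])
qed

section \<open>Borel representatives and Besov increments\<close>

lemma component_measurable: "(\<lambda>y::real^2. y $ i) \<in> borel_measurable borel"
  by (intro borel_measurable_continuous_onI continuous_intros)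

lemma epowr_less:
  assumes "0 < t" "0 < c" "0 < a" "ennreal (t powr (- a)) * epowr I a < ennreal c"
  shows "I \<le> ennreal (c powr (1/a) * t)"
proof (cases "I = \<infinity>")
  case True
  then show ?thesis using assms by (simp add: epowr_def ennreal_mult_top)
next
  case False
  define i where "i = enn2real I"
  have i: "I = ennreal i" "0 \<le> i" using False by (simp_all add: i_def less_top)
  have "ennreal (t powr (- a) * i powr a) < ennreal c"
    using assms(4) False by (simp add: epowr_def i_def ennreal_mult')
  then have "t powr (- a) * i powr a < c" using assms(2) by (simp add: ennreal_less_iff)
  then have "i powr a \<le> c * t powr a"
    using assms(1) by (simp add: powr_minus field_simps)
  then have "(i powr a) powr (1/a) \<le> (c * t powr a) powr (1/a)"
    using assms by (intro powr_mono2) auto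
  then have "i \<le> c powr (1/a) * t"
    using assms i by (simp add: powr_powr powr_mult)
  then show ?thesis unfolding i(1) by (rule ennreal_leI)
qed

lemma besov_N_modulus:
  assumes c: "0 < c" and N: "\<forall>\<^sub>F t in at_right 0. besov_N t f U < ennreal c"
  obtains \<delta> where "\<delta> > 0" "\<And>z. z \<noteq> 0 \<Longrightarrow> norm z < \<delta> \<Longrightarrow>
    (\<integral>\<^sup>+x. ennreal (\<bar>fin_diff U z f x\<bar>^3) \<partial>lebesgue_on U) \<le> ennreal (c^3 * norm z)"
proof -
  obtain \<delta> where \<delta>: "\<delta> > 0" "\<And>t. 0 < t \<Longrightarrow> t < \<delta> \<Longrightarrow> besov_N t f U < ennreal c"
    using N unfolding eventually_at_right_field by blast
  have "(\<integral>\<^sup>+x. ennreal (\<bar>fin_diff U z f x\<bar>^3) \<partial>lebesgue_on U) \<le> ennreal (c^3 * norm z)"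
    if z: "z \<noteq> 0" "norm z < \<delta>" for z
  proof -
    have "ennreal (norm z powr (-1/3)) * L3_norm U (fin_diff U z f) \<le> besov_N (norm z) f U"
      unfolding besov_N_def by (rule SUP_upper) simp
    also have "\<dots> < ennreal c" using z by (intro \<delta>(2)) auto
    finally have "ennreal (norm z powr (- (1/3))) * epowr (\<integral>\<^sup>+x. ennreal (\<bar>fin_diff U z f x\<bar>^3) \<partial>lebesgue_on U) (1/3) < ennreal c"
      by (simp add: L3_norm_def)
    from epowr_less[OF _ c _ this] z
    have "(\<integral>\<^sup>+x. ennreal (\<bar>fin_diff U z f x\<bar>^3) \<partial>lebesgue_on U) \<le> ennreal (c powr (1 / (1/3)) * norm z)" by simp
    also have "c powr (1 / (1/3)) = c^3" using c by simp
    finally show ?thesis .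
  qed
  then show ?thesis using that \<delta>(1) by blast
qed

lemma borel_unit_representative:
  fixes m :: "real^2 \<Rightarrow> real^2"
  assumes \<Omega>: "open \<Omega>" and m: "m \<in> borel_measurable (lebesgue_on \<Omega>)"
    and unit: "AE x in lebesgue_on \<Omega>. norm (m x) = 1"
  obtains m' where "m' \<in> borel_measurable borel" "\<And>x. norm (m' x) = 1"
    "AE x in lborel. x \<in> \<Omega> \<longrightarrow> m' x = m x"
proof -
  have \<Omega>m: "\<Omega> \<in> sets lebesgue" using \<Omega> by (simp add: borel_open)
  define u where "u x = (if x \<in> \<Omega> then m x else 0)" for x
  have u: "u \<in> borel_measurable lebesgue" unfolding u_def by (rule borel_measurable_if_I[OF m \<Omega>m])
  have "\<exists>g. g \<in> borel_measurable lborel \<and> (AE x in lborel. u x $ i = g x)" for i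
  proof -
    have "(\<lambda>x. u x $ i) \<in> borel_measurable lebesgue"
      using measurable_compose[OF u component_measurable] by simp
    then show ?thesis using completion_ex_borel_measurable_real by blast
  qed
  then obtain g where g: "\<And>i. g i \<in> borel_measurable lborel" "\<And>i. AE x in lborel. u x $ i = g i x" by metis
  have [measurable]: "g i \<in> borel_measurable borel" for i using g(1)[of i] by simp
  define v where "v x = g 1 x *\<^sub>R axis 1 1 + g 2 x *\<^sub>R (axis 2 1 :: real^2)" for x
  have [measurable]: "v \<in> borel_measurable borel" unfolding v_def[abs_def] by measurable
  define m' where "m' x = (if norm (v x) = 1 then v x else axis 1 1)" for x
  have m'm: "m' \<in> borel_measurable borel" unfolding m'_def[abs_def] by measurable
  have un: "norm (m' x) = 1" for x by (simp add: m'_def)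
  have "AE x in lebesgue. x \<in> \<Omega> \<longrightarrow> norm (m x) = 1"
    using unit AE_restrict_space_iff[of \<Omega> lebesgue "\<lambda>x. norm (m x) = 1"] \<Omega>m by simp
  then have "AE x in lborel. x \<in> \<Omega> \<longrightarrow> norm (m x) = 1" by (simp add: AE_completion_iff)
  with g(2)[of 1] g(2)[of 2] have "AE x in lborel. x \<in> \<Omega> \<longrightarrow> m' x = m x"
  proof eventually_elim
    case (elim x)
    have "v x = u x" using elim by (simp add: v_def plane_eq_iff axis_def)
    then show ?case using elim by (simp add: m'_def u_def)
  qed
  then show ?thesis using that m'm un by blast
qed

text \<open>The set \<open>\<Omega>\<close> may be dropped from the integral because test functions vanish outside it, and the
  completed measure makes every function measurable that agrees almost everywhere with a
  measurable one.\<close>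

lemma distr_div_eq:
  fixes F F' :: "real^2 \<Rightarrow> real^2"
  assumes \<Omega>: "open \<Omega>" and F'[measurable]: "F' \<in> borel_measurable borel"
    and ae: "AE x in lborel. x \<in> \<Omega> \<longrightarrow> F' x = F x" and \<phi>: "\<phi> \<in> test_functions \<Omega>"
  shows "distr_div \<Omega> F \<phi> = - (LBINT x. F' x \<bullet> gradient \<phi> x)"
proof -
  obtain K P where K: "K \<subseteq> \<Omega>" and P: "continuous_on UNIV P" and z: "\<And>x. x \<notin> K \<Longrightarrow> P x = 0" and grad: "gradient \<phi> = P"
    by (rule test_function_gradient[OF \<phi>]) blast
  have [measurable]: "P \<in> borel_measurable borel" using P by (rule borel_measurable_continuous_onI)
  have \<Omega>m: "\<Omega> \<in> sets lebesgue" using \<Omega> by (simp add: borel_open)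
  have z': "P x = 0" if "x \<notin> \<Omega>" for x using z K that by blast
  have aeP: "AE x in lebesgue. F' x \<bullet> P x = indicator \<Omega> x *\<^sub>R (F x \<bullet> P x)"
    using AE_completion[OF ae]
  proof eventually_elim
    case (elim x)
    then show ?case using z'[of x] by (cases "x \<in> \<Omega>") auto
  qed
  have meas: "(\<lambda>x. F' x \<bullet> P x) \<in> borel_measurable lebesgue"
    by (rule measurable_completion) measurable
  then have "(\<lambda>x. indicator \<Omega> x *\<^sub>R (F x \<bullet> P x)) \<in> borel_measurable lebesgue"
    using borel_measurable_AE[OF _ aeP] by simp
  then have "(\<integral>x. indicator \<Omega> x *\<^sub>R (F x \<bullet> P x) \<partial>lebesgue) = (\<integral>x. F' x \<bullet> P x \<partial>lebesgue)"
    using meas aeP by (intro integral_cong_AE) auto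
  also have "\<dots> = (LBINT x. F' x \<bullet> P x)" by (rule integral_completion) measurable
  finally have "(\<integral>x. F x \<bullet> P x \<partial>lebesgue_on \<Omega>) = (LBINT x. F' x \<bullet> P x)"
    using \<Omega>m by (simp add: integral_restrict_space)
  then show ?thesis by (simp add: distr_div_def grad)
qed

lemma AE_lborel_shift:
  fixes z :: "real^2"
  assumes "AE x in lborel. Q x"
  shows "AE x in lborel. Q (x + z)"
proof -
  obtain N where N: "{x. \<not> Q x} \<subseteq> N" "N \<in> null_sets lborel"
    using assms by (auto elim!: AE_E simp: null_sets_def)
  have [measurable]: "N \<in> sets borel" using N(2) by (auto simp: null_sets_def)
  have "emeasure (distr lborel borel ((+) z)) N = emeasure lborel ((+) z -` N \<inter> space lborel)"
    by (rule emeasure_distr) auto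
  then have e0: "emeasure lborel ((+) z -` N) = 0" using N(2) by (simp add: lborel_distr_plus null_sets_def)
  have "(+) z -` N \<in> sets lborel" using measurable_sets_borel[of "(+) z" borel N] by simp
  with e0 have "(+) z -` N \<in> null_sets lborel" by (simp add: null_sets_def)
  then show ?thesis by (rule AE_I') (use N(1) in \<open>auto simp: add.commute\<close>)
qed

text \<open>Convexity of the cube on the half line.\<close>

lemma cube_add_le:
  fixes p q :: real
  assumes "0 \<le> p" "0 \<le> q"
  shows "(p + q)^3 \<le> 4 * (p^3 + q^3)"
proof -
  have "4 * (p^3 + q^3) - (p + q)^3 = 3 * (p + q) * (p - q)\<^sup>2"
    by (simp add: power2_eq_square power3_eq_cube algebra_simps)
  moreover have "0 \<le> 3 * (p + q) * (p - q)\<^sup>2" using assms by simp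
  ultimately show ?thesis by linarith
qed

lemma ennreal_four_times:
  assumes "0 \<le> p" "0 \<le> q"
  shows "ennreal (4 * (p + q)) = 4 * (ennreal p + ennreal q)"
proof -
  have "ennreal (4 * (p + q)) = ennreal 4 * ennreal (p + q)" by (rule ennreal_mult') simp
  then show ?thesis using assms by (simp add: ennreal_plus)
qed

text \<open>A ball with closure in \<open>\<Omega>\<close> is an admissible domain for the local Besov condition, and increments by
  less than its radius starting in the concentric ball of half the radius do not leave it.\<close>

lemma besov_c0_vanishing_increments:
  fixes m m' :: "real^2 \<Rightarrow> real^2"
  assumes \<Omega>: "open \<Omega>" and m' [measurable]: "m' \<in> borel_measurable borel"
    and ae: "AE x in lborel. x \<in> \<Omega> \<longrightarrow> m' x = m x"
    and bes: "m \<in> loc_vec besov_c0 \<Omega>" and a: "a \<in> \<Omega>"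
  shows "\<exists>r>0. vanishing_increments m' (ball a r)"
proof -
  obtain e where e: "e > 0" "cball a e \<subseteq> \<Omega>" using \<Omega> a open_contains_cball by metis
  define U where "U = ball a e"
  define r where "r = e / 2"
  have r: "r > 0" using e by (simp add: r_def)
  have U\<Omega>: "U \<subseteq> \<Omega>" using e(2) by (auto simp: U_def)
  have "compactly_contained U \<Omega>" using e by (simp add: compactly_contained_def U_def)
  moreover have "open U" "connected U" by (simp_all add: U_def)
  ultimately have bc: "(\<lambda>x. m x $ i) \<in> besov_c0 U" for i
    using bes unfolding loc_vec_def by blast
  have Um: "U \<in> sets lebesgue" by (simp add: U_def)
  have "vanishing_increments m' (ball a r)"
    unfolding vanishing_increments_def
  proof (intro allI impI)
    fix \<eta> :: real assume \<eta>: "\<eta> > 0"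
    \<comment> \<open>two components, and a factor \<open>4\<close> from the cube of their sum\<close>
    define c where "c = root 3 (\<eta> / 8)"
    have c: "c > 0" "c^3 = \<eta> / 8" using \<eta> by (simp_all add: c_def real_root_pow_pos2)
    have "\<exists>\<delta>>0. \<forall>z. z \<noteq> 0 \<and> norm z < \<delta> \<longrightarrow>
      (\<integral>\<^sup>+x. ennreal (\<bar>fin_diff U z (\<lambda>x. m x $ i) x\<bar>^3) \<partial>lebesgue_on U) \<le> ennreal (c^3 * norm z)" for i
    proof -
      have "((\<lambda>t. besov_N t (\<lambda>x. m x $ i) U) \<longlongrightarrow> 0) (at_right 0)"
        using bc[of i] by (simp add: besov_c0_def)
      then have "\<forall>\<^sub>F t in at_right 0. besov_N t (\<lambda>x. m x $ i) U < ennreal c"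
        by (rule order_tendstoD(2)) (use c(1) in simp)
      then show ?thesis by (rule besov_N_modulus[OF c(1)]) blast
    qed
    then obtain \<delta> where \<delta>: "\<And>i. \<delta> i > 0" "\<And>i z. z \<noteq> 0 \<Longrightarrow> norm z < \<delta> i \<Longrightarrow>
      (\<integral>\<^sup>+x. ennreal (\<bar>fin_diff U z (\<lambda>x. m x $ i) x\<bar>^3) \<partial>lebesgue_on U) \<le> ennreal (c^3 * norm z)"
      by metis
    define d where "d = min r (min (\<delta> 1) (\<delta> 2))"
    have d: "d > 0" using r \<delta>(1) by (simp add: d_def)
    have "(\<integral>\<^sup>+x. indicator (ball a r) x * ennreal (norm (m' (x + z) - m' x) ^ 3) \<partial>lborel) \<le> ennreal (\<eta> * norm z)"
      if z: "norm z < d" for z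
    proof (cases "z = 0")
      case False
      let ?f = "\<lambda>i x. indicator (ball a r) x * ennreal (\<bar>m' (x + z) $ i - m' x $ i\<bar> ^ 3)"
      have [measurable]: "(\<lambda>x. m' x $ i) \<in> borel_measurable borel" for i
        using measurable_compose[OF m' component_measurable] by simp
      have [measurable]: "(\<lambda>x. m' (x + z) $ i) \<in> borel_measurable borel" for i
      proof -
        have "(\<lambda>x. m' (x + z)) \<in> borel_measurable borel" by measurable
        then show ?thesis using measurable_compose[OF _ component_measurable] by simp
      qed
      have [measurable]: "ball a r \<in> sets borel" by simp
      have [measurable]: "?f i \<in> borel_measurable borel" for i by measurable
      have comp: "(\<integral>\<^sup>+x. ?f i x \<partial>lborel) \<le> ennreal (c^3 * norm z)" if i: "norm z < \<delta> i" for i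
      proof -
        have "(\<integral>\<^sup>+x. ?f i x \<partial>lborel) = (\<integral>\<^sup>+x. ?f i x \<partial>lebesgue)" by (simp add: nn_integral_completion)
        also have "\<dots> \<le> (\<integral>\<^sup>+x. ennreal (\<bar>fin_diff U z (\<lambda>x. m x $ i) x\<bar>^3) * indicator U x \<partial>lebesgue)"
        proof (rule nn_integral_mono_AE)
          show "AE x in lebesgue. ?f i x \<le> ennreal (\<bar>fin_diff U z (\<lambda>x. m x $ i) x\<bar>^3) * indicator U x"
            using AE_completion[OF ae] AE_completion[OF AE_lborel_shift[OF ae, of z]]
          proof eventually_elim
            case (elim x)
            show ?case
            proof (cases "x \<in> ball a r")
              case True
              have "x \<in> U" using True e(1) by (simp add: U_def r_def)
              moreover have "x + z \<in> U"
                using True z dist_triangle[of a "x + z" x] by (simp add: U_def r_def d_def dist_norm)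
              ultimately show ?thesis using elim U\<Omega> True by (auto simp: fin_diff_def)
            qed simp
          qed
        qed
        also have "\<dots> = (\<integral>\<^sup>+x. ennreal (\<bar>fin_diff U z (\<lambda>x. m x $ i) x\<bar>^3) \<partial>lebesgue_on U)"
          by (rule nn_integral_restrict_space[symmetric]) (use Um in simp)
        also have "\<dots> \<le> ennreal (c^3 * norm z)" by (rule \<delta>(2)[OF False i])
        finally show ?thesis .
      qed
      have cube: "norm v ^ 3 \<le> 4 * (\<bar>v $ 1\<bar>^3 + \<bar>v $ 2\<bar>^3)" for v :: "real^2"
      proof -
        have "norm v \<le> \<bar>v $ 1\<bar> + \<bar>v $ 2\<bar>" using norm_le_l1_cart[of v] by (simp add: sum_2)
        then have "norm v ^ 3 \<le> (\<bar>v $ 1\<bar> + \<bar>v $ 2\<bar>)^3" by (intro power_mono) auto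
        also have "\<dots> \<le> 4 * (\<bar>v $ 1\<bar>^3 + \<bar>v $ 2\<bar>^3)" by (intro cube_add_le) auto
        finally show ?thesis .
      qed
      have "(\<integral>\<^sup>+x. indicator (ball a r) x * ennreal (norm (m' (x + z) - m' x) ^ 3) \<partial>lborel)
          \<le> (\<integral>\<^sup>+x. 4 * (?f 1 x + ?f 2 x) \<partial>lborel)"
      proof (intro nn_integral_mono)
        fix x
        show "indicator (ball a r) x * ennreal (norm (m' (x + z) - m' x) ^ 3) \<le> 4 * (?f 1 x + ?f 2 x)"
        proof (cases "x \<in> ball a r")
          case True
          have "ennreal (norm (m' (x + z) - m' x) ^ 3)
              \<le> ennreal (4 * (\<bar>m' (x + z) $ 1 - m' x $ 1\<bar>^3 + \<bar>m' (x + z) $ 2 - m' x $ 2\<bar>^3))"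
            using cube[of "m' (x + z) - m' x"] by (intro ennreal_leI) simp
          also have "\<dots> = 4 * (ennreal (\<bar>m' (x + z) $ 1 - m' x $ 1\<bar>^3) + ennreal (\<bar>m' (x + z) $ 2 - m' x $ 2\<bar>^3))"
            by (rule ennreal_four_times) simp_all
          finally show ?thesis using True by simp
        qed simp
      qed
      also have "\<dots> = 4 * ((\<integral>\<^sup>+x. ?f 1 x \<partial>lborel) + (\<integral>\<^sup>+x. ?f 2 x \<partial>lborel))"
        by (simp add: nn_integral_cmult nn_integral_add)
      also have "\<dots> \<le> 4 * (ennreal (c^3 * norm z) + ennreal (c^3 * norm z))"
        using z by (intro mult_left_mono add_mono comp) (auto simp: d_def)
      also have "\<dots> = ennreal (4 * (c^3 * norm z + c^3 * norm z))"
        by (rule ennreal_four_times[symmetric]) (use c(1) in simp_all)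
      also have "4 * (c^3 * norm z + c^3 * norm z) = \<eta> * norm z" unfolding c(2) by simp
      finally show ?thesis .
    qed simp
    then show "\<exists>\<delta>>0. \<forall>z. norm z < \<delta> \<longrightarrow>
        (\<integral>\<^sup>+x. indicator (ball a r) x * ennreal (norm (m' (x + z) - m' x) ^ 3) \<partial>lborel) \<le> ennreal (\<eta> * norm z)"
      using d by blast
  qed
  then show ?thesis using r by blast
qed

section \<open>Summable Besov scales and the conclusion\<close>

lemma epowr_mono: "0 < a \<Longrightarrow> x \<le> y \<Longrightarrow> epowr x a \<le> epowr y a"
  by (cases "y = \<infinity>"; cases "x = \<infinity>")
    (auto simp: epowr_def top_unique less_top intro!: ennreal_leI powr_mono2 enn2real_mono)

lemma epowr_less_top_iff: "epowr x a < \<infinity> \<longleftrightarrow> x < \<infinity>"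
  by (auto simp: epowr_def less_top)

lemma measurable_epowr [measurable]: "(\<lambda>x. epowr x a) \<in> borel_measurable borel"
  unfolding epowr_def by measurable

definition modulus :: "(real^2) set \<Rightarrow> (real^2 \<Rightarrow> real) \<Rightarrow> real \<Rightarrow> ennreal" where
  "modulus U f t = (SUP z\<in>{z. norm z \<le> t}. L3_norm U (fin_diff U z f))"

lemma besov_N_eq: "0 \<le> t \<Longrightarrow> besov_N t f U = ennreal (t powr (-1/3)) * modulus U f t"
  unfolding besov_N_def modulus_def by (rule SUP_mult_left_ennreal[symmetric])

lemma modulus_mono: "s \<le> t \<Longrightarrow> modulus U f s \<le> modulus U f t"
  unfolding modulus_def by (rule SUP_subset_mono) auto

lemma modulus_measurable [measurable]: "modulus U f \<in> borel_measurable borel"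
proof (rule borel_measurableI_greater)
  fix y
  have "is_interval {t. y < modulus U f t}"
    unfolding is_interval_1 using modulus_mono less_le_trans by blast
  then show "{t \<in> space borel. y < modulus U f t} \<in> sets borel"
    using real_interval_borel_measurable by simp
qed

text \<open>This bounds \<open>besov_N\<close> away from \<open>t = 0\<close>; integrability in \<open>t\<close> alone does not control the endpoint \<open>t = 1\<close>.\<close>

lemma modulus_finite:
  fixes f :: "real^2 \<Rightarrow> real"
  assumes U: "open U" and f: "f \<in> borel_measurable (lebesgue_on U)" and fin: "L3_norm U f < \<infinity>"
  obtains W where "W < \<infinity>" "\<forall>t. modulus U f t \<le> W"
proof -
  have Um: "U \<in> sets lebesgue" using U by (simp add: borel_open)
  define u where "u x = (if x \<in> U then f x else 0)" for x
  have "u \<in> borel_measurable lebesgue" unfolding u_def by (rule borel_measurable_if_I[OF f Um])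
  then obtain g where g [measurable]: "g \<in> borel_measurable lborel" and ae: "AE x in lborel. u x = g x"
    using completion_ex_borel_measurable_real by blast
  have gb [measurable]: "g \<in> borel_measurable borel" using g by simp
  define A where "A = (\<integral>\<^sup>+x. ennreal (\<bar>f x\<bar>^3) \<partial>lebesgue_on U)"
  have Afin: "A < \<infinity>" using fin unfolding L3_norm_def A_def epowr_less_top_iff .
  have gA: "(\<integral>\<^sup>+x. ennreal (\<bar>g x\<bar>^3) \<partial>lborel) = A"
  proof -
    have "A = (\<integral>\<^sup>+x. ennreal (\<bar>f x\<bar>^3) * indicator U x \<partial>lebesgue)"
      unfolding A_def by (rule nn_integral_restrict_space) (use Um in simp)
    also have "\<dots> = (\<integral>\<^sup>+x. ennreal (\<bar>g x\<bar>^3) \<partial>lebesgue)"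
    proof (rule nn_integral_cong_AE)
      show "AE x in lebesgue. ennreal (\<bar>f x\<bar>^3) * indicator U x = ennreal (\<bar>g x\<bar>^3)"
        using AE_completion[OF ae]
      proof eventually_elim
        case (elim x)
        then show ?case by (cases "x \<in> U") (auto simp: u_def)
      qed
    qed
    finally show ?thesis by (simp add: nn_integral_completion)
  qed
  have cube: "\<bar>p - q\<bar>^3 \<le> 4 * (\<bar>p\<bar>^3 + \<bar>q\<bar>^3)" for p q :: real
    by (rule order_trans[OF power_mono[OF abs_triangle_ineq4] cube_add_le]) auto
  have bd: "(\<integral>\<^sup>+x. ennreal (\<bar>fin_diff U z f x\<bar>^3) \<partial>lebesgue_on U) \<le> 4 * (A + A)" for z
  proof -
    have "(\<integral>\<^sup>+x. ennreal (\<bar>fin_diff U z f x\<bar>^3) \<partial>lebesgue_on U)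
        = (\<integral>\<^sup>+x. ennreal (\<bar>fin_diff U z f x\<bar>^3) * indicator U x \<partial>lebesgue)"
      by (rule nn_integral_restrict_space) (use Um in simp)
    also have "\<dots> \<le> (\<integral>\<^sup>+x. 4 * (ennreal (\<bar>g (z + x)\<bar>^3) + ennreal (\<bar>g x\<bar>^3)) \<partial>lebesgue)"
    proof (rule nn_integral_mono_AE)
      show "AE x in lebesgue. ennreal (\<bar>fin_diff U z f x\<bar>^3) * indicator U x
          \<le> 4 * (ennreal (\<bar>g (z + x)\<bar>^3) + ennreal (\<bar>g x\<bar>^3))"
        using AE_completion[OF ae] AE_completion[OF AE_lborel_shift[OF ae, of z]]
      proof eventually_elim
        case (elim x)
        show ?case
        proof (cases "x \<in> U \<and> x + z \<in> U")
          case True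
          then have e: "fin_diff U z f x = g (z + x) - g x"
            using elim by (simp add: fin_diff_def u_def add.commute)
          have "ennreal (\<bar>fin_diff U z f x\<bar>^3) \<le> ennreal (4 * (\<bar>g (z + x)\<bar>^3 + \<bar>g x\<bar>^3))"
            unfolding e by (intro ennreal_leI cube)
          also have "\<dots> = 4 * (ennreal (\<bar>g (z + x)\<bar>^3) + ennreal (\<bar>g x\<bar>^3))"
            by (rule ennreal_four_times) simp_all
          finally show ?thesis using True by simp
        qed (auto simp: fin_diff_def)
      qed
    qed
    also have "\<dots> = (\<integral>\<^sup>+x. 4 * (ennreal (\<bar>g (z + x)\<bar>^3) + ennreal (\<bar>g x\<bar>^3)) \<partial>lborel)"
      by (rule nn_integral_completion)
    also have "\<dots> = 4 * ((\<integral>\<^sup>+x. ennreal (\<bar>g (z + x)\<bar>^3) \<partial>lborel) + (\<integral>\<^sup>+x. ennreal (\<bar>g x\<bar>^3) \<partial>lborel))"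
      by (simp add: nn_integral_cmult nn_integral_add)
    also have "(\<integral>\<^sup>+x. ennreal (\<bar>g (z + x)\<bar>^3) \<partial>lborel) = (\<integral>\<^sup>+x. ennreal (\<bar>g x\<bar>^3) \<partial>lborel)"
      by (rule lborel_nn_integral_shift[of "\<lambda>x. ennreal (\<bar>g x\<bar>^3)"]) measurable
    finally show ?thesis unfolding gA .
  qed
  have "4 * (A + A) < \<infinity>" using Afin by (simp add: ennreal_mult_less_top)
  then have "epowr (4 * (A + A)) (1/3) < \<infinity>" by (simp only: epowr_less_top_iff)
  moreover have "modulus U f t \<le> epowr (4 * (A + A)) (1/3)" for t
    unfolding modulus_def L3_norm_def by (intro SUP_least epowr_mono bd) simp
  ultimately show ?thesis using that by blast
qed

text \<open>The modulus of continuity is monotone in \<open>t\<close>, so a large value of \<open>besov_N\<close> at \<open>t\<close> persists up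
  to a factor on \<open>{t..2*t}\<close>, an interval of fixed mass for \<open>dt/t\<close>; the tails of the convergent
  integral exclude this for small \<open>t\<close>.\<close>

lemma besov_q_imp_c0:
  fixes f :: "real^2 \<Rightarrow> real"
  assumes U: "open U" and q: "q \<ge> 1" and f: "f \<in> besov_q q U"
  shows "f \<in> besov_c0 U"
proof -
  define h where "h t = epowr (besov_N t f U) q * ennreal (1 / t) * indicator {0<..1} t" for t
  define h' where "h' t = epowr (ennreal (t powr (-1/3)) * modulus U f t) q * ennreal (1 / t) * indicator {0<..1} t" for t
  have hh': "h = h'" by (rule ext) (auto simp: h_def h'_def besov_N_eq indicator_def)
  have hm [measurable]: "h \<in> borel_measurable borel" unfolding hh' h'_def[abs_def] by measurable
  have fm: "f \<in> borel_measurable (lebesgue_on U)" using f by (simp add: besov_q_def)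
  have fin: "L3_norm U f < \<infinity>" using f by (simp add: besov_q_def less_top)
  have "epowr (\<integral>\<^sup>+t. h t \<partial>lborel) (1/q) < \<infinity>"
    using f by (simp add: besov_q_def h_def less_top)
  then have J: "(\<integral>\<^sup>+t. h t \<partial>lborel) < \<infinity>" by (simp only: epowr_less_top_iff)
  have "(\<lambda>n. \<integral>\<^sup>+t. h t * indicator {0<..inverse (real (Suc n))} t \<partial>lborel) \<longlonglongrightarrow> (\<integral>\<^sup>+t. 0 \<partial>(lborel :: real measure))"
  proof (rule nn_integral_dominated_convergence[where w=h and u'="\<lambda>_. 0" and
        u="\<lambda>n t. h t * indicator {0<..inverse (real (Suc n))} t"])
    show "AE t in lborel. h t * indicator {0<..inverse (real (Suc n))} t \<le> h t" for n
      by (auto simp: indicator_def)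
    have "(\<lambda>n. h t * indicator {0<..inverse (real (Suc n))} t) \<longlonglongrightarrow> 0" for t
    proof (cases "t > 0")
      case True
      have "eventually (\<lambda>n. inverse (real (Suc n)) < t) sequentially"
        using order_tendstoD(2)[OF LIMSEQ_inverse_real_of_nat True] .
      then have "eventually (\<lambda>n. h t * indicator {0<..inverse (real (Suc n))} t = 0) sequentially"
        by eventually_elim (simp add: indicator_def)
      then show ?thesis by (rule tendsto_eventually)
    qed simp
    then show "AE t in lborel. (\<lambda>n. h t * indicator {0<..inverse (real (Suc n))} t) \<longlonglongrightarrow> 0" by simp
  qed (use J in \<open>simp_all add: less_top[symmetric]\<close>)
  then have tail: "(\<lambda>n. \<integral>\<^sup>+t. h t * indicator {0<..inverse (real (Suc n))} t \<partial>lborel) \<longlonglongrightarrow> 0" by simp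
  have small: "\<exists>\<delta>>0. \<forall>t. 0 < t \<and> t < \<delta> \<longrightarrow> besov_N t f U < ennreal e" if e: "e > 0" for e
  proof -
    \<comment> \<open>a lower bound for the contribution of \<open>{t<..2*t}\<close> to the integral when \<open>besov_N t f U \<ge> e\<close>\<close>
    define c where "c = (e / 2) powr q / 2"
    have c: "c > 0" using e by (simp add: c_def)
    have "eventually (\<lambda>n. (\<integral>\<^sup>+t. h t * indicator {0<..inverse (real (Suc n))} t \<partial>lborel) < ennreal c) sequentially"
      by (rule order_tendstoD(2)[OF tail]) (use c in simp)
    then obtain n where n: "(\<integral>\<^sup>+t. h t * indicator {0<..inverse (real (Suc n))} t \<partial>lborel) < ennreal c"
      unfolding eventually_sequentially by blast
    define d where "d = inverse (real (Suc n))"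
    have d: "0 < d" "d \<le> 1" by (auto simp: d_def inverse_le_1_iff)
    have "besov_N t f U < ennreal e" if t: "0 < t" "t < d / 2" for t
    proof (rule ccontr)
      assume neg: "\<not> ?thesis"
      have low: "ennreal (c / t) \<le> h s * indicator {0<..d} s" if s: "s \<in> {t<..2*t}" for s
      proof -
        have st: "0 < s" "s \<le> d" "s \<le> 1" using s t d by auto
        have "(1/2::real) \<le> 2 powr (-1/3)"
          using powr_mono[of "-1" "-1/3" "2::real"] by (simp add: powr_minus)
        then have "(1/2) * t powr (-1/3) \<le> 2 powr (-1/3) * t powr (-1/3)" by (intro mult_right_mono) auto
        also have "\<dots> = (2 * t) powr (-1/3)" using t by (simp add: powr_mult)
        also have "\<dots> \<le> s powr (-1/3)" using s t by (intro powr_mono2') auto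
        finally have pw: "ennreal ((1/2) * t powr (-1/3)) \<le> ennreal (s powr (-1/3))" by (rule ennreal_leI)
        have "ennreal (e / 2) = ennreal (1/2) * ennreal e" by (subst ennreal_mult'[symmetric]) simp_all
        also have "\<dots> \<le> ennreal (1/2) * besov_N t f U" using neg by (intro mult_left_mono) auto
        also have "\<dots> = ennreal ((1/2) * t powr (-1/3)) * modulus U f t"
        proof -
          have "ennreal ((1/2) * t powr (-1/3)) = ennreal (1/2) * ennreal (t powr (-1/3))"
            by (rule ennreal_mult') simp
          then show ?thesis using t(1) by (simp only: besov_N_eq[OF less_imp_le] mult.assoc)
        qed
        also have "\<dots> \<le> ennreal (s powr (-1/3)) * modulus U f s"
          using s by (intro mult_mono pw modulus_mono) auto
        also have "\<dots> = besov_N s f U" using st by (simp add: besov_N_eq)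
        finally have "epowr (ennreal (e / 2)) q \<le> epowr (besov_N s f U) q" using q by (intro epowr_mono) auto
        then have "ennreal ((e / 2) powr q) \<le> epowr (besov_N s f U) q" using e by (simp add: epowr_def)
        moreover have "ennreal (1 / (2 * t)) \<le> ennreal (1 / s)" using s t by (intro ennreal_leI divide_left_mono) auto
        ultimately have "ennreal ((e / 2) powr q) * ennreal (1 / (2 * t)) \<le> epowr (besov_N s f U) q * ennreal (1 / s)"
          by (intro mult_mono) auto
        moreover have "ennreal ((e / 2) powr q) * ennreal (1 / (2 * t)) = ennreal (c / t)"
          by (subst ennreal_mult'[symmetric]) (simp_all add: c_def)
        ultimately show ?thesis using st by (simp add: h_def)
      qed
      have "ennreal c = ennreal (c / t) * ennreal t" using t c by (subst ennreal_mult'[symmetric]) simp_all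
      also have "\<dots> = (\<integral>\<^sup>+s. ennreal (c / t) * indicator {t<..2*t} s \<partial>lborel)"
        using t by (simp add: nn_integral_cmult_indicator)
      also have "\<dots> \<le> (\<integral>\<^sup>+s. h s * indicator {0<..d} s \<partial>lborel)"
      proof (intro nn_integral_mono)
        show "ennreal (c / t) * indicator {t<..2*t} s \<le> h s * indicator {0<..d} s" for s
          using low[of s] by (cases "s \<in> {t<..2*t}") auto
      qed
      also have "\<dots> < ennreal c" using n by (simp add: d_def)
      finally show False by simp
    qed
    then show ?thesis using d(1) by (intro exI[of _ "d / 2"]) auto
  qed
  have lim: "((\<lambda>t. besov_N t f U) \<longlongrightarrow> 0) (at_right 0)"
  proof (rule order_tendstoI)
    fix a :: ennreal assume "0 < a"
    define e where "e = (if a = \<infinity> then 1 else enn2real a)"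
    have e: "e > 0" "ennreal e \<le> a"
      using \<open>0 < a\<close> by (auto simp: e_def enn2real_positive_iff less_top)
    obtain \<delta> where "\<delta> > 0" "\<forall>t. 0 < t \<and> t < \<delta> \<longrightarrow> besov_N t f U < ennreal e" using small[OF e(1)] by blast
    then show "\<forall>\<^sub>F t in at_right 0. besov_N t f U < a"
      unfolding eventually_at_right_field using e(2) by (intro exI[of _ \<delta>]) (auto intro: less_le_trans)
  qed simp
  obtain W where W: "W < \<infinity>" "\<forall>t. modulus U f t \<le> W" by (rule modulus_finite[OF U fm fin])
  obtain \<delta> where \<delta>: "\<delta> > 0" "\<forall>t. 0 < t \<and> t < \<delta> \<longrightarrow> besov_N t f U < ennreal 1" using small[of 1] by auto
  have "besov_N t f U \<le> ennreal 1 + ennreal (\<delta> powr (-1/3)) * W" if t: "t \<in> {0<..1}" for t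
  proof (cases "t < \<delta>")
    case True
    then have "besov_N t f U \<le> ennreal 1" using \<delta>(2) t by (auto intro: less_imp_le)
    then show ?thesis by (rule order_trans) simp
  next
    case False
    have "besov_N t f U \<le> ennreal (\<delta> powr (-1/3)) * W"
      using t False \<delta>(1) W(2) by (simp add: besov_N_eq) (intro mult_mono ennreal_leI powr_mono2', auto)
    then show ?thesis by (rule order_trans) simp
  qed
  then have "(SUP t\<in>{0<..1}. besov_N t f U) \<le> ennreal 1 + ennreal (\<delta> powr (-1/3)) * W" by (rule SUP_least)
  also have "\<dots> < \<infinity>" using W(1) by (simp add: ennreal_mult_less_top)
  finally have "f \<in> besov_inf U" using fm fin by (simp add: besov_inf_def)
  then show ?thesis using lim by (simp add: besov_c0_def)
qed

lemma null_divergence: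
  assumes "\<And>\<phi>. \<phi> \<in> test_functions \<Omega> \<Longrightarrow> distr_div \<Omega> F \<phi> = 0"
  defines "Z \<equiv> null_measure (restrict_space borel \<Omega>)"
  shows "divergence_is_measure \<Omega> F Z Z" "total_variation \<Omega> Z Z E = 0"
proof -
  show "divergence_is_measure \<Omega> F Z Z"
    using assms(1) by (simp add: divergence_is_measure_def radon_on_def Z_def)
  have "ennreal \<bar>measure Z A - measure Z A\<bar> = 0" for A by simp
  then show "total_variation \<Omega> Z Z E = 0"
    unfolding total_variation_def by (intro antisym SUP_least) simp_all
qed

theorem mainTheorem2:
  fixes \<Omega> :: "(real^2) set" and m :: "real^2 \<Rightarrow> real^2"
  assumes "bounded_Lipschitz_domain \<Omega>"
    and "m \<in> borel_measurable (lebesgue_on \<Omega>)"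
    and "AE x in lebesgue_on \<Omega>. norm (m x) = 1"
    and "\<forall>\<phi>\<in>test_functions \<Omega>. distr_div \<Omega> m \<phi> = 0"
  shows "((\<exists>q\<ge>1. m \<in> loc_vec (besov_q q) \<Omega>) \<longrightarrow> m \<in> loc_vec besov_c0 \<Omega>) \<and>
    (m \<in> loc_vec besov_c0 \<Omega> \<longrightarrow>
      (\<forall>\<Phi>\<in>ENT. \<exists>P N. divergence_is_measure \<Omega> (\<lambda>x. \<Phi> (m x)) P N \<and>
         (\<forall>E\<in>sets (restrict_space borel \<Omega>). total_variation \<Omega> P N E = 0)) \<and>
      (\<exists>S. locally_finite_subset S \<Omega> \<and> has_locally_Lipschitz_rep (\<Omega> - S) m))"
proof (intro conjI impI)
  assume "\<exists>q\<ge>1. m \<in> loc_vec (besov_q q) \<Omega>"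
  then obtain q where q: "q \<ge> 1" "m \<in> loc_vec (besov_q q) \<Omega>" by blast
  show "m \<in> loc_vec besov_c0 \<Omega>"
    unfolding loc_vec_def mem_Collect_eq
  proof (intro allI impI)
    fix U i assume U: "open U \<and> connected U \<and> compactly_contained U \<Omega>"
    then have "(\<lambda>x. m x $ i) \<in> besov_q q U" using q(2) unfolding loc_vec_def by blast
    then show "(\<lambda>x. m x $ i) \<in> besov_c0 U" using besov_q_imp_c0[OF _ q(1)] U by blast
  qed
next
  have \<Omega>: "open \<Omega>" using assms(1) by (simp add: bounded_Lipschitz_domain_def)
  have "\<exists>m'. m' \<in> borel_measurable borel \<and> (\<forall>x. norm (m' x) = 1) \<and> (AE x in lborel. x \<in> \<Omega> \<longrightarrow> m' x = m x)"
    by (rule borel_unit_representative[OF \<Omega> assms(2,3)]) blast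
  then obtain m' where m': "m' \<in> borel_measurable borel" "\<And>x. norm (m' x) = 1"
    and ae: "AE x in lborel. x \<in> \<Omega> \<longrightarrow> m' x = m x"
    by blast
  have div: "weakly_div_free \<Omega> m'"
    using assms(4) distr_div_eq[OF \<Omega> m'(1) ae] by (simp add: weakly_div_free_def)
  assume bes: "m \<in> loc_vec besov_c0 \<Omega>"
  have ent: "weakly_div_free \<Omega> (\<lambda>x. \<Phi> (m' x))" if "\<Phi> \<in> ENT" for \<Phi>
    by (rule entropy_production_vanishes[OF \<Omega> m' div besov_c0_vanishing_increments[OF \<Omega> m'(1) ae bes] that])
  show "\<forall>\<Phi>\<in>ENT. \<exists>P N. divergence_is_measure \<Omega> (\<lambda>x. \<Phi> (m x)) P N \<and>
         (\<forall>E\<in>sets (restrict_space borel \<Omega>). total_variation \<Omega> P N E = 0)"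
  proof
    fix \<Phi> assume \<Phi>: "\<Phi> \<in> ENT"
    have "distr_div \<Omega> (\<lambda>x. \<Phi> (m x)) \<phi> = 0" if \<phi>: "\<phi> \<in> test_functions \<Omega>" for \<phi>
    proof -
      \<comment> \<open>\<open>\<Phi>\<close> is controlled on the circle only; composition with its continuous extension is Borel\<close>
      obtain G :: "real^2 \<Rightarrow> real^2" and \<gamma> :: "real^2 \<Rightarrow> real" and B where
        G: "\<And>z. (G has_derivative (\<lambda>h. \<gamma> z *\<^sub>R h + (1 - z \<bullet> z) *\<^sub>R B z h)) (at z)"
        and G\<Phi>: "\<And>t. G (circ t) = \<Phi> (circ t)"
        by (rule entropy_extension[OF \<Phi>]) blast
      have Gm: "G (m' x) = \<Phi> (m' x)" for x
        using unit_is_circ[OF m'(2)[of x]] G\<Phi> by metis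
      have "continuous_on UNIV G"
        by (intro continuous_at_imp_continuous_on ballI has_derivative_continuous[OF G])
      then have "(\<lambda>x. G (m' x)) \<in> borel_measurable borel"
        using measurable_compose[OF m'(1) borel_measurable_continuous_onI] by blast
      moreover have "AE x in lborel. x \<in> \<Omega> \<longrightarrow> G (m' x) = \<Phi> (m x)"
        using ae
      proof eventually_elim
        case (elim x)
        then show ?case using Gm[of x] by auto
      qed
      ultimately have "distr_div \<Omega> (\<lambda>x. \<Phi> (m x)) \<phi> = - (LBINT x. G (m' x) \<bullet> gradient \<phi> x)"
        by (rule distr_div_eq[OF \<Omega> _ _ \<phi>])
      then show ?thesis using ent[OF \<Phi>] \<phi> by (simp add: Gm weakly_div_free_def)
    qed
    then show "\<exists>P N. divergence_is_measure \<Omega> (\<lambda>x. \<Phi> (m x)) P N \<and>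
         (\<forall>E\<in>sets (restrict_space borel \<Omega>). total_variation \<Omega> P N E = 0)"
      using null_divergence by blast
  qed
  have "\<exists>S n. locally_finite_subset S \<Omega> \<and> open (\<Omega> - S) \<and> (\<forall>x\<in>approx_points m'. n x = m' x) \<and>
      (\<forall>x\<in>\<Omega> - S. \<exists>s>0. \<exists>L. L-lipschitz_on (ball x s) n)"
    by (rule zero_energy_structure[OF \<Omega> m' ent]) (assumption | blast)+
  then obtain S n where S: "locally_finite_subset S \<Omega>" "open (\<Omega> - S)"
    and n: "\<And>x. x \<in> approx_points m' \<Longrightarrow> n x = m' x"
    and lip: "\<And>x. x \<in> \<Omega> - S \<Longrightarrow> \<exists>s>0. \<exists>L. L-lipschitz_on (ball x s) n"
    by blast
  obtain N where N: "N \<in> null_sets lebesgue" "- N \<subseteq> approx_points m'"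
    by (rule approx_points_full[OF m'])
  have "AE x in lebesgue. n x = m' x" by (rule AE_I'[OF N(1)]) (use N(2) n in blast)
  then have "AE x in lebesgue. x \<in> \<Omega> - S \<longrightarrow> n x = m x"
    using AE_completion[OF ae] by eventually_elim simp
  then have "AE x in lebesgue_on (\<Omega> - S). n x = m x"
    using S(2) by (subst AE_restrict_space_iff) (simp_all add: borel_open)
  moreover have "\<exists>r>0. \<exists>L. L-lipschitz_on (ball x r \<inter> (\<Omega> - S)) n" if x: "x \<in> \<Omega> - S" for x
  proof -
    obtain s L where "s > 0" "L-lipschitz_on (ball x s) n" using lip[OF x] by blast
    then show ?thesis using lipschitz_on_subset[of L "ball x s" n "ball x s \<inter> (\<Omega> - S)"] by blast
  qed
  ultimately have "has_locally_Lipschitz_rep (\<Omega> - S) m"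
    unfolding has_locally_Lipschitz_rep_def by blast
  then show "\<exists>S. locally_finite_subset S \<Omega> \<and> has_locally_Lipschitz_rep (\<Omega> - S) m"
    using S(1) by blast
qed

end
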